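(* Let $R\subset S$ be an integral FCP extension of commutative rings. Then ${}^\square_SR\subseteq S$ is radicial and ${}^t_SR={}^\square_SR\cap{}^\circ_SR$, where ${}^\square_SR$ is the $\kappa$-separable closure, ${}^\circ_SR$ the $\kappa$-radicial closure and ${}^t_SR$ the t-closure of $R$ in $S$.
   Context: All rings are commutative and unital; $\subset$ denotes proper inclusion. $[R,S]$ is the set of all $R$-subalgebras of $S$, ordered by inclusion; $R\subseteq S$ has FCP if each chain in $[R,S]$ is finite. For $Q\in\mathrm{Spec}(S)$ the residual extension of $R\subseteq S$ at $Q$ is $\kappa_R(Q\cap R)\to\kappa_S(Q)$, where $\kappa_R(P)=R_P/PR_P$. An integral extension is $\kappa$-separable (resp. $\kappa$-radicial; infra-integral) if all its residual extensions are separable algebraic field extensions (resp. purely inseparable field extensions; isomorphisms). It is radicial if it is $\kappa$-radicial and $\mathrm{Spec}(S)\to\mathrm{Spec}(R)$ is injective. The $\kappa$-separable closure ${}^\square_SR$ (resp. $\kappa$-radicial closure ${}^\circ_SR$; t-closure ${}^t_SR$) is the greatest $V\in[R,S]$ such that $R\subseteq V$ is $\kappa$-separable (resp. $\kappa$-radicial; infra-integral); these exist for integral FCP extensions. *)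

theory Defs
  imports "HOL-Algebra.Finite_Extensions"
begin

subsection \<open>Localization at a prime and residue fields\<close>

definition loc_rel :: "('a, 'b) ring_scheme \<Rightarrow> 'a set \<Rightarrow> (('a \<times> 'a) \<times> ('a \<times> 'a)) set"
  where "loc_rel R P =
    {((a, s), (b, t)). a \<in> carrier R \<and> b \<in> carrier R \<and>
       s \<in> carrier R - P \<and> t \<in> carrier R - P \<and>
       (\<exists>u \<in> carrier R - P. u \<otimes>\<^bsub>R\<^esub> (t \<otimes>\<^bsub>R\<^esub> a \<ominus>\<^bsub>R\<^esub> s \<otimes>\<^bsub>R\<^esub> b) = \<zero>\<^bsub>R\<^esub>)}"

definition loc_frac :: "('a, 'b) ring_scheme \<Rightarrow> 'a set \<Rightarrow> 'a \<Rightarrow> 'a \<Rightarrow> ('a \<times> 'a) set"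
  where "loc_frac R P a s = loc_rel R P `` {(a, s)}"

definition localization :: "('a, 'b) ring_scheme \<Rightarrow> 'a set \<Rightarrow> ('a \<times> 'a) set ring"
  where "localization R P =
    \<lparr>carrier = (carrier R \<times> (carrier R - P)) // loc_rel R P,
     mult = (\<lambda>x y. \<Union>(a, s)\<in>x. \<Union>(b, t)\<in>y. loc_frac R P (a \<otimes>\<^bsub>R\<^esub> b) (s \<otimes>\<^bsub>R\<^esub> t)),
     one = loc_frac R P \<one>\<^bsub>R\<^esub> \<one>\<^bsub>R\<^esub>,
     zero = loc_frac R P \<zero>\<^bsub>R\<^esub> \<one>\<^bsub>R\<^esub>,
     add = (\<lambda>x y. \<Union>(a, s)\<in>x. \<Union>(b, t)\<in>y.
              loc_frac R P (t \<otimes>\<^bsub>R\<^esub> a \<oplus>\<^bsub>R\<^esub> s \<otimes>\<^bsub>R\<^esub> b) (s \<otimes>\<^bsub>R\<^esub> t))\<rparr>"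

text \<open>The extended ideal \<open>P R\<^sub>P\<close> and the residue field \<open>R\<^sub>P / P R\<^sub>P\<close>.\<close>

definition loc_ideal :: "('a, 'b) ring_scheme \<Rightarrow> 'a set \<Rightarrow> ('a \<times> 'a) set set"
  where "loc_ideal R P = Idl\<^bsub>localization R P\<^esub> ((\<lambda>a. loc_frac R P a \<one>\<^bsub>R\<^esub>) ` P)"

definition residue_field :: "('a, 'b) ring_scheme \<Rightarrow> 'a set \<Rightarrow> ('a \<times> 'a) set set ring"
  where "residue_field R P = localization R P Quot loc_ideal R P"

text \<open>
  Ring extensions \<open>R \<subseteq> S\<close> are given by two ring records over the same type, \<open>R\<close> being
  \<open>S\<lparr>carrier := A\<rparr>\<close> for a subring \<open>A\<close> of \<open>S\<close>. For a prime \<open>Q\<close> of \<open>S\<close> and \<open>P = Q \<inter> R\<close>, the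
  map below is the one from \<open>R\<^sub>P / P R\<^sub>P\<close> to \<open>S\<^sub>Q / Q S\<^sub>Q\<close> induced by \<open>a/s \<mapsto> a/s\<close>; as for
  the operations of quotient structures, the union ranges over the representatives.
\<close>

definition residual_map ::
    "('a, 'b) ring_scheme \<Rightarrow> ('a, 'c) ring_scheme \<Rightarrow> 'a set \<Rightarrow>
      ('a \<times> 'a) set set \<Rightarrow> ('a \<times> 'a) set set"
  where "residual_map R S Q c =
    (\<Union>x\<in>c. \<Union>(a, s)\<in>x. loc_ideal S Q +>\<^bsub>localization S Q\<^esub> loc_frac S Q a s)"

definition residual_image ::
    "('a, 'b) ring_scheme \<Rightarrow> ('a, 'c) ring_scheme \<Rightarrow> 'a set \<Rightarrow> ('a \<times> 'a) set set set"
  where "residual_image R S Q =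
    residual_map R S Q ` carrier (residue_field R (Q \<inter> carrier R))"

subsection \<open>Separable and purely inseparable field extensions\<close>

text \<open>
  Polynomials are coefficient lists with the leading coefficient first; the coefficient of
  degree \<open>i\<close> of the formal derivative of \<open>p\<close> is \<open>i + 1\<close> times that of degree \<open>i + 1\<close> of \<open>p\<close>.
\<close>

definition poly_deriv :: "('a, 'b) ring_scheme \<Rightarrow> 'a list \<Rightarrow> 'a list"
  where "poly_deriv L p =
    ring.normalize L
      (map (\<lambda>i. [Suc i] \<cdot>\<^bsub>L\<^esub> (ring.coeff L p (Suc i))) (rev [0..<degree p]))"

definition separable_poly :: "('a, 'b) ring_scheme \<Rightarrow> 'a set \<Rightarrow> 'a list \<Rightarrow> bool"
  where "separable_poly L K p \<longleftrightarrow>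
    \<one>\<^bsub>univ_poly L K\<^esub> gcdof\<^bsub>univ_poly L K\<^esub> p (poly_deriv L p)"

definition separable_field_ext :: "('a, 'b) ring_scheme \<Rightarrow> 'a set \<Rightarrow> bool"
  where "separable_field_ext L K \<longleftrightarrow>
    (\<forall>x \<in> carrier L. ring.algebraic L K x \<and> separable_poly L K (ring.Irr L K x))"

definition char_exponent :: "('a, 'b) ring_scheme \<Rightarrow> nat"
  where "char_exponent L =
    (if \<exists>n::nat. n > 0 \<and> [n] \<cdot>\<^bsub>L\<^esub> \<one>\<^bsub>L\<^esub> = \<zero>\<^bsub>L\<^esub>
     then LEAST n::nat. n > 0 \<and> [n] \<cdot>\<^bsub>L\<^esub> \<one>\<^bsub>L\<^esub> = \<zero>\<^bsub>L\<^esub>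
     else 1)"

definition purely_inseparable_field_ext :: "('a, 'b) ring_scheme \<Rightarrow> 'a set \<Rightarrow> bool"
  where "purely_inseparable_field_ext L K \<longleftrightarrow>
    (\<forall>x \<in> carrier L. \<exists>n::nat. x [^]\<^bsub>L\<^esub> (char_exponent L ^ n) \<in> K)"

subsection \<open>Properties of ring extensions\<close>

definition integral_ext :: "('a, 'b) ring_scheme \<Rightarrow> ('a, 'c) ring_scheme \<Rightarrow> bool"
  where "integral_ext R S \<longleftrightarrow>
    (\<forall>x \<in> carrier S. \<exists>p \<in> carrier (univ_poly S (carrier R)).
       p \<noteq> [] \<and> lead_coeff p = \<one>\<^bsub>S\<^esub> \<and> ring.eval S p x = \<zero>\<^bsub>S\<^esub>)"

definition kappa_separable :: "('a, 'b) ring_scheme \<Rightarrow> ('a, 'c) ring_scheme \<Rightarrow> bool"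
  where "kappa_separable R S \<longleftrightarrow> integral_ext R S \<and>
    (\<forall>Q. primeideal Q S \<longrightarrow> separable_field_ext (residue_field S Q) (residual_image R S Q))"

definition kappa_radicial :: "('a, 'b) ring_scheme \<Rightarrow> ('a, 'c) ring_scheme \<Rightarrow> bool"
  where "kappa_radicial R S \<longleftrightarrow> integral_ext R S \<and>
    (\<forall>Q. primeideal Q S \<longrightarrow>
       purely_inseparable_field_ext (residue_field S Q) (residual_image R S Q))"

definition infra_integral :: "('a, 'b) ring_scheme \<Rightarrow> ('a, 'c) ring_scheme \<Rightarrow> bool"
  where "infra_integral R S \<longleftrightarrow> integral_ext R S \<and>
    (\<forall>Q. primeideal Q S \<longrightarrow>
       residual_map R S Q \<in> ring_iso (residue_field R (Q \<inter> carrier R)) (residue_field S Q))"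

definition radicial :: "('a, 'b) ring_scheme \<Rightarrow> ('a, 'c) ring_scheme \<Rightarrow> bool"
  where "radicial R S \<longleftrightarrow> kappa_radicial R S \<and>
    inj_on (\<lambda>Q. Q \<inter> carrier R) {Q. primeideal Q S}"

subsection \<open>Intermediate rings and closures\<close>

definition intermediate_rings :: "'a set \<Rightarrow> ('a, 'b) ring_scheme \<Rightarrow> 'a set set"
  where "intermediate_rings R S = {V. subring V S \<and> R \<subseteq> V}"

definition FCP :: "'a set \<Rightarrow> ('a, 'b) ring_scheme \<Rightarrow> bool"
  where "FCP R S \<longleftrightarrow> (\<forall>C. subset.chain (intermediate_rings R S) C \<longrightarrow> finite C)"

text \<open>
  \<open>GREATEST\<close> is unspecified when no greatest element exists, so facts about these closures
  include that they exist.
\<close>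

definition kappa_separable_closure :: "'a set \<Rightarrow> ('a, 'b) ring_scheme \<Rightarrow> 'a set"
  where "kappa_separable_closure R S =
    (GREATEST V. V \<in> intermediate_rings R S \<and>
       kappa_separable (S\<lparr>carrier := R\<rparr>) (S\<lparr>carrier := V\<rparr>))"

definition kappa_radicial_closure :: "'a set \<Rightarrow> ('a, 'b) ring_scheme \<Rightarrow> 'a set"
  where "kappa_radicial_closure R S =
    (GREATEST V. V \<in> intermediate_rings R S \<and>
       kappa_radicial (S\<lparr>carrier := R\<rparr>) (S\<lparr>carrier := V\<rparr>))"

definition t_closure :: "'a set \<Rightarrow> ('a, 'b) ring_scheme \<Rightarrow> 'a set"
  where "t_closure R S =
    (GREATEST V. V \<in> intermediate_rings R S \<and>
       infra_integral (S\<lparr>carrier := R\<rparr>) (S\<lparr>carrier := V\<rparr>))"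

end

theory Submission
  imports Defs "HOL-Computational_Algebra.Primes"
begin

text \<open>
  Let \<open>Q\<close> range over the primes of \<open>S\<close>, with residue field \<open>L\<close>, and let \<open>K\<close> be the residue field of \<open>R\<close>
  at \<open>Q \<inter> R\<close>. By lying over, every prime of an intermediate ring is contracted from \<open>S\<close>; hence the
  three closures consist of the \<open>w \<in> S\<close> whose image in each \<open>L\<close> is separable over \<open>K\<close>, is purely
  inseparable over \<open>K\<close>, or lies in \<open>K\<close>, respectively, and the formula for the t-closure can be checked
  in \<open>L\<close>. In characteristic \<open>p\<close> an algebraic \<open>x\<close> is separable over \<open>K\<close> iff \<open>x \<in> K[x\<^sup>p]\<close>; a dimension
  count turns this into closure of the separable elements under the field operations.

  For radiciality let \<open>x \<in> S\<close> and fix \<open>Q\<close> with residue characteristic \<open>p > 0\<close>. By FCP the chain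
  \<open>R[x] \<supseteq> R[x\<^sup>p] \<supseteq> \<dots>\<close> becomes stationary, so some \<open>y = x\<^sup>q\<close>, \<open>q\<close> a power of \<open>p\<close>, lies in \<open>R[y\<^sup>p]\<close> and
  is separable at all primes containing \<open>p\<close>. If \<open>y\<close> is a root of a monic polynomial of degree \<open>d\<close> and
  \<open>m\<close> is the prime-to-\<open>p\<close> part of \<open>d!\<close>, then \<open>m y\<close> is separable at every prime: it vanishes where \<open>m\<close>
  does, and where \<open>d!\<close> is invertible a polynomial of degree \<open>d\<close> gives a separable minimal polynomial.
  So \<open>m x\<^sup>q\<close> is in the separable closure with \<open>m \<notin> Q\<close>. In residue characteristic \<open>0\<close> take \<open>q = 1\<close>
  and \<open>m = d!\<close>.
\<close>

section \<open>Residue fields\<close>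

text \<open>The obstacle is that an element of the separable closure must be separable at all primes
  simultaneously, while residue characteristics vary: a power of \<open>p\<close> only repairs the
  primes containing \<open>p\<close>, and the multiplier \<open>m\<close> has to deal with the
  others without lying in the given prime. The elements so obtained serve twice. At \<open>Q\<close>
  the image of \<open>x\<^sup>q\<close> is the quotient of \<open>m x\<^sup>q\<close> by
  \<open>m\<close>, both from the closure. And if two primes have the same trace on the closure,
  with \<open>m\<close> outside the second, then \<open>x\<close> in the first puts
  \<open>m x\<^sup>q\<close>, hence \<open>x\<close>, into the second, which gives injectivity on
  spectra.

  The criterion \<open>x \<in> K[x\<^sup>p]\<close> is used in place of minimal polynomials because
  a stationary chain of rings yields it verbatim before any passage to residue fields, because it
  survives clearing denominators, and because it is a statement about generation: if
  \<open>x\<close> and \<open>y\<close> satisfy it, then \<open>E = K[x, y]\<close> is generated by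
  \<open>K\<close> and the \<open>p\<close>-th powers of \<open>E\<close>. For
  \<open>z \<in> E\<close> and \<open>F = K[z\<^sup>p]\<close>, Frobenius then carries an
  \<open>F\<close>-basis of \<open>E\<close> to an \<open>F\<close>-basis, and this forces
  \<open>z \<in> F\<close>.\<close>

definition res_frac :: "('a, 'b) ring_scheme \<Rightarrow> 'a set \<Rightarrow> 'a \<Rightarrow> 'a \<Rightarrow> ('a \<times> 'a) set set"
  where "res_frac R P a s = loc_ideal R P +>\<^bsub>localization R P\<^esub> loc_frac R P a s"

definition res_map :: "('a, 'b) ring_scheme \<Rightarrow> 'a set \<Rightarrow> 'a \<Rightarrow> ('a \<times> 'a) set set"
  where "res_map R P a = res_frac R P a \<one>\<^bsub>R\<^esub>"

context primeideal
begin

lemma compl_mult: "s \<in> carrier R - I \<Longrightarrow> t \<in> carrier R - I \<Longrightarrow> s \<otimes> t \<in> carrier R - I"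
  using I_prime by auto

lemma compl_one: "\<one> \<in> carrier R - I"
  using I_notcarr one_imp_carrier by auto

lemma equiv_loc_rel: "equiv (carrier R \<times> (carrier R - I)) (loc_rel R I)"
proof (rule equivI)
  show "loc_rel R I \<subseteq> (carrier R \<times> (carrier R - I)) \<times> carrier R \<times> (carrier R - I)"
    unfolding loc_rel_def by auto
  show "refl_on (carrier R \<times> (carrier R - I)) (loc_rel R I)"
    unfolding loc_rel_def refl_on_def using compl_one
    by (auto intro!: bexI[of _ \<one>] simp: r_neg a_minus_def)
  show "sym (loc_rel R I)"
  proof (rule symI)
    fix x y assume "(x, y) \<in> loc_rel R I"
    then obtain a s b t u where *: "x = (a, s)" "y = (b, t)" "a \<in> carrier R" "b \<in> carrier R"
      "s \<in> carrier R - I" "t \<in> carrier R - I" "u \<in> carrier R - I"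
      "u \<otimes> (t \<otimes> a \<ominus> s \<otimes> b) = \<zero>"
      unfolding loc_rel_def by auto
    have "u \<otimes> (s \<otimes> b \<ominus> t \<otimes> a) = \<ominus> (u \<otimes> (t \<otimes> a \<ominus> s \<otimes> b))"
      using *(3-7) by simp algebra
    thus "(y, x) \<in> loc_rel R I"
      unfolding loc_rel_def using * by auto
  qed
  show "trans (loc_rel R I)"
  proof (rule transI)
    fix x y z assume "(x, y) \<in> loc_rel R I" "(y, z) \<in> loc_rel R I"
    then obtain a s b t u c v w where *: "x = (a, s)" "y = (b, t)" "z = (c, v)"
      "a \<in> carrier R" "b \<in> carrier R" "c \<in> carrier R"
      "s \<in> carrier R - I" "t \<in> carrier R - I" "u \<in> carrier R - I"
      "v \<in> carrier R - I" "w \<in> carrier R - I"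
      and eq: "u \<otimes> (t \<otimes> a \<ominus> s \<otimes> b) = \<zero>" "w \<otimes> (v \<otimes> b \<ominus> t \<otimes> c) = \<zero>"
      unfolding loc_rel_def by auto
    \<comment> \<open>\<open>t (v a - s c) = v (t a - s b) + s (v b - t c)\<close>, so the middle
      denominator joins the witness.\<close>
    have "(u \<otimes> w \<otimes> t) \<otimes> (v \<otimes> a \<ominus> s \<otimes> c) =
        (w \<otimes> v) \<otimes> (u \<otimes> (t \<otimes> a \<ominus> s \<otimes> b)) \<oplus> (u \<otimes> s) \<otimes> (w \<otimes> (v \<otimes> b \<ominus> t \<otimes> c))"
      using *(4-) by simp algebra
    also have "\<dots> = \<zero>" unfolding eq using * by simp
    finally show "(x, z) \<in> loc_rel R I"
      unfolding loc_rel_def using * compl_mult by blast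
  qed
qed

lemma loc_frac_eq_iff:
  assumes "a \<in> carrier R" "b \<in> carrier R" "s \<in> carrier R - I" "t \<in> carrier R - I"
  shows "loc_frac R I a s = loc_frac R I b t \<longleftrightarrow>
    (\<exists>u \<in> carrier R - I. u \<otimes> (t \<otimes> a \<ominus> s \<otimes> b) = \<zero>)"
proof -
  have "loc_frac R I a s = loc_frac R I b t \<longleftrightarrow> ((a, s), (b, t)) \<in> loc_rel R I"
    unfolding loc_frac_def using eq_equiv_class_iff[OF equiv_loc_rel, of "(a, s)" "(b, t)"] assms
    by simp
  thus ?thesis unfolding loc_rel_def using assms by auto
qed

lemma loc_frac_eqI:
  assumes "a \<in> carrier R" "b \<in> carrier R" "s \<in> carrier R - I" "t \<in> carrier R - I"
    and "t \<otimes> a = s \<otimes> b"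
  shows "loc_frac R I a s = loc_frac R I b t"
proof -
  have "\<one> \<otimes> (t \<otimes> a \<ominus> s \<otimes> b) = \<zero>"
    unfolding assms(5) using assms by (simp add: a_minus_def r_neg)
  thus ?thesis using loc_frac_eq_iff[OF assms(1-4)] compl_one by blast
qed

lemma localization_carrierE:
  assumes "x \<in> carrier (localization R I)"
  obtains a s where "a \<in> carrier R" "s \<in> carrier R - I" "x = loc_frac R I a s"
  using assms unfolding localization_def loc_frac_def by (auto elim!: quotientE)

lemma loc_frac_closed:
  "a \<in> carrier R \<Longrightarrow> s \<in> carrier R - I \<Longrightarrow> loc_frac R I a s \<in> carrier (localization R I)"
  unfolding localization_def loc_frac_def by (auto intro: quotientI)

lemma mem_loc_frac:
  assumes "a \<in> carrier R" "s \<in> carrier R - I"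
  shows "(b, t) \<in> loc_frac R I a s \<longleftrightarrow>
    b \<in> carrier R \<and> t \<in> carrier R - I \<and> loc_frac R I b t = loc_frac R I a s"
proof -
  have "(b, t) \<in> loc_frac R I a s \<longleftrightarrow> ((a, s), (b, t)) \<in> loc_rel R I"
    unfolding loc_frac_def by simp
  also have "\<dots> \<longleftrightarrow> b \<in> carrier R \<and> t \<in> carrier R - I \<and>
      (\<exists>u \<in> carrier R - I. u \<otimes> (t \<otimes> a \<ominus> s \<otimes> b) = \<zero>)"
    unfolding loc_rel_def using assms by auto
  also have "\<dots> \<longleftrightarrow> b \<in> carrier R \<and> t \<in> carrier R - I \<and> loc_frac R I b t = loc_frac R I a s"
    using loc_frac_eq_iff[OF assms(1) _ assms(2)] by metis
  finally show ?thesis .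
qed

text \<open>The operations of \<open>localization\<close> are unions over all representatives. A
  class is nonempty, so the union of a family that is constant on it collapses to the common
  value.\<close>

lemma UN_loc_frac:
  assumes "a \<in> carrier R" "s \<in> carrier R - I"
    and "\<And>b t. b \<in> carrier R \<Longrightarrow> t \<in> carrier R - I \<Longrightarrow>
      loc_frac R I b t = loc_frac R I a s \<Longrightarrow> f b t = f a s"
  shows "(\<Union>(b, t)\<in>loc_frac R I a s. f b t) = f a s"
proof -
  have "(a, s) \<in> loc_frac R I a s" using mem_loc_frac[OF assms(1,2)] assms by blast
  moreover have "f b t = f a s" if "(b, t) \<in> loc_frac R I a s" for b t
    using that assms(3) mem_loc_frac[OF assms(1,2)] by blast
  ultimately show ?thesis by fast
qed

lemma loc_mult:
  assumes "a \<in> carrier R" "s \<in> carrier R - I" "b \<in> carrier R" "t \<in> carrier R - I"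
  shows "loc_frac R I a s \<otimes>\<^bsub>localization R I\<^esub> loc_frac R I b t = loc_frac R I (a \<otimes> b) (s \<otimes> t)"
proof -
  \<comment> \<open>Used twice: to change the first representative under the union over the second
    class, and then to collapse that union.\<close>
  have wd: "loc_frac R I (a' \<otimes> b') (s' \<otimes> t') = loc_frac R I (a \<otimes> b) (s \<otimes> t)"
    if c: "a \<in> carrier R" "s \<in> carrier R - I" "b \<in> carrier R" "t \<in> carrier R - I"
      "a' \<in> carrier R" "s' \<in> carrier R - I" "b' \<in> carrier R" "t' \<in> carrier R - I"
    and e: "loc_frac R I a' s' = loc_frac R I a s" "loc_frac R I b' t' = loc_frac R I b t"
    for a s b t a' s' b' t'
  proof -
    obtain u v where u: "u \<in> carrier R - I" "u \<otimes> (s \<otimes> a' \<ominus> s' \<otimes> a) = \<zero>"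
      and v: "v \<in> carrier R - I" "v \<otimes> (t \<otimes> b' \<ominus> t' \<otimes> b) = \<zero>"
      using e loc_frac_eq_iff c by metis
    have "(u \<otimes> v) \<otimes> ((s \<otimes> t) \<otimes> (a' \<otimes> b') \<ominus> (s' \<otimes> t') \<otimes> (a \<otimes> b)) =
      (v \<otimes> t \<otimes> b') \<otimes> (u \<otimes> (s \<otimes> a' \<ominus> s' \<otimes> a)) \<oplus>
      (u \<otimes> s' \<otimes> a) \<otimes> (v \<otimes> (t \<otimes> b' \<ominus> t' \<otimes> b))"
      using c u(1) v(1) by simp algebra
    also have "\<dots> = \<zero>" unfolding u v using c u(1) v(1) by simp
    finally show ?thesis
      using loc_frac_eq_iff[of "a' \<otimes> b'" "a \<otimes> b" "s' \<otimes> t'" "s \<otimes> t"] c compl_mult u(1) v(1)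
      by blast
  qed
  have "loc_frac R I a s \<otimes>\<^bsub>localization R I\<^esub> loc_frac R I b t =
    (\<Union>(a, s)\<in>loc_frac R I a s. \<Union>(b, t)\<in>loc_frac R I b t. loc_frac R I (a \<otimes> b) (s \<otimes> t))"
    unfolding localization_def by simp
  also have "\<dots> = (\<Union>(b, t)\<in>loc_frac R I b t. loc_frac R I (a \<otimes> b) (s \<otimes> t))"
  proof (rule UN_loc_frac[OF assms(1,2)])
    fix a' s' assume "a' \<in> carrier R" "s' \<in> carrier R - I" "loc_frac R I a' s' = loc_frac R I a s"
    thus "(\<Union>(b, t)\<in>loc_frac R I b t. loc_frac R I (a' \<otimes> b) (s' \<otimes> t)) =
      (\<Union>(b, t)\<in>loc_frac R I b t. loc_frac R I (a \<otimes> b) (s \<otimes> t))"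
      using wd[OF assms(1,2) _ _ _ _ _ _ _ refl] mem_loc_frac[OF assms(3,4)]
      by (intro SUP_cong refl) auto
  qed
  also have "\<dots> = loc_frac R I (a \<otimes> b) (s \<otimes> t)"
    by (rule UN_loc_frac[OF assms(3,4)]) (rule wd[OF assms(1-4)]; use assms in auto)
  finally show ?thesis .
qed

lemma loc_add:
  assumes "a \<in> carrier R" "s \<in> carrier R - I" "b \<in> carrier R" "t \<in> carrier R - I"
  shows "loc_frac R I a s \<oplus>\<^bsub>localization R I\<^esub> loc_frac R I b t =
    loc_frac R I (t \<otimes> a \<oplus> s \<otimes> b) (s \<otimes> t)"
proof -
  have wd: "loc_frac R I (t' \<otimes> a' \<oplus> s' \<otimes> b') (s' \<otimes> t') = loc_frac R I (t \<otimes> a \<oplus> s \<otimes> b) (s \<otimes> t)"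
    if c: "a \<in> carrier R" "s \<in> carrier R - I" "b \<in> carrier R" "t \<in> carrier R - I"
      "a' \<in> carrier R" "s' \<in> carrier R - I" "b' \<in> carrier R" "t' \<in> carrier R - I"
    and e: "loc_frac R I a' s' = loc_frac R I a s" "loc_frac R I b' t' = loc_frac R I b t"
    for a s b t a' s' b' t'
  proof -
    obtain u v where u: "u \<in> carrier R - I" "u \<otimes> (s \<otimes> a' \<ominus> s' \<otimes> a) = \<zero>"
      and v: "v \<in> carrier R - I" "v \<otimes> (t \<otimes> b' \<ominus> t' \<otimes> b) = \<zero>"
      using e loc_frac_eq_iff c by metis
    have "(u \<otimes> v) \<otimes> ((s \<otimes> t) \<otimes> (t' \<otimes> a' \<oplus> s' \<otimes> b') \<ominus> (s' \<otimes> t') \<otimes> (t \<otimes> a \<oplus> s \<otimes> b)) =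
      (v \<otimes> t \<otimes> t') \<otimes> (u \<otimes> (s \<otimes> a' \<ominus> s' \<otimes> a)) \<oplus>
      (u \<otimes> s' \<otimes> s) \<otimes> (v \<otimes> (t \<otimes> b' \<ominus> t' \<otimes> b))"
      using c u(1) v(1) by simp algebra
    also have "\<dots> = \<zero>" unfolding u v using c u(1) v(1) by simp
    finally show ?thesis
      using loc_frac_eq_iff[of "t' \<otimes> a' \<oplus> s' \<otimes> b'" "t \<otimes> a \<oplus> s \<otimes> b" "s' \<otimes> t'" "s \<otimes> t"]
        c compl_mult u(1) v(1) by blast
  qed
  have "loc_frac R I a s \<oplus>\<^bsub>localization R I\<^esub> loc_frac R I b t =
    (\<Union>(a, s)\<in>loc_frac R I a s. \<Union>(b, t)\<in>loc_frac R I b t.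
      loc_frac R I (t \<otimes> a \<oplus> s \<otimes> b) (s \<otimes> t))"
    unfolding localization_def by simp
  also have "\<dots> = (\<Union>(b, t)\<in>loc_frac R I b t. loc_frac R I (t \<otimes> a \<oplus> s \<otimes> b) (s \<otimes> t))"
  proof (rule UN_loc_frac[OF assms(1,2)])
    fix a' s' assume "a' \<in> carrier R" "s' \<in> carrier R - I" "loc_frac R I a' s' = loc_frac R I a s"
    thus "(\<Union>(b, t)\<in>loc_frac R I b t. loc_frac R I (t \<otimes> a' \<oplus> s' \<otimes> b) (s' \<otimes> t)) =
      (\<Union>(b, t)\<in>loc_frac R I b t. loc_frac R I (t \<otimes> a \<oplus> s \<otimes> b) (s \<otimes> t))"
      using wd[OF assms(1,2) _ _ _ _ _ _ _ refl] mem_loc_frac[OF assms(3,4)]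
      by (intro SUP_cong refl) auto
  qed
  also have "\<dots> = loc_frac R I (t \<otimes> a \<oplus> s \<otimes> b) (s \<otimes> t)"
    by (rule UN_loc_frac[OF assms(3,4)]) (rule wd[OF assms(1-4)]; use assms in auto)
  finally show ?thesis .
qed

lemma loc_zero: "\<zero>\<^bsub>localization R I\<^esub> = loc_frac R I \<zero> \<one>"
  and loc_one: "\<one>\<^bsub>localization R I\<^esub> = loc_frac R I \<one> \<one>"
  unfolding localization_def by simp_all

lemma localization_cring: "cring (localization R I)"
proof (rule cringI)
  note [simp] = loc_mult loc_add loc_zero loc_one compl_mult compl_one loc_frac_closed
  note [simp del] = Diff_iff
  have M: "s \<in> carrier R - I \<Longrightarrow> s \<in> carrier R" for s by blast
  show "abelian_group (localization R I)"
  proof (rule abelian_groupI)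
    fix x y assume "x \<in> carrier (localization R I)" "y \<in> carrier (localization R I)"
    then obtain a s b t where [simp]: "x = loc_frac R I a s" "y = loc_frac R I b t"
      "a \<in> carrier R" "b \<in> carrier R" "s \<in> carrier R - I" "t \<in> carrier R - I"
      by (metis localization_carrierE)
    note [simp] = M[of s] M[of t]
    show "x \<oplus>\<^bsub>localization R I\<^esub> y \<in> carrier (localization R I)" by simp
    show "x \<oplus>\<^bsub>localization R I\<^esub> y = y \<oplus>\<^bsub>localization R I\<^esub> x"
      by (simp add: a_comm m_comm)
    show "\<exists>y\<in>carrier (localization R I). y \<oplus>\<^bsub>localization R I\<^esub> x = \<zero>\<^bsub>localization R I\<^esub>"
      by (rule bexI[of _ "loc_frac R I (\<ominus> a) s"])
        (simp_all add: r_minus l_neg loc_frac_eqI)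
    fix z assume "z \<in> carrier (localization R I)"
    then obtain c v where [simp]: "z = loc_frac R I c v" "c \<in> carrier R" "v \<in> carrier R - I"
      by (metis localization_carrierE)
    note [simp] = M[of v]
    show "x \<oplus>\<^bsub>localization R I\<^esub> y \<oplus>\<^bsub>localization R I\<^esub> z =
      x \<oplus>\<^bsub>localization R I\<^esub> (y \<oplus>\<^bsub>localization R I\<^esub> z)"
    proof -
      have c: "a \<in> carrier R" "b \<in> carrier R" "c \<in> carrier R"
        "s \<in> carrier R" "t \<in> carrier R" "v \<in> carrier R" by simp_all
      have "v \<otimes> (t \<otimes> a \<oplus> s \<otimes> b) \<oplus> s \<otimes> t \<otimes> c = t \<otimes> v \<otimes> a \<oplus> s \<otimes> (v \<otimes> b \<oplus> t \<otimes> c)"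
        using c by algebra
      thus ?thesis by (simp add: m_assoc)
    qed
  next
    fix x assume "x \<in> carrier (localization R I)"
    then obtain a s where [simp]: "x = loc_frac R I a s" "a \<in> carrier R" "s \<in> carrier R - I"
      by (metis localization_carrierE)
    note [simp] = M[of s]
    show "\<zero>\<^bsub>localization R I\<^esub> \<oplus>\<^bsub>localization R I\<^esub> x = x" by simp
  qed simp
  show "Group.comm_monoid (localization R I)"
  proof (rule comm_monoidI)
    fix x y z assume "x \<in> carrier (localization R I)" "y \<in> carrier (localization R I)"
      "z \<in> carrier (localization R I)"
    then obtain a s b t c v where [simp]: "x = loc_frac R I a s" "y = loc_frac R I b t"
      "a \<in> carrier R" "b \<in> carrier R" "s \<in> carrier R - I" "t \<in> carrier R - I"
      "z = loc_frac R I c v" "c \<in> carrier R" "v \<in> carrier R - I"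
      by (metis localization_carrierE)
    note [simp] = M[of s] M[of t] M[of v]
    show "x \<otimes>\<^bsub>localization R I\<^esub> y \<otimes>\<^bsub>localization R I\<^esub> z =
      x \<otimes>\<^bsub>localization R I\<^esub> (y \<otimes>\<^bsub>localization R I\<^esub> z)"
      by (simp add: m_assoc)
  next
    fix x y assume "x \<in> carrier (localization R I)" "y \<in> carrier (localization R I)"
    then obtain a s b t where [simp]: "x = loc_frac R I a s" "y = loc_frac R I b t"
      "a \<in> carrier R" "b \<in> carrier R" "s \<in> carrier R - I" "t \<in> carrier R - I"
      by (metis localization_carrierE)
    note [simp] = M[of s] M[of t]
    show "x \<otimes>\<^bsub>localization R I\<^esub> y \<in> carrier (localization R I)" by simp
    show "x \<otimes>\<^bsub>localization R I\<^esub> y = y \<otimes>\<^bsub>localization R I\<^esub> x"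
      by (simp add: m_comm)
  next
    fix x assume "x \<in> carrier (localization R I)"
    then obtain a s where [simp]: "x = loc_frac R I a s" "a \<in> carrier R" "s \<in> carrier R - I"
      by (metis localization_carrierE)
    note [simp] = M[of s]
    show "\<one>\<^bsub>localization R I\<^esub> \<otimes>\<^bsub>localization R I\<^esub> x = x" by simp
  qed simp
  fix x y z assume "x \<in> carrier (localization R I)" "y \<in> carrier (localization R I)"
    "z \<in> carrier (localization R I)"
  then obtain a s b t c v where [simp]: "x = loc_frac R I a s" "y = loc_frac R I b t"
    "a \<in> carrier R" "b \<in> carrier R" "s \<in> carrier R - I" "t \<in> carrier R - I"
    "z = loc_frac R I c v" "c \<in> carrier R" "v \<in> carrier R - I"
    by (metis localization_carrierE)
  note [simp] = M[of s] M[of t] M[of v]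
  show "(x \<oplus>\<^bsub>localization R I\<^esub> y) \<otimes>\<^bsub>localization R I\<^esub> z =
    x \<otimes>\<^bsub>localization R I\<^esub> z \<oplus>\<^bsub>localization R I\<^esub> y \<otimes>\<^bsub>localization R I\<^esub> z"
  proof -
    have c: "a \<in> carrier R" "b \<in> carrier R" "c \<in> carrier R"
      "s \<in> carrier R" "t \<in> carrier R" "v \<in> carrier R" by simp_all
    have "(s \<otimes> v \<otimes> (t \<otimes> v)) \<otimes> ((t \<otimes> a \<oplus> s \<otimes> b) \<otimes> c) =
        (s \<otimes> t \<otimes> v) \<otimes> (t \<otimes> v \<otimes> (a \<otimes> c) \<oplus> s \<otimes> v \<otimes> (b \<otimes> c))"
      using c by algebra
    thus ?thesis by (simp add: loc_frac_eqI)
  qed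
qed


text \<open>Equality of the fractions gives \<open>u t a = u s b \<in> I\<close> with
  \<open>u t\<close> outside \<open>I\<close>, and \<open>I\<close> is prime. Hence lying over
  \<open>I\<close> does not depend on the representative.\<close>

lemma loc_frac_zero_iff:
  assumes "a \<in> carrier R" "s \<in> carrier R - I" "b \<in> I" "t \<in> carrier R - I"
    and "loc_frac R I a s = loc_frac R I b t"
  shows "a \<in> I"
proof -
  have b: "b \<in> carrier R" using assms(3) a_subset by blast
  obtain u where u: "u \<in> carrier R - I" "u \<otimes> (t \<otimes> a \<ominus> s \<otimes> b) = \<zero>"
    using loc_frac_eq_iff[OF assms(1) b assms(2,4)] assms(5) by blast
  have "(u \<otimes> t) \<otimes> a = u \<otimes> (t \<otimes> a \<ominus> s \<otimes> b) \<oplus> (u \<otimes> s) \<otimes> b"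
    using u(1) assms(1,2,4) b by simp algebra
  also have "\<dots> \<in> I" unfolding u(2) using u(1) assms b I_l_closed by simp
  finally show ?thesis using I_prime[of "u \<otimes> t" a] compl_mult[OF u(1) assms(4)] assms(1) by blast
qed

lemma loc_minus:
  assumes "a \<in> carrier R" "s \<in> carrier R - I"
  shows "\<ominus>\<^bsub>localization R I\<^esub> loc_frac R I a s = loc_frac R I (\<ominus> a) s"
proof -
  interpret L: cring "localization R I" by (rule localization_cring)
  have "loc_frac R I (\<ominus> a) s \<oplus>\<^bsub>localization R I\<^esub> loc_frac R I a s = \<zero>\<^bsub>localization R I\<^esub>"
    using assms compl_one compl_mult[OF assms(2) assms(2)]
    by (simp add: loc_add loc_zero r_minus l_neg, intro loc_frac_eqI) auto
  thus ?thesis using assms loc_frac_closed by (intro L.minus_equality) auto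
qed

lemma loc_ideal_eq: "loc_ideal R I = {loc_frac R I a s | a s. a \<in> I \<and> s \<in> carrier R - I}" (is "_ = ?J")
  and loc_ideal_ideal: "ideal (loc_ideal R I) (localization R I)"
proof -
  interpret L: cring "localization R I" by (rule localization_cring)
  have IR: "a \<in> I \<Longrightarrow> a \<in> carrier R" for a using a_subset by blast
  have sub: "(\<lambda>a. loc_frac R I a \<one>) ` I \<subseteq> carrier (localization R I)"
    using IR loc_frac_closed compl_one by blast
  show id: "ideal (loc_ideal R I) (localization R I)"
    unfolding loc_ideal_def by (rule L.genideal_ideal[OF sub])
  have J: "ideal ?J (localization R I)"
  proof (rule idealI[OF L.ring_axioms])
    show "subgroup ?J (add_monoid (localization R I))"
    proof (rule L.add.subgroupI)
      show "?J \<subseteq> carrier (localization R I)" using IR loc_frac_closed by blast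
      show "?J \<noteq> {}" using compl_one zero_closed additive_subgroup.zero_closed[OF additive_subgroup_axioms] by blast
    next
      fix x assume "x \<in> ?J"
      then obtain a s where x: "x = loc_frac R I a s" "a \<in> I" "s \<in> carrier R - I" by blast
      hence "\<ominus>\<^bsub>localization R I\<^esub> x = loc_frac R I (\<ominus> a) s" using loc_minus IR by simp
      thus "\<ominus>\<^bsub>localization R I\<^esub> x \<in> ?J" using x by auto
    next
      fix x y assume "x \<in> ?J" "y \<in> ?J"
      then obtain a s b t where x: "x = loc_frac R I a s" "a \<in> I" "s \<in> carrier R - I"
        "y = loc_frac R I b t" "b \<in> I" "t \<in> carrier R - I" by blast
      have "x \<oplus>\<^bsub>localization R I\<^esub> y = loc_frac R I (t \<otimes> a \<oplus> s \<otimes> b) (s \<otimes> t)"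
        using x IR by (simp add: loc_add)
      moreover have "t \<otimes> a \<oplus> s \<otimes> b \<in> I" using x I_l_closed by auto
      ultimately show "x \<oplus>\<^bsub>localization R I\<^esub> y \<in> ?J" using compl_mult x by blast
    qed
  next
    fix x y assume "x \<in> ?J" "y \<in> carrier (localization R I)"
    then obtain a s b t where x: "x = loc_frac R I a s" "a \<in> I" "s \<in> carrier R - I"
      "y = loc_frac R I b t" "b \<in> carrier R" "t \<in> carrier R - I" by (auto elim!: localization_carrierE)
    have *: "y \<otimes>\<^bsub>localization R I\<^esub> x = loc_frac R I (b \<otimes> a) (t \<otimes> s)"
      using x IR by (simp add: loc_mult)
    show **: "y \<otimes>\<^bsub>localization R I\<^esub> x \<in> ?J" unfolding * using compl_mult x I_l_closed by blast
    show "x \<otimes>\<^bsub>localization R I\<^esub> y \<in> ?J"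
      using ** L.m_comm x loc_frac_closed IR by auto
  qed
  show "loc_ideal R I = ?J"
  proof
    show "loc_ideal R I \<subseteq> ?J"
      unfolding loc_ideal_def by (rule L.genideal_minimal[OF J]) (use compl_one in blast)
    show "?J \<subseteq> loc_ideal R I"
    proof
      fix x assume "x \<in> ?J"
      then obtain a s where x: "x = loc_frac R I a s" "a \<in> I" "s \<in> carrier R - I" by blast
      have "x = loc_frac R I \<one> s \<otimes>\<^bsub>localization R I\<^esub> loc_frac R I a \<one>"
        using x IR compl_one by (simp add: loc_mult)
      moreover have "loc_frac R I a \<one> \<in> loc_ideal R I"
        unfolding loc_ideal_def using L.genideal_self[OF sub] x by blast
      ultimately show "x \<in> loc_ideal R I"
        using ideal.I_l_closed[OF id] loc_frac_closed x by simp
    qed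
  qed
qed

lemma loc_frac_mem_ideal:
  assumes "a \<in> carrier R" "s \<in> carrier R - I"
  shows "loc_frac R I a s \<in> loc_ideal R I \<longleftrightarrow> a \<in> I"
  unfolding loc_ideal_eq using loc_frac_zero_iff[OF assms] assms by blast

text \<open>The difference of the fractions has numerator \<open>t a - s b\<close>, and primality
  absorbs the witness \<open>u\<close> of \<open>loc_rel\<close>. From here on, equality in the
  residue field is a membership in \<open>I\<close>.\<close>

lemma res_frac_eq_iff:
  assumes "a \<in> carrier R" "s \<in> carrier R - I" "b \<in> carrier R" "t \<in> carrier R - I"
  shows "res_frac R I a s = res_frac R I b t \<longleftrightarrow> t \<otimes> a \<ominus> s \<otimes> b \<in> I"
proof -
  interpret L: cring "localization R I" by (rule localization_cring)
  interpret J: ideal "loc_ideal R I" "localization R I" by (rule loc_ideal_ideal)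
  have "res_frac R I a s = res_frac R I b t \<longleftrightarrow>
      loc_frac R I a s \<ominus>\<^bsub>localization R I\<^esub> loc_frac R I b t \<in> loc_ideal R I"
    unfolding res_frac_def using L.quotient_eq_iff_same_a_r_cos[OF loc_ideal_ideal]
      loc_frac_closed assms by blast
  also have "loc_frac R I a s \<ominus>\<^bsub>localization R I\<^esub> loc_frac R I b t =
      loc_frac R I (t \<otimes> a \<ominus> s \<otimes> b) (s \<otimes> t)"
    unfolding a_minus_def using assms by (simp add: loc_minus loc_add r_minus)
  finally show ?thesis using loc_frac_mem_ideal compl_mult assms by simp
qed

lemma residue_field_carrierE:
  assumes "x \<in> carrier (residue_field R I)"
  obtains a s where "a \<in> carrier R" "s \<in> carrier R - I" "x = res_frac R I a s"
  using assms unfolding residue_field_def FactRing_def A_RCOSETS_def' res_frac_def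
  by (auto elim!: localization_carrierE)

lemma res_frac_closed:
  "a \<in> carrier R \<Longrightarrow> s \<in> carrier R - I \<Longrightarrow> res_frac R I a s \<in> carrier (residue_field R I)"
  unfolding residue_field_def FactRing_def A_RCOSETS_def' res_frac_def
  using loc_frac_closed by auto

lemma residue_field_carrier:
  "carrier (residue_field R I) = {res_frac R I a s | a s. a \<in> carrier R \<and> s \<in> carrier R - I}"
  using residue_field_carrierE res_frac_closed by blast

lemma res_frac_mult:
  assumes "a \<in> carrier R" "s \<in> carrier R - I" "b \<in> carrier R" "t \<in> carrier R - I"
  shows "res_frac R I a s \<otimes>\<^bsub>residue_field R I\<^esub> res_frac R I b t = res_frac R I (a \<otimes> b) (s \<otimes> t)"
  unfolding residue_field_def FactRing_def res_frac_def
  using ideal.rcoset_mult_add[OF loc_ideal_ideal] loc_frac_closed assms by (simp add: loc_mult)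

lemma res_frac_add:
  assumes "a \<in> carrier R" "s \<in> carrier R - I" "b \<in> carrier R" "t \<in> carrier R - I"
  shows "res_frac R I a s \<oplus>\<^bsub>residue_field R I\<^esub> res_frac R I b t = res_frac R I (t \<otimes> a \<oplus> s \<otimes> b) (s \<otimes> t)"
  unfolding residue_field_def FactRing_def res_frac_def
  using abelian_subgroup.a_rcos_sum[OF abelian_subgroupI3[OF ideal.axioms(1)[OF loc_ideal_ideal]
    cring.axioms(1)[OF localization_cring, THEN ring.is_abelian_group]]] loc_frac_closed assms
  by (simp add: loc_add)

lemma residue_one: "\<one>\<^bsub>residue_field R I\<^esub> = res_frac R I \<one> \<one>"
  unfolding residue_field_def FactRing_def res_frac_def by (simp add: loc_one)

lemma residue_zero: "\<zero>\<^bsub>residue_field R I\<^esub> = res_frac R I \<zero> \<one>"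
proof -
  interpret L: cring "localization R I" by (rule localization_cring)
  interpret J: ideal "loc_ideal R I" "localization R I" by (rule loc_ideal_ideal)
  show ?thesis
    unfolding residue_field_def FactRing_def res_frac_def
    using L.a_rcos_zero[OF loc_ideal_ideal] J.zero_closed by (simp add: loc_zero)
qed

lemma res_frac_zero_iff:
  assumes "a \<in> carrier R" "s \<in> carrier R - I"
  shows "res_frac R I a s = \<zero>\<^bsub>residue_field R I\<^esub> \<longleftrightarrow> a \<in> I"
  unfolding residue_zero using res_frac_eq_iff[OF assms zero_closed compl_one] assms
  by (simp add: a_minus_def)

lemma residue_field_field: "field (residue_field R I)"
proof -
  interpret L: cring "residue_field R I"
    unfolding residue_field_def
    by (rule ideal.quotient_is_cring[OF loc_ideal_ideal localization_cring])
  show ?thesis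
  proof (rule L.cring_fieldI2)
    show "\<zero>\<^bsub>residue_field R I\<^esub> \<noteq> \<one>\<^bsub>residue_field R I\<^esub>"
      unfolding residue_one using res_frac_zero_iff[OF one_closed compl_one] compl_one by auto
  next
    fix x assume x: "x \<in> carrier (residue_field R I)" "x \<noteq> \<zero>\<^bsub>residue_field R I\<^esub>"
    then obtain a s where as: "a \<in> carrier R" "s \<in> carrier R - I" "x = res_frac R I a s"
      by (metis residue_field_carrierE)
    hence a: "a \<in> carrier R - I" using x(2) res_frac_zero_iff by blast
    have "x \<otimes>\<^bsub>residue_field R I\<^esub> res_frac R I s a = \<one>\<^bsub>residue_field R I\<^esub>"
      unfolding residue_one as(3) using as a compl_one compl_mult[OF as(2) a]
      by (simp add: res_frac_mult res_frac_eq_iff m_comm a_minus_def r_neg)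
    thus "\<exists>y \<in> carrier (residue_field R I). x \<otimes>\<^bsub>residue_field R I\<^esub> y = \<one>\<^bsub>residue_field R I\<^esub>"
      using res_frac_closed as a by blast
  qed
qed

lemma res_map_hom: "ring_hom_ring R (residue_field R I) (res_map R I)"
proof -
  interpret L: field "residue_field R I" by (rule residue_field_field)
  show ?thesis
    by (rule ring_hom_ringI[OF ring_axioms L.ring_axioms])
      (use compl_one in \<open>auto simp: res_map_def res_frac_closed res_frac_mult res_frac_add residue_one\<close>)
qed

lemma res_map_zero_iff: "a \<in> carrier R \<Longrightarrow> res_map R I a = \<zero>\<^bsub>residue_field R I\<^esub> \<longleftrightarrow> a \<in> I"
  unfolding res_map_def using res_frac_zero_iff compl_one by blast

lemma res_frac_eq_div:
  assumes "a \<in> carrier R" "s \<in> carrier R - I"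
  shows "res_frac R I a s = res_map R I a \<otimes>\<^bsub>residue_field R I\<^esub> inv\<^bsub>residue_field R I\<^esub> (res_map R I s)"
proof -
  interpret L: field "residue_field R I" by (rule residue_field_field)
  have "res_map R I s \<otimes>\<^bsub>residue_field R I\<^esub> res_frac R I \<one> s = \<one>\<^bsub>residue_field R I\<^esub>"
    unfolding res_map_def residue_one using assms compl_one
    by (simp add: res_frac_mult res_frac_eq_iff m_comm a_minus_def r_neg)
  hence "inv\<^bsub>residue_field R I\<^esub> (res_map R I s) = res_frac R I \<one> s"
    using L.comm_inv_char res_frac_closed assms compl_one unfolding res_map_def by simp
  thus ?thesis using assms compl_one by (simp add: res_map_def res_frac_mult)
qed

lemma subring_prime:
  assumes "subring A R"
  shows "primeideal (I \<inter> A) (R\<lparr>carrier := A\<rparr>)"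
proof -
  note A = subringE[OF assms]
  have c: "cring (R\<lparr>carrier := A\<rparr>)" using subcringI'[OF assms] subcring_iff[OF A(1)] by blast
  interpret C: cring "R\<lparr>carrier := A\<rparr>" by (rule c)
  show ?thesis
  proof (rule primeidealI)
    show "ideal (I \<inter> A) (R\<lparr>carrier := A\<rparr>)"
    proof (rule idealI[OF C.ring_axioms])
      show "subgroup (I \<inter> A) (add_monoid (R\<lparr>carrier := A\<rparr>))"
      proof (rule C.add.subgroupI)
        show "I \<inter> A \<noteq> {}"
          using A(2) additive_subgroup.zero_closed[OF additive_subgroup_axioms] by blast
      next
        fix a assume a: "a \<in> I \<inter> A"
        hence "\<ominus>\<^bsub>R\<lparr>carrier := A\<rparr>\<^esub> a = \<ominus> a"
          using A by (intro C.minus_equality) (auto simp: l_neg)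
        thus "\<ominus>\<^bsub>R\<lparr>carrier := A\<rparr>\<^esub> a \<in> I \<inter> A" using a A by auto
      qed (use A in auto)
    qed (use A I_l_closed I_r_closed in auto)
    show "carrier (R\<lparr>carrier := A\<rparr>) \<noteq> I \<inter> A" using compl_one A(3) by auto
  qed (use c I_prime A(1) in auto)
qed


text \<open>Controls every pair over which the union in \<open>residual_map\<close> ranges, so that
  its value can be read off from a single representative.\<close>

lemma mem_res_frac:
  assumes "a \<in> carrier R" "s \<in> carrier R - I" "x \<in> res_frac R I a s" "(b, t) \<in> x"
  shows "b \<in> carrier R" "t \<in> carrier R - I" "t \<otimes> a \<ominus> s \<otimes> b \<in> I"
proof -
  interpret L: cring "localization R I" by (rule localization_cring)
  interpret J: ideal "loc_ideal R I" "localization R I" by (rule loc_ideal_ideal)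
  have x: "x \<in> carrier (localization R I)"
    using assms L.a_r_coset_subset_G[of "loc_ideal R I" "loc_frac R I a s"] J.a_subset loc_frac_closed
    unfolding res_frac_def by blast
  then obtain b' t' where x': "b' \<in> carrier R" "t' \<in> carrier R - I" "x = loc_frac R I b' t'"
    by (rule localization_carrierE)
  thus bt: "b \<in> carrier R" "t \<in> carrier R - I"
    using mem_loc_frac[OF x'(1,2)] assms(4) by blast+
  have "x = loc_frac R I b t" using mem_loc_frac[OF x'(1,2)] assms(4) x' by blast
  hence "res_frac R I a s = res_frac R I b t"
    using L.a_repr_independence[OF _ _ J.a_subgroup] assms(3) loc_frac_closed[OF assms(1,2)]
    unfolding res_frac_def by blast
  thus "t \<otimes> a \<ominus> s \<otimes> b \<in> I" using res_frac_eq_iff assms bt by blast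
qed

lemma self_mem_res_frac:
  assumes "a \<in> carrier R" "s \<in> carrier R - I"
  shows "loc_frac R I a s \<in> res_frac R I a s" "(a, s) \<in> loc_frac R I a s"
proof -
  interpret L: cring "localization R I" by (rule localization_cring)
  interpret J: ideal "loc_ideal R I" "localization R I" by (rule loc_ideal_ideal)
  show "loc_frac R I a s \<in> res_frac R I a s"
    unfolding res_frac_def using J.a_rcos_self loc_frac_closed[OF assms] by blast
  show "(a, s) \<in> loc_frac R I a s" using mem_loc_frac[OF assms] assms by blast
qed

text \<open>All representatives over \<open>A\<close> satisfy the same cross-multiplied congruence
  modulo \<open>I\<close> when read in \<open>R\<close>, so the union is over one class
  only.\<close>

lemma residual_map_res_frac:
  assumes A: "subring A R" and "a \<in> A" "s \<in> A - I"
  shows "residual_map (R\<lparr>carrier := A\<rparr>) R I (res_frac (R\<lparr>carrier := A\<rparr>) (I \<inter> A) a s) = res_frac R I a s"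
proof -
  let ?A = "R\<lparr>carrier := A\<rparr>"
  interpret P: primeideal "I \<inter> A" ?A by (rule subring_prime[OF A])
  note AE = subringE[OF A]
  have as: "a \<in> carrier ?A" "s \<in> carrier ?A - (I \<inter> A)" using assms by auto
  have "res_frac R I b t = res_frac R I a s"
    if "x \<in> res_frac ?A (I \<inter> A) a s" "(b, t) \<in> x" for x b t
  proof -
    note m = P.mem_res_frac[OF as that]
    have bt: "b \<in> A" "t \<in> A - I" using m by auto
    have "t \<otimes> a \<ominus>\<^bsub>?A\<^esub> s \<otimes> b = t \<otimes> a \<ominus> s \<otimes> b"
      using P.minus_equality[of "\<ominus> (s \<otimes> b)" "s \<otimes> b"] bt AE assms
      by (auto simp: a_minus_def l_neg subset_iff)
    hence "t \<otimes> a \<ominus> s \<otimes> b \<in> I" using m(3) by simp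
    thus ?thesis using res_frac_eq_iff[of a s b t] bt assms AE(1) by blast
  qed
  moreover have "loc_frac ?A (I \<inter> A) a s \<in> res_frac ?A (I \<inter> A) a s" "(a, s) \<in> loc_frac ?A (I \<inter> A) a s"
    using P.self_mem_res_frac[OF as] by auto
  ultimately show ?thesis
    unfolding residual_map_def res_frac_def[symmetric] by fast
qed

lemma residual_image_eq:
  assumes A: "subring A R"
  shows "residual_image (R\<lparr>carrier := A\<rparr>) R I = {res_frac R I a s | a s. a \<in> A \<and> s \<in> A - I}"
proof -
  let ?A = "R\<lparr>carrier := A\<rparr>"
  interpret P: primeideal "I \<inter> A" ?A by (rule subring_prime[OF A])
  have "carrier (residue_field ?A (I \<inter> A)) = {res_frac ?A (I \<inter> A) a s | a s. a \<in> A \<and> s \<in> A - I}"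
    unfolding P.residue_field_carrier by auto
  hence "residual_image ?A R I =
      {residual_map ?A R I (res_frac ?A (I \<inter> A) a s) | a s. a \<in> A \<and> s \<in> A - I}"
    unfolding residual_image_def by auto
  also have "\<dots> = {res_frac R I a s | a s. a \<in> A \<and> s \<in> A - I}"
    by (rule Collect_cong) (metis residual_map_res_frac[OF A])
  finally show ?thesis .
qed

text \<open>Injectivity holds because equality of residue classes is the same membership
  \<open>t a - s b \<in> I\<close> over \<open>A\<close> and over \<open>R\<close>.\<close>

lemma residual_map_inj_hom:
  assumes A: "subring A R"
  shows "residual_map (R\<lparr>carrier := A\<rparr>) R I \<in>
      ring_hom (residue_field (R\<lparr>carrier := A\<rparr>) (I \<inter> A)) (residue_field R I)"
    and "inj_on (residual_map (R\<lparr>carrier := A\<rparr>) R I)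
      (carrier (residue_field (R\<lparr>carrier := A\<rparr>) (I \<inter> A)))"
proof -
  let ?A = "R\<lparr>carrier := A\<rparr>"
  interpret P: primeideal "I \<inter> A" ?A by (rule subring_prime[OF A])
  note AE = subringE[OF A]
  have rep: "\<exists>a s. x = res_frac ?A (I \<inter> A) a s \<and> a \<in> A \<and> s \<in> A - I"
    if "x \<in> carrier (residue_field ?A (I \<inter> A))" for x
    using that unfolding P.residue_field_carrier by auto
  have cl: "\<And>s. s \<in> A - I \<Longrightarrow> s \<in> carrier R - I" "\<And>s. s \<in> A \<Longrightarrow> s \<in> carrier R" using AE(1) by auto
  have one: "\<one> \<in> A - I" using AE compl_one by auto
  show "residual_map ?A R I \<in> ring_hom (residue_field ?A (I \<inter> A)) (residue_field R I)"
  proof (rule ring_hom_memI)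
    fix x assume "x \<in> carrier (residue_field ?A (I \<inter> A))"
    then obtain a s where x: "x = res_frac ?A (I \<inter> A) a s" "a \<in> A" "s \<in> A - I" using rep by blast
    show "residual_map ?A R I x \<in> carrier (residue_field R I)"
      using x res_frac_closed cl residual_map_res_frac[OF A] by simp
    fix y assume "y \<in> carrier (residue_field ?A (I \<inter> A))"
    then obtain b t where y: "y = res_frac ?A (I \<inter> A) b t" "b \<in> A" "t \<in> A - I" using rep by blast
    have st: "s \<otimes> t \<in> A - I" using x y AE cl compl_mult by auto
    show "residual_map ?A R I (x \<otimes>\<^bsub>residue_field ?A (I \<inter> A)\<^esub> y) =
        residual_map ?A R I x \<otimes>\<^bsub>residue_field R I\<^esub> residual_map ?A R I y"
      using x y st AE cl P.res_frac_mult[of a s b t] res_frac_mult[of a s b t]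
      by (simp add: residual_map_res_frac[OF A])
    show "residual_map ?A R I (x \<oplus>\<^bsub>residue_field ?A (I \<inter> A)\<^esub> y) =
        residual_map ?A R I x \<oplus>\<^bsub>residue_field R I\<^esub> residual_map ?A R I y"
      using x y st AE cl P.res_frac_add[of a s b t] res_frac_add[of a s b t]
      by (simp add: residual_map_res_frac[OF A])
  next
    show "residual_map ?A R I \<one>\<^bsub>residue_field ?A (I \<inter> A)\<^esub> = \<one>\<^bsub>residue_field R I\<^esub>"
      using residual_map_res_frac[OF A _ one] one P.residue_one by (simp add: residue_one)
  qed
  show "inj_on (residual_map ?A R I) (carrier (residue_field ?A (I \<inter> A)))"
  proof (rule inj_onI)
    fix x y assume xy: "x \<in> carrier (residue_field ?A (I \<inter> A))" "y \<in> carrier (residue_field ?A (I \<inter> A))"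
      and eq: "residual_map ?A R I x = residual_map ?A R I y"
    obtain a s b t where x: "x = res_frac ?A (I \<inter> A) a s" "a \<in> A" "s \<in> A - I"
      and y: "y = res_frac ?A (I \<inter> A) b t" "b \<in> A" "t \<in> A - I" using rep xy by blast
    have "t \<otimes> a \<ominus> s \<otimes> b \<in> I"
      using eq x y cl res_frac_eq_iff[of a s b t] by (simp add: residual_map_res_frac[OF A])
    moreover have "t \<otimes> a \<ominus>\<^bsub>?A\<^esub> s \<otimes> b = t \<otimes> a \<ominus> s \<otimes> b"
      using P.minus_equality[of "\<ominus> (s \<otimes> b)" "s \<otimes> b"] x y AE
      by (auto simp: a_minus_def l_neg subset_iff)
    moreover have "t \<otimes> a \<ominus> s \<otimes> b \<in> A" using x y AE by (auto simp: a_minus_def)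
    ultimately show "x = y" unfolding x y using P.res_frac_eq_iff[of a s b t] x y by simp
  qed
qed

end

section \<open>Separable elements of a field extension\<close>

lemma (in cring) binomial_expansion:
  assumes [simp]: "x \<in> carrier R" "y \<in> carrier R"
  shows "(x \<oplus> y) [^] (n::nat) = (\<Oplus>k\<in>{..n}. [(n choose k)] \<cdot> (x [^] k \<otimes> y [^] (n - k)))"
proof (induction n)
  case 0 show ?case by simp
next
  case (Suc n)
  let ?f = "\<lambda>k. [(n choose k)] \<cdot> (x [^] k \<otimes> y [^] (n - k))"
  let ?g = "\<lambda>k. [(n choose k)] \<cdot> (x [^] k \<otimes> y [^] (Suc n - k))"
  let ?h = "\<lambda>k. [(Suc n choose k)] \<cdot> (x [^] k \<otimes> y [^] (Suc n - k))"
  have "(x \<oplus> y) [^] Suc n = (\<Oplus>k\<in>{..n}. ?f k) \<otimes> x \<oplus> (\<Oplus>k\<in>{..n}. ?f k) \<otimes> y"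
    using Suc by (simp add: r_distr)
  also have "(\<Oplus>k\<in>{..n}. ?f k) \<otimes> x = (\<Oplus>k\<in>{..n}. [(n choose k)] \<cdot> (x [^] Suc k \<otimes> y [^] (n - k)))"
    by (subst finsum_ldistr) (auto simp: add_pow_ldistr add_pow_rdistr m_ac intro!: finsum_cong')
  also have "(\<Oplus>k\<in>{..n}. ?f k) \<otimes> y = (\<Oplus>k\<in>{..n}. ?g k)"
    by (subst finsum_ldistr) (auto simp: add_pow_ldistr m_assoc Suc_diff_le intro!: finsum_cong')
  also have "(\<Oplus>k\<in>{..n}. ?g k) = (\<Oplus>k\<in>{..Suc n}. ?g k)"
    by (subst finsum_Suc) (auto simp: binomial_eq_0)
  also have "\<dots> = (\<Oplus>k\<in>{..n}. ?g (Suc k)) \<oplus> ?g 0"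
    by (subst finsum_Suc2) auto
  also have "(\<Oplus>k\<in>{..n}. [(n choose k)] \<cdot> (x [^] Suc k \<otimes> y [^] (n - k))) \<oplus>
      ((\<Oplus>k\<in>{..n}. ?g (Suc k)) \<oplus> ?g 0) =
      (\<Oplus>k\<in>{..n}. [(n choose k)] \<cdot> (x [^] Suc k \<otimes> y [^] (n - k)) \<oplus> ?g (Suc k)) \<oplus> ?g 0"
    by (subst finsum_addf) (auto simp: a_assoc)
  also have "(\<Oplus>k\<in>{..n}. [(n choose k)] \<cdot> (x [^] Suc k \<otimes> y [^] (n - k)) \<oplus> ?g (Suc k)) =
      (\<Oplus>k\<in>{..n}. ?h (Suc k))"
    by (rule finsum_cong') (auto simp: add.nat_pow_mult)
  also have "\<dots> \<oplus> ?g 0 = (\<Oplus>k\<in>{..Suc n}. ?h k)"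
  proof -
    have "?h \<in> {..Suc n} \<rightarrow> carrier R" by auto
    from finsum_Suc2[OF this] show ?thesis by (simp del: binomial_Suc_Suc)
  qed
  finally show ?case .
qed

lemma (in ring) add_pow_dvd_zero:
  assumes "[(p::nat)] \<cdot> \<one> = \<zero>" "p dvd m" "x \<in> carrier R"
  shows "[m] \<cdot> x = \<zero>"
proof -
  obtain k where m: "m = p * k" using assms(2) by (rule dvdE)
  have "[p] \<cdot> x = ([p] \<cdot> \<one>) \<otimes> x" using assms(3) by (subst add_pow_ldistr) auto
  hence "[p] \<cdot> x = \<zero>" using assms by simp
  thus ?thesis unfolding m using add.nat_pow_pow[OF assms(3), of k p] by (simp add: mult.commute)
qed

lemma prime_dvd_choose_self:
  assumes "Factorial_Ring.prime (p::nat)" "0 < k" "k < p"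
  shows "p dvd (p choose k)"
proof -
  have "fact k * fact (p - k) * (p choose k) = (fact p :: nat)"
    using assms by (intro binomial_fact_lemma) simp
  hence "p dvd fact k * fact (p - k) * (p choose k)"
    using prime_dvd_fact_iff[OF assms(1), of p] by simp
  moreover have "\<not> p dvd fact k" "\<not> p dvd fact (p - k)"
    using assms prime_dvd_fact_iff[OF assms(1)] by auto
  ultimately show ?thesis using prime_dvd_mult_iff[OF assms(1)] by blast
qed

lemma (in cring) frobenius_add:
  assumes "Factorial_Ring.prime (p::nat)" "[p] \<cdot> \<one> = \<zero>" and [simp]: "x \<in> carrier R" "y \<in> carrier R"
  shows "(x \<oplus> y) [^] p = x [^] p \<oplus> y [^] p"
proof -
  let ?f = "\<lambda>k. [(p choose k)] \<cdot> (x [^] k \<otimes> y [^] (p - k))"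
  \<comment> \<open>Writing \<open>p = n + 2\<close> allows both end terms to be split off; the
    middle indices are then \<open>Suc k\<close> with \<open>k \<le> n\<close>.\<close>
  obtain m where m: "p = Suc m" using prime_gt_0_nat[OF assms(1)] by (cases p) auto
  obtain n where n: "m = Suc n" using prime_gt_1_nat[OF assms(1)] m by (cases m) auto
  have z: "?f (Suc k) = \<zero>" if "k \<le> n" for k
    by (rule add_pow_dvd_zero[OF assms(2) prime_dvd_choose_self[OF assms(1)]]) (use that m n in auto)
  have "(x \<oplus> y) [^] p = (\<Oplus>k\<in>{..p}. ?f k)" by (rule binomial_expansion) auto
  also have "\<dots> = ?f p \<oplus> (\<Oplus>k\<in>{..m}. ?f k)"
    unfolding m by (subst finsum_Suc) (auto simp del: binomial_Suc_Suc)
  also have "(\<Oplus>k\<in>{..m}. ?f k) = (\<Oplus>k\<in>{..n}. ?f (Suc k)) \<oplus> ?f 0"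
    unfolding n by (subst finsum_Suc2) (auto simp del: binomial_Suc_Suc)
  also have "(\<Oplus>k\<in>{..n}. ?f (Suc k)) = (\<Oplus>k\<in>{..n}. \<zero>)"
    by (rule finsum_cong') (use z in auto)
  finally show ?thesis by simp
qed

lemma (in cring) frobenius_pow_add:
  assumes "Factorial_Ring.prime (p::nat)" "[p] \<cdot> \<one> = \<zero>" and [simp]: "x \<in> carrier R" "y \<in> carrier R"
  shows "(x \<oplus> y) [^] (p ^ n) = x [^] (p ^ n) \<oplus> y [^] (p ^ n)"
proof (induction n)
  case (Suc n)
  have "(x \<oplus> y) [^] (p ^ Suc n) = ((x \<oplus> y) [^] (p ^ n)) [^] p"
    by (simp add: nat_pow_pow mult.commute)
  also have "\<dots> = (x [^] (p ^ n)) [^] p \<oplus> (y [^] (p ^ n)) [^] p"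
    unfolding Suc by (rule frobenius_add[OF assms(1,2)]) auto
  finally show ?case by (simp add: nat_pow_pow mult.commute)
qed simp

text \<open>
  Evaluating at \<open>x + \<epsilon>\<close> computes the pair of \<open>f(x)\<close> and \<open>f'(x)\<close>, so the product rule is the
  multiplicativity of evaluation in the dual numbers.
\<close>

definition dual_numbers :: "('a, 'b) ring_scheme \<Rightarrow> ('a \<times> 'a) ring"
  where "dual_numbers R =
    \<lparr>carrier = carrier R \<times> carrier R,
     mult = (\<lambda>(a, b) (c, d). (a \<otimes>\<^bsub>R\<^esub> c, a \<otimes>\<^bsub>R\<^esub> d \<oplus>\<^bsub>R\<^esub> b \<otimes>\<^bsub>R\<^esub> c)),
     one = (\<one>\<^bsub>R\<^esub>, \<zero>\<^bsub>R\<^esub>), zero = (\<zero>\<^bsub>R\<^esub>, \<zero>\<^bsub>R\<^esub>),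
     add = (\<lambda>(a, b) (c, d). (a \<oplus>\<^bsub>R\<^esub> c, b \<oplus>\<^bsub>R\<^esub> d))\<rparr>"

context cring
begin

lemma dual_numbers_cring: "cring (dual_numbers R)"
proof (rule cringI)
  show "abelian_group (dual_numbers R)"
  proof (rule abelian_groupI)
    fix x assume "x \<in> carrier (dual_numbers R)"
    thus "\<exists>y\<in>carrier (dual_numbers R). y \<oplus>\<^bsub>dual_numbers R\<^esub> x = \<zero>\<^bsub>dual_numbers R\<^esub>"
      by (intro bexI[of _ "(\<ominus> fst x, \<ominus> snd x)"]) (auto simp: dual_numbers_def l_neg)
  qed (auto simp: dual_numbers_def a_ac)
  show "Group.comm_monoid (dual_numbers R)"
  proof (rule comm_monoidI)
    fix x y z assume "x \<in> carrier (dual_numbers R)" "y \<in> carrier (dual_numbers R)"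
      "z \<in> carrier (dual_numbers R)"
    thus "x \<otimes>\<^bsub>dual_numbers R\<^esub> y \<otimes>\<^bsub>dual_numbers R\<^esub> z =
        x \<otimes>\<^bsub>dual_numbers R\<^esub> (y \<otimes>\<^bsub>dual_numbers R\<^esub> z)"
      by (auto simp: dual_numbers_def m_assoc l_distr r_distr a_assoc)
  qed (auto simp: dual_numbers_def m_comm a_comm)
  fix x y z assume "x \<in> carrier (dual_numbers R)" "y \<in> carrier (dual_numbers R)"
    "z \<in> carrier (dual_numbers R)"
  thus "(x \<oplus>\<^bsub>dual_numbers R\<^esub> y) \<otimes>\<^bsub>dual_numbers R\<^esub> z =
      x \<otimes>\<^bsub>dual_numbers R\<^esub> z \<oplus>\<^bsub>dual_numbers R\<^esub> y \<otimes>\<^bsub>dual_numbers R\<^esub> z"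
    by (auto simp: dual_numbers_def l_distr a_ac)
qed

lemma dual_numbers_hom: "ring_hom_ring R (dual_numbers R) (\<lambda>a. (a, \<zero>))"
  by (rule ring_hom_ringI[OF ring_axioms cring.axioms(1)[OF dual_numbers_cring]])
    (auto simp: dual_numbers_def)

text \<open>The truncated exponent \<open>n - 1\<close> is harmless at \<open>n = 0\<close>, where
  the coefficient is zero.\<close>

lemma dual_numbers_pow:
  assumes [simp]: "x \<in> carrier R"
  shows "(x, \<one>) [^]\<^bsub>dual_numbers R\<^esub> (n::nat) = (x [^] n, [n] \<cdot> (x [^] (n - 1)))"
proof (induction n)
  case (Suc n)
  have "[n] \<cdot> (x [^] (n - 1)) \<otimes> x = [n] \<cdot> (x [^] n)"
    by (cases n) (simp_all add: add_pow_ldistr l_distr)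
  moreover have "(x, \<one>) [^]\<^bsub>dual_numbers R\<^esub> (Suc n) =
     ((x, \<one>) [^]\<^bsub>dual_numbers R\<^esub> n) \<otimes>\<^bsub>dual_numbers R\<^esub> (x, \<one>)"
    by simp
  ultimately show ?case
    unfolding Suc by (simp add: dual_numbers_def a_comm)
qed (simp add: dual_numbers_def)

text \<open>The value at \<open>x\<close> of the formal derivative: the head of the list has degree
  \<open>length p\<close>. A recursion on the unnormalized list suits induction better than
  \<open>poly_deriv\<close>; \<open>eval_poly_deriv\<close> links the two.\<close>

fun deval :: "'a list \<Rightarrow> 'a \<Rightarrow> 'a" where
  "deval [] x = \<zero>"
| "deval (a # p) x = [length p] \<cdot> (a \<otimes> x [^] (length p - 1)) \<oplus> deval p x"

lemma deval_closed [simp]: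
  "set p \<subseteq> carrier R \<Longrightarrow> x \<in> carrier R \<Longrightarrow> deval p x \<in> carrier R"
  by (induction p) auto

lemma dual_numbers_eval:
  assumes "set p \<subseteq> carrier R" and [simp]: "x \<in> carrier R"
  shows "ring.eval (dual_numbers R) (map (\<lambda>a. (a, \<zero>)) p) (x, \<one>) = (eval p x, deval p x)"
proof -
  interpret D: cring "dual_numbers R" by (rule dual_numbers_cring)
  show ?thesis using assms(1)
  proof (induction p)
    case Nil
    have "D.eval (map (\<lambda>a. (a, \<zero>)) []) (x, \<one>) = \<zero>\<^bsub>dual_numbers R\<^esub>" by simp
    thus ?case by (simp add: dual_numbers_def)
  next
    case (Cons a p)
    hence [simp]: "a \<in> carrier R" "set p \<subseteq> carrier R" by auto
    have "D.eval (map (\<lambda>a. (a, \<zero>)) (a # p)) (x, \<one>) =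
      (a, \<zero>) \<otimes>\<^bsub>dual_numbers R\<^esub> (x [^] length p, [length p] \<cdot> (x [^] (length p - 1)))
      \<oplus>\<^bsub>dual_numbers R\<^esub> (eval p x, deval p x)"
      using Cons by (simp add: dual_numbers_pow)
    also have "\<dots> = (eval (a # p) x, deval (a # p) x)"
      using eval_in_carrier[of p x] by (simp add: dual_numbers_def add_pow_rdistr)
    finally show ?case .
  qed
qed

lemma deval_poly_mult:
  assumes "set p \<subseteq> carrier R" "set q \<subseteq> carrier R" and [simp]: "x \<in> carrier R"
  shows "deval (poly_mult p q) x = eval p x \<otimes> deval q x \<oplus> deval p x \<otimes> eval q x"
proof -
  let ?h = "map (\<lambda>a. (a, \<zero>))"
  have x: "(x, \<one>) \<in> carrier (dual_numbers R)" by (simp add: dual_numbers_def)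
  have cl: "set (?h r) \<subseteq> carrier (dual_numbers R)" if "set r \<subseteq> carrier R" for r
    using that by (auto simp: dual_numbers_def)
  have mult: "(a, b) \<otimes>\<^bsub>dual_numbers R\<^esub> (c, d) = (a \<otimes> c, a \<otimes> d \<oplus> b \<otimes> c)" for a b c d
    by (simp add: dual_numbers_def)
  interpret D: cring "dual_numbers R" by (rule dual_numbers_cring)
  interpret H: ring_hom_ring R "dual_numbers R" "\<lambda>a. (a, \<zero>)" by (rule dual_numbers_hom)
  have "(eval (poly_mult p q) x, deval (poly_mult p q) x) = D.eval (?h (poly_mult p q)) (x, \<one>)"
    by (rule dual_numbers_eval[OF poly_mult_in_carrier[OF assms(1,2)] assms(3), symmetric])
  also have "\<dots> = D.eval (D.normalize (?h (poly_mult p q))) (x, \<one>)"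
    by (rule D.eval_normalize[OF cl[OF poly_mult_in_carrier[OF assms(1,2)]] x, symmetric])
  also have "\<dots> = D.eval (?h p) (x, \<one>) \<otimes>\<^bsub>dual_numbers R\<^esub> D.eval (?h q) (x, \<one>)"
    unfolding H.poly_mult_hom'[OF assms(1,2)]
    by (rule D.eval_poly_mult[OF cl[OF assms(1)] cl[OF assms(2)] x])
  also have "\<dots> = (eval p x, deval p x) \<otimes>\<^bsub>dual_numbers R\<^esub> (eval q x, deval q x)"
    unfolding dual_numbers_eval[OF assms(1,3)] dual_numbers_eval[OF assms(2,3)] ..
  finally show ?thesis unfolding mult by blast
qed

lemma deval_poly_add:
  assumes "set p \<subseteq> carrier R" "set q \<subseteq> carrier R" and [simp]: "x \<in> carrier R"
  shows "deval (poly_add p q) x = deval p x \<oplus> deval q x"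
proof -
  let ?h = "map (\<lambda>a. (a, \<zero>))"
  have x: "(x, \<one>) \<in> carrier (dual_numbers R)" by (simp add: dual_numbers_def)
  have cl: "set (?h r) \<subseteq> carrier (dual_numbers R)" if "set r \<subseteq> carrier R" for r
    using that by (auto simp: dual_numbers_def)
  have add: "(a, b) \<oplus>\<^bsub>dual_numbers R\<^esub> (c, d) = (a \<oplus> c, b \<oplus> d)" for a b c d
    by (simp add: dual_numbers_def)
  interpret D: cring "dual_numbers R" by (rule dual_numbers_cring)
  interpret H: ring_hom_ring R "dual_numbers R" "\<lambda>a. (a, \<zero>)" by (rule dual_numbers_hom)
  have "(eval (poly_add p q) x, deval (poly_add p q) x) = D.eval (?h (poly_add p q)) (x, \<one>)"
    by (rule dual_numbers_eval[OF poly_add_in_carrier[OF assms(1,2)] assms(3), symmetric])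
  also have "\<dots> = D.eval (D.normalize (?h (poly_add p q))) (x, \<one>)"
    by (rule D.eval_normalize[OF cl[OF poly_add_in_carrier[OF assms(1,2)]] x, symmetric])
  also have "\<dots> = D.eval (?h p) (x, \<one>) \<oplus>\<^bsub>dual_numbers R\<^esub> D.eval (?h q) (x, \<one>)"
    unfolding H.poly_add_hom'[OF assms(1,2)]
    by (rule D.eval_poly_add[OF cl[OF assms(1)] cl[OF assms(2)] x])
  also have "\<dots> = (eval p x, deval p x) \<oplus>\<^bsub>dual_numbers R\<^esub> (eval q x, deval q x)"
    unfolding dual_numbers_eval[OF assms(1,3)] dual_numbers_eval[OF assms(2,3)] ..
  finally show ?thesis unfolding add by blast
qed

lemma eval_poly_deriv:
  assumes "set p \<subseteq> carrier R" and [simp]: "x \<in> carrier R"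
  shows "eval (poly_deriv R p) x = deval p x"
proof -
  let ?l = "\<lambda>p. map (\<lambda>i. [Suc i] \<cdot> coeff p (Suc i)) (rev [0..<degree p])"
  have cl: "set (?l q) \<subseteq> carrier R" if "set q \<subseteq> carrier R" for q
    using that coeff_in_carrier[OF that] by auto
  have "eval (?l p) x = deval p x" using assms(1)
  proof (induction p)
    case (Cons a p)
    hence [simp]: "a \<in> carrier R" "set p \<subseteq> carrier R" by auto
    show ?case
    \<comment> \<open>\<open>degree\<close> is a truncated length, so the derivative list only grows
      by one entry when the tail is nonempty.\<close>
    proof (cases p)
      case (Cons b q)
      have eq: "?l (a # p) = ([length p] \<cdot> a) # ?l p"
        unfolding Cons by (auto simp del: add.nat_pow_Suc)
      have "eval (?l (a # p)) x = ([length p] \<cdot> a) \<otimes> x [^] (length p - 1) \<oplus> eval (?l p) x"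
        unfolding eq eval.simps list.sel by simp
      also have "\<dots> = deval (a # p) x"
        using Cons.IH by (simp add: add_pow_ldistr)
      finally show ?thesis .
    qed simp
  qed simp
  thus ?thesis unfolding poly_deriv_def using eval_normalize[OF cl] assms by simp
qed

end

lemma (in ring_hom_ring) hom_add_pow: "a \<in> carrier R \<Longrightarrow> h ([(n::nat)] \<cdot>\<^bsub>R\<^esub> a) = [n] \<cdot>\<^bsub>S\<^esub> (h a)"
  by (induction n) auto

text \<open>In a domain a factorization \<open>n = q m\<close> makes \<open>q\<close> or
  \<open>m\<close> vanish. The divisibility is recorded because it later confines a bad residue
  characteristic to the divisors of a factorial.\<close>

lemma (in domain) ex_prime_char:
  assumes "[(n::nat)] \<cdot> \<one> = \<zero>" "n > 0"
  shows "\<exists>p. Factorial_Ring.prime p \<and> p dvd n \<and> [p] \<cdot> \<one> = \<zero>"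
  using assms
proof (induction n rule: less_induct)
  case (less n)
  have "n \<noteq> 1" using less.prems by auto
  then obtain q where q: "Factorial_Ring.prime q" "q dvd n" using prime_factor_nat by blast
  obtain m where m: "n = q * m" using q(2) by (rule dvdE)
  have "[n] \<cdot> \<one> = ([q] \<cdot> \<one>) \<otimes> ([m] \<cdot> \<one>)"
    using add.nat_pow_pow[of \<one> q m] unfolding m by (simp add: add_pow_ldistr mult.commute)
  hence "[q] \<cdot> \<one> = \<zero> \<or> [m] \<cdot> \<one> = \<zero>" using less.prems(1) integral by force
  thus ?case
  proof
    assume "[m] \<cdot> \<one> = \<zero>"
    moreover have "m < n" "m > 0" using m q(1) less.prems(2) prime_gt_1_nat[OF q(1)] by auto
    ultimately show ?thesis using less.IH[of m] m by (meson dvd_mult)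
  qed (use q in blast)
qed

lemma (in domain) carrier_univ_poly_set:
  "subring K R \<Longrightarrow> p \<in> carrier (K[X]) \<Longrightarrow> set p \<subseteq> carrier R"
  using subringE(1) polynomial_incl unfolding univ_poly_carrier[symmetric] by blast

lemma (in ring) add_pow_mem_subring:
  assumes "subring K R" "k \<in> K" shows "[(n::nat)] \<cdot> k \<in> K"
  using subringE[OF assms(1)] assms(2) by (induction n) auto

lemma (in ring) nat_pow_mem_subring:
  assumes "subring K R" "k \<in> K" shows "k [^] (n::nat) \<in> K"
  using subringE[OF assms(1)] assms(2) by (induction n) auto

lemma (in domain) poly_deriv_closed:
  assumes "subring K R" "p \<in> carrier (K[X])"
  shows "poly_deriv R p \<in> carrier (K[X])"
proof -
  have "set p \<subseteq> K" using assms(2) polynomial_incl unfolding univ_poly_carrier[symmetric] by blast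
  hence sub: "set p \<union> {\<zero>} \<subseteq> K" using subringE(2)[OF assms(1)] by simp
  have "coeff p i \<in> K" for i
    by (rule subsetD[OF sub]) (use rangeI[of "coeff p" i] in \<open>unfold coeff_img(3)\<close>)
  hence "set (map (\<lambda>i. [Suc i] \<cdot> (coeff p (Suc i))) (rev [0..<degree p])) \<subseteq> K"
    using add_pow_mem_subring[OF assms(1)] by (auto simp del: add.nat_pow_Suc)
  thus ?thesis unfolding poly_deriv_def univ_poly_carrier[symmetric]
    by (rule normalize_gives_polynomial)
qed

section \<open>Separability of the minimal polynomial, read off from its derivative at the
  element\<close>

context domain
begin

context
  fixes K x assumes K: "subfield K R" and x: "x \<in> carrier R" and alg: "algebraic K x"
begin

lemma alg_over: "(algebraic over K) x" using alg unfolding over_def .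

lemmas Irr_props = IrrE[OF K x alg_over]

lemma Irr_set: "set (Irr K x) \<subseteq> carrier R"
  using carrier_univ_poly_set[OF subfieldE(1)[OF K] Irr_props(1)] .

text \<open>Writing \<open>f = g h\<close> with \<open>g\<close> the minimal polynomial, the product
  rule gives \<open>f'(x) = g'(x) h(x)\<close>. So any polynomial having \<open>x\<close> as a
  simple root certifies separability.\<close>

lemma deval_Irr_multiple:
  assumes "f \<in> carrier (K[X])" "eval f x = \<zero>" "deval f x \<noteq> \<zero>"
  shows "deval (Irr K x) x \<noteq> \<zero>"
proof
  assume z: "deval (Irr K x) x = \<zero>"
  have "Irr K x pdivides f" by (rule Irr_minimal[OF K x alg_over assms(1,2)])
  then obtain h where h: "h \<in> carrier (poly_ring R)" "f = poly_mult (Irr K x) h"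
    unfolding pdivides_def factor_def univ_poly_mult by blast
  have "set h \<subseteq> carrier R" using carrier_univ_poly_set[OF carrier_is_subring h(1)] .
  hence "deval f x = \<zero>"
    unfolding h(2) using Irr_set x z Irr_props(4) eval_in_carrier
    by (simp add: deval_poly_mult)
  thus False using assms(3) by simp
qed

text \<open>A divisor of an irreducible polynomial is a unit or an associate of it, so the gcd with
  the derivative is nontrivial only if the minimal polynomial divides the derivative, that is, if
  the derivative vanishes at \<open>x\<close>.\<close>

lemma separable_poly_Irr: "separable_poly R K (Irr K x) \<longleftrightarrow> deval (Irr K x) x \<noteq> \<zero>"
proof -
  let ?f = "Irr K x" and ?g = "poly_deriv R (Irr K x)"
  interpret UP: domain "K[X]" by (rule univ_poly_is_domain[OF subfieldE(1)[OF K]])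
  have g: "?g \<in> carrier (K[X])" by (rule poly_deriv_closed[OF subfieldE(1)[OF K] Irr_props(1)])
  have ev: "eval ?g x = deval ?f x" by (rule eval_poly_deriv[OF Irr_set x])
  have dvd: "?f divides\<^bsub>K[X]\<^esub> ?g \<longleftrightarrow> deval ?f x = \<zero>"
  proof
    assume "deval ?f x = \<zero>"
    hence "?f pdivides ?g" using Irr_minimal[OF K x alg_over g] ev by simp
    thus "?f divides\<^bsub>K[X]\<^esub> ?g" using pdivides_iff_shell[OF K Irr_props(1) g] by simp
  next
    assume "?f divides\<^bsub>K[X]\<^esub> ?g"
    hence "?f pdivides ?g" using pdivides_iff_shell[OF K Irr_props(1) g] by simp
    hence "eval ?g x = \<zero>"
      using pdivides_imp_root_sharing[OF carrier_polynomial_shell[OF subfieldE(1)[OF K] Irr_props(1)] _ x Irr_props(4)]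
      by blast
    thus "deval ?f x = \<zero>" using ev by simp
  qed
  show ?thesis
  proof
    assume "separable_poly R K ?f"
    hence *: "y divides\<^bsub>K[X]\<^esub> \<one>\<^bsub>K[X]\<^esub>"
      if "y \<in> carrier (K[X])" "y divides\<^bsub>K[X]\<^esub> ?f" "y divides\<^bsub>K[X]\<^esub> ?g" for y
      using that unfolding separable_poly_def isgcd_def by blast
    show "deval ?f x \<noteq> \<zero>"
    proof
      assume "deval ?f x = \<zero>"
      hence "?f divides\<^bsub>K[X]\<^esub> \<one>\<^bsub>K[X]\<^esub>" using * dvd Irr_props(1) UP.divides_refl by blast
      hence "?f \<in> Units (K[X])" using UP.divides_unit Irr_props(1) UP.Units_one_closed by blast
      thus False using pirreducibleE(2)[OF subfieldE(1)[OF K] Irr_props(1,2)] by blast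
    qed
  next
    assume nz: "deval ?f x \<noteq> \<zero>"
    show "separable_poly R K ?f"
      unfolding separable_poly_def isgcd_def
    proof (intro conjI ballI impI)
      show "\<one>\<^bsub>K[X]\<^esub> divides\<^bsub>K[X]\<^esub> ?f" "\<one>\<^bsub>K[X]\<^esub> divides\<^bsub>K[X]\<^esub> ?g"
        using UP.unit_divides UP.Units_one_closed Irr_props(1) g by blast+
    next
      fix y assume y: "y \<in> carrier (K[X])" "y divides\<^bsub>K[X]\<^esub> ?f \<and> y divides\<^bsub>K[X]\<^esub> ?g"
      have "y \<in> Units (K[X]) \<or> y \<sim>\<^bsub>K[X]\<^esub> ?f"
        using divides_pirreducible_condition[OF Irr_props(2) y(1)] y(2) by blast
      moreover have "\<not> y \<sim>\<^bsub>K[X]\<^esub> ?f"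
        using dvd nz y UP.divides_trans[of ?f y ?g] Irr_props(1) unfolding associated_def by blast
      ultimately show "y divides\<^bsub>K[X]\<^esub> \<one>\<^bsub>K[X]\<^esub>" using UP.unit_divides by blast
    qed
  qed
qed

text \<open>The derivative has leading coefficient \<open>n \<noteq> 0\<close>, where
  \<open>n\<close> is the degree of the minimal polynomial, so it is nonzero of degree
  \<open>n - 1\<close> and too small to be a multiple of the minimal polynomial.\<close>

lemma deval_Irr_degree:
  assumes "[(degree (Irr K x))] \<cdot> \<one> \<noteq> \<zero>"
  shows "deval (Irr K x) x \<noteq> \<zero>"
proof
  let ?f = "Irr K x" and ?g = "poly_deriv R (Irr K x)"
  assume "deval ?f x = \<zero>"
  have g: "?g \<in> carrier (K[X])" by (rule poly_deriv_closed[OF subfieldE(1)[OF K] Irr_props(1)])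
  have "eval ?g x = deval ?f x" by (rule eval_poly_deriv[OF Irr_set x])
  hence dvd: "?f pdivides ?g" using Irr_minimal[OF K x alg_over g] \<open>deval ?f x = \<zero>\<close> by simp
  have pos: "degree ?f \<ge> 1" by (rule pirreducible_degree[OF K Irr_props(1,2)])
  then obtain n where n: "degree ?f = Suc n" by (cases "degree ?f") auto
  let ?l = "map (\<lambda>i. [Suc i] \<cdot> (coeff ?f (Suc i))) (rev [0..<degree ?f])"
  have "coeff ?f (Suc n) = \<one>"
    using lead_coeff_simp[of ?f] Irr_props(3) pirreducibleE(1)[OF subfieldE(1)[OF K] Irr_props(1,2)] n
    by simp
  hence "lead_coeff ?l \<noteq> \<zero>" using assms unfolding n by (simp del: add.nat_pow_Suc)
  hence "length ?g = degree ?f"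
    unfolding poly_deriv_def using normalize_length_eq[of ?l] by (simp del: add.nat_pow_Suc)
  moreover from this have "?g \<noteq> []" using pos by force
  hence "degree ?f \<le> degree ?g"
    using pdivides_imp_degree_le[OF subfieldE(1)[OF K] Irr_props(1) g _ dvd] by blast
  ultimately show False using pos by simp
qed

text \<open>If \<open>x = h(x\<^sup>p)\<close>, then \<open>h(X\<^sup>p) - X\<close> vanishes at
  \<open>x\<close> and has derivative \<open>- 1\<close> there.\<close>

lemma frobenius_generated_imp_deval_Irr:
  assumes "Factorial_Ring.prime (p::nat)" "[p] \<cdot> \<one> = \<zero>" "x \<in> simple_extension K (x [^] p)"
  shows "deval (Irr K x) x \<noteq> \<zero>"
proof -
  note SK = subfieldE(1)[OF K]
  note KE = subringE[OF SK]
  interpret UP: domain "K[X]" by (rule univ_poly_is_domain[OF SK])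
  \<comment> \<open>Values at \<open>x\<close> of polynomials in \<open>X\<^sup>p\<close>; all that
    has to be remembered about such a polynomial is that its derivative vanishes at
    \<open>x\<close>.\<close>
  have lift: "\<exists>f \<in> carrier (K[X]). eval f x = y \<and> deval f x = \<zero>"
    if "y \<in> simple_extension K (x [^] p)" for y
    using that
  proof (induction rule: simple_extension.induct)
    case zero show ?case using univ_poly_zero_closed by (intro bexI[of _ "[]"]) auto
  next
    case (lin k1 k2)
    then obtain f where f: "f \<in> carrier (K[X])" "eval f x = k1" "deval f x = \<zero>" by blast
    have fs: "set f \<subseteq> carrier R" by (rule carrier_univ_poly_set[OF SK f(1)])
    let ?m = "monom \<one> p"
    have k2: "k2 \<in> carrier R" using lin KE(1) by blast
    have ms: "set ?m \<subseteq> carrier R" by (rule monom_in_carrier) simp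
    have dm: "deval ?m x = \<zero>"
    proof -
      have "deval (replicate n \<zero>) x = \<zero>" for n
        using x by (induction n) auto
      thus ?thesis unfolding monom_def
        using add_pow_dvd_zero[OF assms(2) dvd_refl] x by simp
    qed
    let ?g = "f \<otimes>\<^bsub>K[X]\<^esub> ?m \<oplus>\<^bsub>K[X]\<^esub> poly_of_const k2"
    have mc: "?m \<in> carrier (K[X])"
      using unitary_monom_eq_var_pow[OF SK] var_pow_closed[OF SK] by simp
    have cc: "poly_of_const k2 \<in> carrier (K[X])"
      unfolding poly_of_const_def univ_poly_carrier[symmetric] using lin(2)
      by (intro normalize_gives_polynomial) auto
    have cs: "set (poly_of_const k2) \<subseteq> carrier R" by (rule carrier_univ_poly_set[OF SK cc])
    have ec: "eval (poly_of_const k2) x = k2" "deval (poly_of_const k2) x = \<zero>"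
      unfolding poly_of_const_def using k2 x by auto
    have gc: "?g \<in> carrier (K[X])" using f mc cc by simp
    have pm: "set (poly_mult f ?m) \<subseteq> carrier R" by (rule poly_mult_in_carrier[OF fs ms])
    have "eval ?g x = k1 \<otimes> x [^] p \<oplus> k2"
      unfolding univ_poly_mult univ_poly_add
      using eval_poly_add[OF pm cs x] eval_poly_mult[OF fs ms x] eval_monom[OF one_closed x] ec f x by simp
    moreover have "deval ?g x = \<zero>"
      unfolding univ_poly_mult univ_poly_add
      using deval_poly_add[OF pm cs x] deval_poly_mult[OF fs ms x] dm ec f
        eval_in_carrier[OF fs x] eval_in_carrier[OF ms x] by simp
    ultimately show ?case using gc by blast
  qed
  obtain f where f: "f \<in> carrier (K[X])" "eval f x = x" "deval f x = \<zero>" using lift[OF assms(3)] by blast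
  have fs: "set f \<subseteq> carrier R" by (rule carrier_univ_poly_set[OF SK f(1)])
  \<comment> \<open>The polynomial \<open>- X\<close>.\<close>
  let ?l = "[\<ominus> \<one>, \<zero>]"
  have nz: "\<ominus> \<one> \<noteq> \<zero>" using one_not_zero by (metis minus_minus minus_zero one_closed)
  have lc: "?l \<in> carrier (K[X])"
    unfolding univ_poly_carrier[symmetric] using KE nz by (auto simp: polynomial_def)
  have ls: "set ?l \<subseteq> carrier R" by simp
  have el: "eval ?l x = \<ominus> x" "deval ?l x = \<ominus> \<one>" using x by (auto simp: l_minus)
  have c: "f \<oplus>\<^bsub>K[X]\<^esub> ?l \<in> carrier (K[X])" using f lc by simp
  show ?thesis
  proof (rule deval_Irr_multiple[OF c])
    show "eval (f \<oplus>\<^bsub>K[X]\<^esub> ?l) x = \<zero>"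
      unfolding univ_poly_add eval_poly_add[OF fs ls x] f el using x by (simp add: r_neg)
    show "deval (f \<oplus>\<^bsub>K[X]\<^esub> ?l) x \<noteq> \<zero>"
      unfolding univ_poly_add deval_poly_add[OF fs ls x] f el using nz by simp
  qed
qed

end

end

section \<open>Separable elements are generated by their \<open>p\<close>-th power\<close>

context field
begin

lemma minus_pow_prime_char:
  assumes "Factorial_Ring.prime (p::nat)" "[p] \<cdot> \<one> = \<zero>" "x \<in> carrier R"
  shows "(\<ominus> x) [^] p = \<ominus> (x [^] p)"
proof -
  have "\<zero> = (\<ominus> x \<oplus> x) [^] p" using assms prime_gt_0_nat[OF assms(1)] by (simp add: l_neg nat_pow_zero)
  also have "\<dots> = (\<ominus> x) [^] p \<oplus> x [^] p" using frobenius_add[OF assms(1,2)] assms(3) by simp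
  finally show ?thesis using assms by (intro minus_equality[symmetric]) auto
qed

lemma roots_linear_pow:
  assumes "a \<in> carrier R"
  shows "roots ([\<one>, \<ominus> a] [^]\<^bsub>poly_ring R\<^esub> (n::nat)) = replicate_mset n a"
proof -
  interpret UP: domain "poly_ring R" by (rule univ_poly_is_domain[OF carrier_is_subring])
  have l: "[\<one>, \<ominus> a] \<in> carrier (poly_ring R)"
    unfolding univ_poly_carrier[symmetric] using assms by (auto simp: polynomial_def)
  show ?thesis
  proof (induction n)
    case 0
    have "[\<one>] \<in> carrier (poly_ring R)" using UP.one_closed unfolding univ_poly_one .
    thus ?case using degree_zero_imp_empty_roots[of "[\<one>]"] by (simp add: univ_poly_one)
  next
    case (Suc n)
    have "[\<one>, \<ominus> a] [^]\<^bsub>poly_ring R\<^esub> Suc n = [\<one>, \<ominus> a] \<otimes>\<^bsub>poly_ring R\<^esub> ([\<one>, \<ominus> a] [^]\<^bsub>poly_ring R\<^esub> n)"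
      using UP.nat_pow_Suc2[OF l] by simp
    thus ?case
      using poly_mult_degree_one_monic_imp_same_roots[OF assms UP.nat_pow_closed[OF l]
          polynomial_pow_not_zero[OF l]] Suc by simp
  qed
qed

text \<open>Frobenius in the polynomial ring. The right-hand side shows that the coefficients lie in
  every subfield containing \<open>x\<^sup>p\<close>.\<close>

lemma linear_pow_prime_char:
  assumes "Factorial_Ring.prime (p::nat)" "[p] \<cdot> \<one> = \<zero>" "x \<in> carrier R"
  shows "[\<one>, \<ominus> x] [^]\<^bsub>poly_ring R\<^esub> p = monom \<one> p \<oplus>\<^bsub>poly_ring R\<^esub> poly_of_const (\<ominus> (x [^] p))"
proof -
  interpret UP: domain "poly_ring R" by (rule univ_poly_is_domain[OF carrier_is_subring])
  interpret H: ring_hom_ring R "poly_ring R" poly_of_const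
    using canonical_embedding_ring_hom[OF carrier_is_subring] by simp
  have X: "X \<in> carrier (poly_ring R)" using var_closed[OF carrier_is_subring] by simp
  have char: "[p] \<cdot>\<^bsub>poly_ring R\<^esub> \<one>\<^bsub>poly_ring R\<^esub> = \<zero>\<^bsub>poly_ring R\<^esub>"
    using H.hom_add_pow[OF one_closed, of p] assms(2) by simp
  have "[\<one>, \<ominus> x] = X \<oplus>\<^bsub>poly_ring R\<^esub> poly_of_const (\<ominus> x)"
    unfolding var_def univ_poly_add poly_of_const_def using assms(3) by auto
  hence "[\<one>, \<ominus> x] [^]\<^bsub>poly_ring R\<^esub> p = (X \<oplus>\<^bsub>poly_ring R\<^esub> poly_of_const (\<ominus> x)) [^]\<^bsub>poly_ring R\<^esub> p" by simp
  also have "\<dots> = X [^]\<^bsub>poly_ring R\<^esub> p \<oplus>\<^bsub>poly_ring R\<^esub> poly_of_const (\<ominus> x) [^]\<^bsub>poly_ring R\<^esub> p"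
    by (rule UP.frobenius_add[OF assms(1) char X]) (use assms(3) in simp)
  also have "poly_of_const (\<ominus> x) [^]\<^bsub>poly_ring R\<^esub> p = poly_of_const (\<ominus> (x [^] p))"
    using H.hom_nat_pow[of "\<ominus> x" p] minus_pow_prime_char[OF assms] assms(3) by simp
  finally show ?thesis unfolding unitary_monom_eq_var_pow[OF carrier_is_subring] .
qed

text \<open>The minimal polynomial divides \<open>(X - x)\<^sup>p\<close>, so it splits with
  \<open>x\<close> as its only root. As that root is simple, the polynomial is linear and its
  constant term is \<open>- x\<close>.\<close>

lemma simple_root_pow_mem:
  assumes F: "subfield F R" and x: "x \<in> carrier R" "algebraic F x"
    and p: "Factorial_Ring.prime (p::nat)" "[p] \<cdot> \<one> = \<zero>" and xp: "x [^] p \<in> F"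
    and sep: "deval (Irr F x) x \<noteq> \<zero>"
  shows "x \<in> F"
proof -
  let ?G = "Irr F x" and ?l = "[\<one>, \<ominus> x]"
  note SF = subfieldE(1)[OF F]
  note FE = subringE[OF SF]
  note I = Irr_props[OF F x]
  have Gc: "?G \<in> carrier (poly_ring R)" by (rule carrier_polynomial_shell[OF SF I(1)])
  interpret UP: domain "poly_ring R" by (rule univ_poly_is_domain[OF carrier_is_subring])
  interpret UF: domain "F[X]" by (rule univ_poly_is_domain[OF SF])
  have l: "?l \<in> carrier (poly_ring R)"
    unfolding univ_poly_carrier[symmetric] using x by (auto simp: polynomial_def)
  have ls: "set ?l \<subseteq> carrier R" using x by simp
  have lp: "?l [^]\<^bsub>poly_ring R\<^esub> p \<in> carrier (poly_ring R)" using l by simp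
  have lp0: "?l [^]\<^bsub>poly_ring R\<^esub> p \<noteq> []" by (rule polynomial_pow_not_zero[OF l]) simp
  have "?l [^]\<^bsub>poly_ring R\<^esub> p = monom \<one> p \<oplus>\<^bsub>F[X]\<^esub> poly_of_const (\<ominus> (x [^] p))"
    unfolding linear_pow_prime_char[OF p x(1)] univ_poly_add ..
  moreover have "monom \<one> p \<in> carrier (F[X])"
    using unitary_monom_eq_var_pow[OF SF] var_pow_closed[OF SF] by simp
  moreover have "poly_of_const (\<ominus> (x [^] p)) \<in> carrier (F[X])"
    unfolding poly_of_const_def univ_poly_carrier[symmetric] using xp FE
    by (intro normalize_gives_polynomial) auto
  ultimately have lpF: "?l [^]\<^bsub>poly_ring R\<^esub> p \<in> carrier (F[X])" by simp
  have "eval (?l [^]\<^bsub>poly_ring R\<^esub> p) x = (eval ?l x) [^] p"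
    using ring_hom_ring.hom_nat_pow[OF eval_ring_hom[OF carrier_is_subring x(1)] l] by simp
  also have "\<dots> = \<zero>" using x prime_gt_0_nat[OF p(1)] by (simp add: r_neg nat_pow_zero)
  finally have dvd: "?G pdivides (?l [^]\<^bsub>poly_ring R\<^esub> p)"
    using Irr_minimal[OF F x(1) alg_over[OF F x] lpF] by simp
  have "splitted (?l [^]\<^bsub>poly_ring R\<^esub> p)"
    unfolding splitted_def roots_linear_pow[OF x(1)] using polynomial_pow_degree[OF l, of p] by simp
  hence "splitted ?G" using pdivides_imp_splitted[OF Gc lp lp0] dvd by blast
  hence sz: "size (roots ?G) = degree ?G" unfolding splitted_def .
  have "roots ?G \<subseteq># replicate_mset p x"
    using pdivides_imp_roots_incl[OF Gc lp lp0 dvd] unfolding roots_linear_pow[OF x(1)] .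
  hence "set_mset (roots ?G) \<subseteq> {x}" by (auto dest!: set_mset_mono split: if_splits)
  hence "roots ?G = replicate_mset (size (roots ?G)) x" by (rule set_mset_subset_singletonD)
  hence "alg_mult ?G x = degree ?G"
    unfolding alg_mult_eq_count_roots[OF Gc] using sz by (metis count_replicate_mset)
  \<comment> \<open>If \<open>(X - x)\<^sup>2\<close> divided the minimal polynomial, the product
    rule would make its derivative vanish at \<open>x\<close>.\<close>
  moreover have "\<not> 2 \<le> alg_mult ?G x"
  proof
    assume "2 \<le> alg_mult ?G x"
    hence "(?l [^]\<^bsub>poly_ring R\<^esub> (2::nat)) pdivides ?G" by (rule le_alg_mult_imp_pdivides[OF x(1) Gc])
    then obtain h where h: "h \<in> carrier (poly_ring R)" "?G = (?l [^]\<^bsub>poly_ring R\<^esub> (2::nat)) \<otimes>\<^bsub>poly_ring R\<^esub> h"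
      unfolding pdivides_def factor_def by blast
    have "?G = ?l \<otimes>\<^bsub>poly_ring R\<^esub> (?l \<otimes>\<^bsub>poly_ring R\<^esub> h)"
      unfolding h(2) using l h(1) by (simp add: numeral_2_eq_2 UP.m_assoc)
    hence G: "?G = poly_mult ?l (poly_mult ?l h)" unfolding univ_poly_mult .
    have hs: "set h \<subseteq> carrier R" by (rule carrier_univ_poly_set[OF carrier_is_subring h(1)])
    have el: "eval ?l x = \<zero>" using x by (simp add: r_neg)
    have lh: "set (poly_mult ?l h) \<subseteq> carrier R" by (rule poly_mult_in_carrier[OF ls hs])
    have "eval (poly_mult ?l h) x = \<zero>"
      unfolding eval_poly_mult[OF ls hs x(1)] el using eval_in_carrier[OF hs x(1)] by simp
    hence "deval ?G x = \<zero>"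
      unfolding G deval_poly_mult[OF ls lh x(1)] el using deval_closed[OF lh x(1)] deval_closed[OF ls x(1)] by simp
    thus False using sep by simp
  qed
  moreover have "degree ?G \<ge> 1" by (rule pirreducible_degree[OF F I(1,2)])
  ultimately have "length ?G = Suc (Suc 0)" by simp
  then obtain a b where ab: "?G = [a, b]" by (metis length_0_conv length_Suc_conv)
  hence a: "a = \<one>" using I(3) by simp
  have b: "b \<in> F" using I(1) ab polynomial_incl unfolding univ_poly_carrier[symmetric] by fastforce
  hence bR: "b \<in> carrier R" using FE by blast
  have "x \<oplus> b = \<zero>" using I(4) unfolding ab a using x bR by simp
  hence "x = \<ominus> b" using bR x(1) by (metis minus_equality)
  thus ?thesis using b FE by simp
qed

text \<open>Over \<open>F = K[x\<^sup>p]\<close> the element \<open>x\<close> is still separable,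
  since the minimal polynomial over \<open>K\<close> is a polynomial over \<open>F\<close> with
  simple root \<open>x\<close>. As \<open>x\<^sup>p \<in> F\<close>, this gives
  \<open>x \<in> F\<close>.\<close>

lemma deval_Irr_imp_frobenius_generated:
  assumes K: "subfield K R" and x: "x \<in> carrier R" "algebraic K x"
    and p: "Factorial_Ring.prime (p::nat)" "[p] \<cdot> \<one> = \<zero>"
    and sep: "deval (Irr K x) x \<noteq> \<zero>"
  shows "x \<in> simple_extension K (x [^] p)"
proof -
  let ?F = "simple_extension K (x [^] p)"
  note ao = alg_over[OF K x]
  have "subring (simple_extension K x) R" by (rule simple_extension_is_subring[OF subfieldE(1)[OF K] x(1)])
  hence "x [^] p \<in> simple_extension K x"
    using nat_pow_mem_subring simple_extension_mem[OF subfieldE(1)[OF K] x(1)] by blast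
  hence "(algebraic over K) (x [^] p)" by (rule simple_extesion_mem_imp_algebraic[OF K x(1) ao])
  hence F: "subfield ?F R" using simple_extension_is_subfield[OF K, of "x [^] p"] x by simp
  have KF: "K \<subseteq> ?F" using simple_extension_incl[OF subfieldE(3)[OF K]] x by simp
  have aF: "algebraic ?F x" using algebraic_mono[OF KF ao] unfolding over_def .
  note I = Irr_props[OF K x]
  have IF: "Irr K x \<in> carrier (?F[X])"
    using I(1) KF unfolding univ_poly_carrier[symmetric] polynomial_def by auto
  show ?thesis
  proof (rule simple_root_pow_mem[OF F x(1) aF p])
    show "x [^] p \<in> ?F" using simple_extension_mem[OF subfieldE(1)[OF K]] x by simp
    show "deval (Irr ?F x) x \<noteq> \<zero>"
      by (rule deval_Irr_multiple[OF F x(1) aF IF I(4) sep])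
  qed
qed

text \<open>For algebraic \<open>x\<close> this is separability over \<open>K\<close>; it holds vacuously in characteristic \<open>0\<close>.\<close>

definition frobenius_generated :: "'a set \<Rightarrow> 'a \<Rightarrow> bool"
  where "frobenius_generated K x \<longleftrightarrow>
    (\<forall>p::nat. Factorial_Ring.prime p \<longrightarrow> [p] \<cdot> \<one> = \<zero> \<longrightarrow> x \<in> simple_extension K (x [^] p))"

text \<open>For the converse, the degree of the minimal polynomial decides: if it is nonzero in the
  field, separability is automatic, which covers characteristic \<open>0\<close>; if it vanishes,
  the characteristic is a prime and the generation criterion applies.\<close>

theorem separable_poly_Irr_iff:
  assumes K: "subfield K R" and x: "x \<in> carrier R" "algebraic K x"
  shows "separable_poly R K (Irr K x) \<longleftrightarrow> frobenius_generated K x"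
proof
  assume "separable_poly R K (Irr K x)"
  thus "frobenius_generated K x"
    unfolding frobenius_generated_def
    using deval_Irr_imp_frobenius_generated[OF K x] separable_poly_Irr[OF K x] by blast
next
  assume fg: "frobenius_generated K x"
  have "deval (Irr K x) x \<noteq> \<zero>"
  proof (cases "[(degree (Irr K x))] \<cdot> \<one> = \<zero>")
    case True
    have "degree (Irr K x) > 0" using pirreducible_degree[OF K Irr_props(1,2)[OF K x]] by simp
    then obtain p :: nat where "Factorial_Ring.prime p" "[p] \<cdot> \<one> = \<zero>" using ex_prime_char[OF True] by blast
    thus ?thesis using frobenius_generated_imp_deval_Irr[OF K x] fg unfolding frobenius_generated_def by blast
  qed (rule deval_Irr_degree[OF K x])
  thus "separable_poly R K (Irr K x)" using separable_poly_Irr[OF K x] by blast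
qed

text \<open>The minimal polynomial has degree between \<open>1\<close> and \<open>d\<close>, so this
  degree divides \<open>d!\<close> and is nonzero in the field.\<close>

lemma frobenius_generated_of_degree:
  assumes K: "subfield K R" and x: "x \<in> carrier R"
    and q: "q \<in> carrier (K[X])" "q \<noteq> []" "eval q x = \<zero>" "degree q \<le> d"
    and d: "[(fact d :: nat)] \<cdot> \<one> \<noteq> \<zero>"
  shows "frobenius_generated K x"
proof -
  have a: "algebraic K x" using algebraicI[OF q(1-3)] unfolding over_def .
  have "Irr K x pdivides q" by (rule Irr_minimal[OF K x alg_over[OF K x a] q(1,3)])
  hence "degree (Irr K x) \<le> d"
    using pdivides_imp_degree_le[OF subfieldE(1)[OF K] Irr_props(1)[OF K x a] q(1,2)] q(4) by simp
  moreover have "degree (Irr K x) \<ge> 1" using pirreducible_degree[OF K Irr_props(1,2)[OF K x a]] .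
  ultimately have "degree (Irr K x) dvd fact d" by (intro dvd_fact) auto
  hence "[(degree (Irr K x))] \<cdot> \<one> \<noteq> \<zero>" using d add_pow_dvd_zero[OF _ _ one_closed] by blast
  thus ?thesis
    using deval_Irr_degree[OF K x a] separable_poly_Irr[OF K x a] separable_poly_Irr_iff[OF K x a] by blast
qed

end

section \<open>The dimension count behind closure of separable elements under field
  operations\<close>

lemma (in ring) ex_base_length:
  assumes K: "subfield K R" and "set Us \<subseteq> carrier R"
  shows "\<exists>Vs. independent K Vs \<and> Span K Vs = Span K Us \<and> length Vs \<le> length Us \<and>
    (length Vs = length Us \<longrightarrow> independent K Us)"
  using assms(2)
proof (induction Us)
  case Nil show ?case by (intro exI[of _ "[]"]) auto
next
  case (Cons u Us)
  hence u: "u \<in> carrier R" "set Us \<subseteq> carrier R" by auto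
  obtain Vs where Vs: "independent K Vs" "Span K Vs = Span K Us" "length Vs \<le> length Us"
    "length Vs = length Us \<longrightarrow> independent K Us" using Cons.IH[OF u(2)] by blast
  show ?case
  \<comment> \<open>A redundant \<open>u\<close> is dropped; the length then becomes strictly
    smaller and the last conjunct vacuous.\<close>
  proof (cases "u \<in> Span K Us")
    case True
    hence "Span K (u # Us) = Span K Us"
      using mono_Span_subset[OF K, of "u # Us" Us] Span_base_incl[OF K u(2)] mono_Span[OF K u(2,1)] u(2) by auto
    thus ?thesis using Vs by (intro exI[of _ Vs]) auto
  next
    case False
    have "independent K (u # Vs)" using li_Cons[OF u(1) _ Vs(1)] False Vs(2) by simp
    moreover have "Span K (u # Vs) = Span K (u # Us)" using Vs(2) by simp
    moreover have "length Vs = length Us \<longrightarrow> independent K (u # Us)"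
      using li_Cons[OF u(1) False] Vs(4) by blast
    ultimately show ?thesis using Vs(3) by (intro exI[of _ "u # Vs"]) auto
  qed
qed

text \<open>Extracting a base from \<open>Ws\<close> drops nothing, as the dimension of the span is
  already \<open>length Ws\<close>.\<close>

lemma (in ring) spanning_length_imp_independent:
  assumes K: "subfield K R" and Us: "independent K Us" and Ws: "set Ws \<subseteq> carrier R"
    and eq: "Span K Ws = Span K Us" "length Ws = length Us"
  shows "independent K Ws"
proof -
  obtain Vs where Vs: "independent K Vs" "Span K Vs = Span K Ws"
    "length Vs = length Ws \<longrightarrow> independent K Ws" using ex_base_length[OF K Ws] by blast
  have "dimension (length Vs) K (Span K Us)" "dimension (length Us) K (Span K Us)"
    using dimension_independent[OF Vs(1)] dimension_independent[OF Us] Vs(2) eq(1) by auto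
  hence "length Vs = length Us" by (rule dimension_is_inj[OF K])
  thus ?thesis using Vs(3) eq(2) by simp
qed

lemma (in domain) pow_eq_zero_imp:
  "x \<in> carrier R \<Longrightarrow> x [^] (n::nat) = \<zero> \<Longrightarrow> x = \<zero>"
  by (induction n) (auto simp: integral_iff)

context field
begin

context
  fixes p :: nat assumes p: "Factorial_Ring.prime p" "[p] \<cdot> \<one> = \<zero>"
begin

lemma frobenius_combine:
  assumes "set Ks \<subseteq> carrier R" "set Us \<subseteq> carrier R"
  shows "(combine Ks Us) [^] p = combine (map (\<lambda>k. k [^] p) Ks) (map (\<lambda>u. u [^] p) Us)"
  using assms
proof (induction Ks Us rule: combine.induct)
  case (1 k Ks u Us)
  thus ?case using frobenius_add[OF p] by (simp add: nat_pow_distrib)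
qed (use prime_gt_0_nat[OF p(1)] in \<open>auto simp: nat_pow_zero\<close>)

lemma frobenius_simple_extension:
  assumes "subring K R" "x \<in> carrier R" "y \<in> simple_extension K x"
  shows "y [^] p \<in> simple_extension K (x [^] p)"
  using assms(3)
proof (induction rule: simple_extension.induct)
  case zero show ?case using prime_gt_0_nat[OF p(1)] by (simp add: nat_pow_zero)
next
  case (lin k1 k2)
  have k: "k1 \<in> carrier R" "k2 \<in> carrier R"
    using lin simple_extension_in_carrier[OF subringE(1)[OF assms(1)] assms(2)] subringE(1)[OF assms(1)] by auto
  have "(k1 \<otimes> x \<oplus> k2) [^] p = k1 [^] p \<otimes> x [^] p \<oplus> k2 [^] p"
    using frobenius_add[OF p] k assms(2) by (simp add: nat_pow_distrib)
  thus ?case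
    using simple_extension.lin[OF lin(3) nat_pow_mem_subring[OF assms(1) lin(2)]] by simp
qed

text \<open>
  The \<open>p\<close>-th powers of a basis \<open>v\<^sub>i\<close> of \<open>E\<close> over \<open>F\<close> span \<open>E\<close>, so they are independent. Write
  \<open>1 = \<Sum> b\<^sub>i v\<^sub>i\<close> and \<open>- z = \<Sum> c\<^sub>i v\<^sub>i\<close>; the \<open>p\<close>-th power of \<open>0 = \<Sum> (z b\<^sub>i + c\<^sub>i) v\<^sub>i\<close> is a relation
  over \<open>F\<close>, whence \<open>z b\<^sub>i = - c\<^sub>i\<close> for all \<open>i\<close>.
\<close>

lemma frobenius_span_imp_root_mem:
  assumes F: "subfield F R" and Vs: "independent F Vs" and one: "\<one> \<in> Span F Vs"
    and span: "Span F (map (\<lambda>v. v [^] p) Vs) = Span F Vs"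
    and z: "z \<in> Span F Vs" "z [^] p \<in> F"
  shows "z \<in> F"
proof -
  note SF = subfieldE(1)[OF F]
  note FE = subringE[OF SF]
  let ?Ws = "map (\<lambda>v. v [^] p) Vs"
  have V: "set Vs \<subseteq> carrier R" by (rule independent_in_carrier[OF Vs])
  have W: "set ?Ws \<subseteq> carrier R" using V by auto
  have indW: "independent F ?Ws"
    by (rule spanning_length_imp_independent[OF F Vs W span]) simp
  have zR: "z \<in> carrier R" using z(1) Span_in_carrier[OF FE(1) V] by blast
  have "\<ominus> z \<in> Span F Vs" using Span_subgroup_props(4)[OF F V z(1)] .
  then obtain Cs where C: "set Cs \<subseteq> F" "length Cs = length Vs" "\<ominus> z = combine Cs Vs"
    using Span_mem_iff_length_version[OF F V] by blast
  obtain Bs where B: "set Bs \<subseteq> F" "length Bs = length Vs" "\<one> = combine Bs Vs"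
    using Span_mem_iff_length_version[OF F V] one by blast
  have CR: "set Cs \<subseteq> carrier R" and BR: "set Bs \<subseteq> carrier R" using B C FE(1) by auto
  define Ds where "Ds = map2 (\<oplus>) (map ((\<otimes>) z) Bs) Cs"
  have zB: "set (map ((\<otimes>) z) Bs) \<subseteq> carrier R" using BR zR by auto
  have "combine Ds Vs = combine (map ((\<otimes>) z) Bs) Vs \<oplus> combine Cs Vs"
    unfolding Ds_def using combine_add[of "map ((\<otimes>) z) Bs" Vs Cs] B(2) C(2) zB CR V by simp
  also have "\<dots> = z \<otimes> \<one> \<oplus> \<ominus> z" using combine_r_distr[OF BR V zR] B C by simp
  also have "\<dots> = \<zero>" using zR by (simp add: r_neg)
  finally have D0: "combine Ds Vs = \<zero>" .
  have lenD: "length Ds = length Vs" unfolding Ds_def using B C by simp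
  have Dnth: "Ds ! i = z \<otimes> Bs ! i \<oplus> Cs ! i" if "i < length Vs" for i
    unfolding Ds_def using that B C by simp
  have DR: "set Ds \<subseteq> carrier R"
  proof
    fix d assume "d \<in> set Ds"
    then obtain i where "i < length Vs" "d = Ds ! i" using lenD by (metis in_set_conv_nth)
    thus "d \<in> carrier R" using Dnth BR CR B(2) C(2) zR by (auto simp: subset_iff)
  qed
  \<comment> \<open>The entries \<open>z b\<^sub>i + c\<^sub>i\<close> need not lie in
    \<open>F\<close>, but their \<open>p\<close>-th powers do, because
    \<open>z\<^sup>p \<in> F\<close>.\<close>
  have "set (map (\<lambda>d. d [^] p) Ds) \<subseteq> F"
  proof
    fix e assume "e \<in> set (map (\<lambda>d. d [^] p) Ds)"
    then obtain i where i: "i < length Vs" "e = (Ds ! i) [^] p" using lenD by (auto simp: in_set_conv_nth)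
    have bc: "Bs ! i \<in> F" "Cs ! i \<in> F" using i B C by (auto simp: subset_iff)
    hence bcR: "Bs ! i \<in> carrier R" "Cs ! i \<in> carrier R" using FE(1) by auto
    have "e = z [^] p \<otimes> (Bs ! i) [^] p \<oplus> (Cs ! i) [^] p"
      using i Dnth frobenius_add[OF p] bcR zR by (simp add: nat_pow_distrib)
    thus "e \<in> F" using z(2) nat_pow_mem_subring[OF SF bc(1), of p] nat_pow_mem_subring[OF SF bc(2), of p] FE by simp
  qed
  moreover have "combine (map (\<lambda>d. d [^] p) Ds) ?Ws = \<zero>"
    using frobenius_combine[OF DR V] D0 prime_gt_0_nat[OF p(1)] by (simp add: nat_pow_zero)
  ultimately have "set (take (length ?Ws) (map (\<lambda>d. d [^] p) Ds)) \<subseteq> {\<zero>}"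
    by (rule independent_imp_trivial_combine[OF F indW])
  hence pz: "d [^] p = \<zero>" if "d \<in> set Ds" for d using lenD that by auto
  have dz: "d = \<zero>" if "d \<in> set Ds" for d
    using pz[OF that] DR that pow_eq_zero_imp[of d p] by auto
  \<comment> \<open>Some \<open>b\<^sub>i\<close> is nonzero because \<open>1 \<noteq> 0\<close>;
    dividing by it in \<open>F\<close> recovers \<open>z\<close>.\<close>
  have "\<not> set Bs \<subseteq> {\<zero>}"
  proof
    assume "set Bs \<subseteq> {\<zero>}"
    hence "Bs = replicate (length Vs) \<zero>" using B(2) by (metis replicate_eqI singletonD subsetD)
    hence "\<one> = \<zero>" using B(3) combine_replicate[OF V] by simp
    thus False by simp
  qed
  then obtain b where "b \<in> set Bs" "b \<noteq> \<zero>" by blast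
  then obtain i where i: "i < length Vs" "Bs ! i \<noteq> \<zero>" using B(2) by (metis in_set_conv_nth)
  have bc: "Bs ! i \<in> F" "Cs ! i \<in> F" using i B C by (auto simp: subset_iff)
  hence bcR: "Bs ! i \<in> carrier R" "Cs ! i \<in> carrier R" using FE(1) by auto
  have "z \<otimes> Bs ! i \<oplus> Cs ! i = \<zero>" using dz[OF nth_mem[of i Ds]] Dnth[OF i(1)] lenD i(1) by simp
  hence "\<ominus> (Cs ! i) = z \<otimes> Bs ! i" using bcR zR by (intro minus_equality) auto
  hence "Bs ! i \<otimes> z \<in> F" using bc FE bcR zR by (metis m_comm)
  thus ?thesis using subfield_m_inv_simprule[OF F _ zR, of "Bs ! i"] bc i by blast
qed

text \<open>The hypothesis \<open>gen\<close> says that \<open>E\<close> is generated as a ring by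
  \<open>F\<close> and its \<open>p\<close>-th powers. The span \<open>G\<close> of the
  \<open>p\<close>-th powers of an \<open>F\<close>-basis is a subring containing both, so
  \<open>G = E\<close>, which is the spanning condition of
  \<open>frobenius_span_imp_root_mem\<close>.\<close>

lemma frobenius_closed_imp_root_mem:
  assumes SE: "subring E R" and F: "subfield F R" and FsubE: "F \<subseteq> E"
    and Us: "set Us \<subseteq> carrier R" "Span F Us = E"
    and gen: "\<And>G. subring G R \<Longrightarrow> F \<subseteq> G \<Longrightarrow> (\<And>u. u \<in> E \<Longrightarrow> u [^] p \<in> G) \<Longrightarrow> E \<subseteq> G"
    and z: "z \<in> E" "z [^] p \<in> F"
  shows "z \<in> F"
proof -
  note EE = subringE[OF SE]
  note SF = subfieldE(1)[OF F]
  note FE = subringE[OF SF]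
  have subalg: "subalgebra F E R"
    using subring.axioms(1)[OF SE] FsubE EE(6) by (auto intro!: subalgebra.intro subalgebra_axioms.intro)
  obtain Vs where V: "set Vs \<subseteq> carrier R" "independent F Vs" "Span F Vs = E"
    using filter_base[OF F Us(1)] Us(2) by metis
  have VE: "set Vs \<subseteq> E" using Span_base_incl[OF F V(1)] V(3) by (simp del: Span.simps)
  define Ws where "Ws = map (\<lambda>v. v [^] p) Vs"
  have W: "set Ws \<subseteq> carrier R" using V(1) unfolding Ws_def by auto
  have WE: "set Ws \<subseteq> E" using VE nat_pow_mem_subring[OF SE] unfolding Ws_def by auto
  define G where "G = Span F Ws"
  have GE: "G \<subseteq> E" unfolding G_def by (rule subalgebra_Span_incl[OF F subalg WE])
  note G = Span_subgroup_props[OF F W, folded G_def] Span_smult_closed[OF F W, folded G_def]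
  have pow: "u [^] p \<in> G" if "u \<in> E" for u
  proof -
    have "u \<in> Span F Vs" using that V(3) by blast
    then obtain Ks where Ks: "set Ks \<subseteq> F" "length Ks = length Vs" "u = combine Ks Vs"
      using iffD1[OF Span_mem_iff_length_version[OF F V(1)]] by blast
    have KsR: "set Ks \<subseteq> carrier R" using Ks(1) FE(1) by blast
    have "u [^] p = combine (map (\<lambda>k. k [^] p) Ks) Ws"
      unfolding Ks(3) Ws_def by (rule frobenius_combine[OF KsR V(1)])
    moreover have "set (map (\<lambda>k. k [^] p) Ks) \<subseteq> F" using Ks(1) nat_pow_mem_subring[OF SF] by auto
    ultimately show ?thesis unfolding G_def Span_eq_combine_set[OF F W] by blast
  qed
  have mulW: "w \<otimes> v \<in> G" if w: "w \<in> set Ws" and v: "v \<in> G" for v w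
  proof -
    have wR: "w \<in> carrier R" using w W by blast
    \<comment> \<open>The set is an \<open>F\<close>-subspace, so it suffices to test it on the
      spanning list, where \<open>a\<^sup>p b\<^sup>p = (a b)\<^sup>p\<close> with
      \<open>a b \<in> E\<close>. Linearity in the other factor is treated afterwards in the same
      way.\<close>
    let ?H = "{v \<in> carrier R. w \<otimes> v \<in> G}"
    have "subalgebra F ?H R"
    proof (intro subalgebra.intro subalgebra_axioms.intro)
      show "subgroup ?H (add_monoid R)"
        by (rule add.subgroupI) (use wR G in \<open>auto simp: r_minus r_distr\<close>)
    next
      fix k v assume "k \<in> F" "v \<in> ?H"
      thus "k \<otimes> v \<in> ?H" using G(5)[of k "w \<otimes> v"] wR FE(1) by (auto simp: m_lcomm subset_iff)
    qed
    moreover have "set Ws \<subseteq> ?H"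
    proof
      fix w' assume w': "w' \<in> set Ws"
      obtain a b where ab: "a \<in> set Vs" "w = a [^] p" "b \<in> set Vs" "w' = b [^] p"
        using w w' unfolding Ws_def by auto
      have "w \<otimes> w' = (a \<otimes> b) [^] p" using ab V(1) by (auto simp: nat_pow_distrib subset_iff)
      moreover have "a \<otimes> b \<in> E" using ab VE EE(6) by blast
      ultimately show "w' \<in> ?H" using pow w' W by auto
    qed
    ultimately have "Span F Ws \<subseteq> ?H" by (rule subalgebra_Span_incl[OF F])
    thus ?thesis using v unfolding G_def by blast
  qed
  have mulG: "u \<otimes> v \<in> G" if u: "u \<in> G" and v: "v \<in> G" for u v
  proof -
    have vR: "v \<in> carrier R" using v G(1) by blast
    let ?H = "{u \<in> carrier R. u \<otimes> v \<in> G}"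
    have "subalgebra F ?H R"
    proof (intro subalgebra.intro subalgebra_axioms.intro)
      show "subgroup ?H (add_monoid R)"
        by (rule add.subgroupI) (use vR G in \<open>auto simp: l_minus l_distr\<close>)
    next
      fix k u assume "k \<in> F" "u \<in> ?H"
      thus "k \<otimes> u \<in> ?H" using G(5)[of k "u \<otimes> v"] vR FE(1) by (auto simp: m_assoc subset_iff)
    qed
    moreover have "set Ws \<subseteq> ?H" using mulW v W by blast
    ultimately have "Span F Ws \<subseteq> ?H" by (rule subalgebra_Span_incl[OF F])
    thus ?thesis using u unfolding G_def by blast
  qed
  have oneG: "\<one> \<in> G" using pow[OF EE(3)] by simp
  have SG: "subring G R" by (rule subringI) (use G oneG mulG in auto)
  have "f \<in> G" if "f \<in> F" for f
    using G(5)[OF that oneG] that FE(1) by (simp add: subset_iff)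
  hence "E \<subseteq> G" using gen[OF SG _ pow] by blast
  hence "Span F (map (\<lambda>v. v [^] p) Vs) = Span F Vs"
    using GE V(3) unfolding G_def Ws_def by blast
  thus ?thesis
    using frobenius_span_imp_root_mem[OF F V(2)] V(3) z EE(3) by blast
qed

text \<open>A ring containing \<open>K\<close>, \<open>x\<^sup>p\<close> and
  \<open>y\<^sup>p\<close> contains \<open>x\<close> and \<open>y\<close>, so
  \<open>E = K[x, y]\<close> is generated by its \<open>p\<close>-th powers over \<open>K\<close>, a
  fortiori over \<open>F = K[z\<^sup>p]\<close>. Since \<open>z\<^sup>p \<in> F\<close> by
  construction, \<open>z \<in> F\<close> follows.\<close>

lemma frobenius_generated_extension_char:
  assumes K: "subfield K R"
    and x: "x \<in> carrier R" "algebraic K x" "x \<in> simple_extension K (x [^] p)"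
    and y: "y \<in> carrier R" "algebraic K y" "y \<in> simple_extension K (y [^] p)"
    and z: "z \<in> finite_extension K [x, y]"
  shows "z \<in> simple_extension K (z [^] p)"
proof -
  note SK = subfieldE(1)[OF K]
  note [simp del] = finite_extension.simps Span.simps
  let ?E = "finite_extension K [x, y]" and ?F = "simple_extension K (z [^] p)"
  have xy: "set [x, y] \<subseteq> carrier R" "\<And>u. u \<in> set [x, y] \<Longrightarrow> (algebraic over K) u"
    using x y by (auto simp: over_def)
  have SE: "subring ?E R" by (rule finite_extension_is_subring[OF SK xy(1)])
  note EE = subringE[OF SE]
  have KE: "K \<subseteq> ?E" by (rule finite_extension_incl[OF subfieldE(3)[OF K] xy(1)])
  have xyE: "x \<in> ?E" "y \<in> ?E" using finite_extension_mem[OF SK xy(1)] by auto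
  have zR: "z \<in> carrier R" using z EE(1) by blast
  have zpE: "z [^] p \<in> ?E" by (rule nat_pow_mem_subring[OF SE z])
  have "(algebraic over K) (z [^] p)" by (rule finite_extesion_mem_imp_algebraic[OF K xy zpE])
  hence F: "subfield ?F R" using simple_extension_is_subfield[OF K, of "z [^] p"] zR by simp
  have KF: "K \<subseteq> ?F" using simple_extension_incl[OF subfieldE(3)[OF K]] zR by simp
  have FsubE: "?F \<subseteq> ?E" by (rule simple_extension_subring_incl[OF SE KE zpE])
  obtain n where "dimension n K ?E"
    using finite_extension_finite_dimension(1)[OF K xy] by (rule finite_dimensionE')
  then obtain Us where Us: "set Us \<subseteq> carrier R" "Span K Us = ?E" using exists_base[OF K] by blast
  \<comment> \<open>A list spanning over \<open>K\<close> also spans over the larger field, so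
    \<open>?E\<close> is finite-dimensional over \<open>?F\<close>.\<close>
  have span: "Span ?F Us = ?E"
  proof
    have "subalgebra ?F ?E R"
      using subring.axioms(1)[OF SE] FsubE EE(6) by (auto intro!: subalgebra.intro subalgebra_axioms.intro)
    thus "Span ?F Us \<subseteq> ?E"
      using subalgebra_Span_incl[OF F] Span_base_incl[OF K Us(1)] Us(2) by metis
    have "subalgebra K (Span ?F Us) R"
      using Span_is_subalgebra[OF F Us(1)] KF
      unfolding subalgebra_def subalgebra_axioms_def by blast
    thus "?E \<subseteq> Span ?F Us"
      using subalgebra_Span_incl[OF K _ Span_base_incl[OF F Us(1)]] Us(2) by metis
  qed
  show ?thesis
  proof (rule frobenius_closed_imp_root_mem[OF SE F FsubE Us(1) span])
    fix G assume SG: "subring G R" and FG: "?F \<subseteq> G" and pow: "\<And>u. u \<in> ?E \<Longrightarrow> u [^] p \<in> G"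
    have KG: "K \<subseteq> G" using KF FG by blast
    have "x \<in> G" using simple_extension_subring_incl[OF SG KG pow[OF xyE(1)]] x(3) by blast
    moreover have "y \<in> G" using simple_extension_subring_incl[OF SG KG pow[OF xyE(2)]] y(3) by blast
    ultimately show "?E \<subseteq> G" by (intro finite_extension_subring_incl[OF SG KG]) auto
  next
    show "z \<in> ?E" by (rule z)
    show "z [^] p \<in> ?F" using simple_extension_mem[OF SK] zR by simp
  qed
qed

text \<open>Applying Frobenius repeatedly to \<open>z \<in> K[z\<^sup>p]\<close> shows that each
  iterated \<open>p\<close>-th power of \<open>z\<close> lies in the ring generated by the next one;
  these inclusions are then composed.\<close>

lemma frobenius_generated_pow:
  assumes K: "subring K R" and z: "z \<in> carrier R" "z \<in> simple_extension K (z [^] p)"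
  shows "z \<in> simple_extension K (z [^] (p ^ n))"
proof (induction n)
  case 0 show ?case using simple_extension_mem[OF K z(1)] z(1) by simp
next
  case (Suc n)
  let ?q = "p ^ n"
  have step: "z [^] (p ^ m) \<in> simple_extension K (z [^] (p ^ Suc m))" for m
  proof (induction m)
    case 0 show ?case using z by simp
  next
    case (Suc m)
    have "(z [^] (p ^ m)) [^] p \<in> simple_extension K ((z [^] (p ^ Suc m)) [^] p)"
      by (rule frobenius_simple_extension[OF K _ Suc]) (use z in simp)
    thus ?case using z(1) by (simp add: nat_pow_pow mult.commute)
  qed
  have "simple_extension K (z [^] ?q) \<subseteq> simple_extension K (z [^] (p ^ Suc n))"
    by (rule simple_extension_subring_incl[OF simple_extension_is_subring[OF K] _ step])
      (use z simple_extension_incl[OF subringE(1)[OF K]] in auto)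
  thus ?case using Suc by blast
qed

end

lemma frobenius_generated_extension:
  assumes "subfield K R"
    and "x \<in> carrier R" "algebraic K x" "frobenius_generated K x"
    and "y \<in> carrier R" "algebraic K y" "frobenius_generated K y"
    and "z \<in> finite_extension K [x, y]"
  shows "frobenius_generated K z"
  using frobenius_generated_extension_char[OF _ _ assms(1-3) _ assms(5,6) _ assms(8)] assms(4,7)
  unfolding frobenius_generated_def by blast

text \<open>The ring generated over \<open>K\<close> by an element of \<open>K\<close> is
  \<open>K\<close>, and \<open>z\<close> lies in the one generated by its \<open>p ^ n\<close>-th
  power.\<close>

lemma frobenius_generated_inseparable:
  assumes K: "subfield K R" and z: "z \<in> carrier R" "frobenius_generated K z"
    and p: "Factorial_Ring.prime (p::nat)" "[p] \<cdot> \<one> = \<zero>" "z [^] (p ^ n) \<in> K"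
  shows "z \<in> K"
proof -
  have "z \<in> simple_extension K (z [^] p)" using z(2) p unfolding frobenius_generated_def by blast
  hence "z \<in> simple_extension K (z [^] (p ^ n))"
    by (rule frobenius_generated_pow[OF p(1,2) subfieldE(1)[OF K] z(1)])
  thus ?thesis using simple_extension_subring_incl[OF subfieldE(1)[OF K] subset_refl p(3)] by blast
qed

end

section \<open>Residual extensions, elementwise\<close>

text \<open>
  The conditions on the image of \<open>w\<close> in the residue field at \<open>Q\<close>, with denominators cleared. In this
  form they only depend on the trace of \<open>Q\<close> on \<open>R[w]\<close>, which allows passing between a prime of \<open>S\<close> and
  its contraction to an intermediate ring.
\<close>

definition t_at :: "('a, 'b) ring_scheme \<Rightarrow> 'a set \<Rightarrow> 'a set \<Rightarrow> 'a \<Rightarrow> bool"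
  where "t_at S R Q w \<longleftrightarrow> (\<exists>s \<in> R - Q. \<exists>r \<in> R. s \<otimes>\<^bsub>S\<^esub> w \<ominus>\<^bsub>S\<^esub> r \<in> Q)"

definition pi_at :: "('a, 'b) ring_scheme \<Rightarrow> 'a set \<Rightarrow> 'a set \<Rightarrow> 'a \<Rightarrow> bool"
  where "pi_at S R Q w \<longleftrightarrow>
    (\<exists>n::nat. t_at S R Q (w [^]\<^bsub>S\<^esub> (char_exponent (residue_field S Q) ^ n)))"

definition sep_at :: "('a, 'b) ring_scheme \<Rightarrow> 'a set \<Rightarrow> 'a set \<Rightarrow> 'a \<Rightarrow> bool"
  where "sep_at S R Q w \<longleftrightarrow>
    (\<forall>p::nat. Factorial_Ring.prime p \<longrightarrow> [p] \<cdot>\<^bsub>S\<^esub> \<one>\<^bsub>S\<^esub> \<in> Q \<longrightarrow>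
      (\<exists>s \<in> R - Q. \<exists>g \<in> ring.simple_extension S R (w [^]\<^bsub>S\<^esub> p). s \<otimes>\<^bsub>S\<^esub> w \<ominus>\<^bsub>S\<^esub> g \<in> Q))"

lemma (in domain) char_exponent_cases:
  "(char_exponent R = 1 \<and> (\<forall>n::nat. n > 0 \<longrightarrow> [n] \<cdot> \<one> \<noteq> \<zero>)) \<or>
   (Factorial_Ring.prime (char_exponent R) \<and> [(char_exponent R)] \<cdot> \<one> = \<zero>)"
proof (cases "\<exists>n::nat. n > 0 \<and> [n] \<cdot> \<one> = \<zero>")
  case True
  let ?P = "\<lambda>n::nat. n > 0 \<and> [n] \<cdot> \<one> = \<zero>"
  have c: "char_exponent R = Least ?P" unfolding char_exponent_def using True by auto
  have P: "?P (Least ?P)" by (rule LeastI_ex[OF True])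
  obtain p where p: "Factorial_Ring.prime p" "p dvd Least ?P" "[p] \<cdot> \<one> = \<zero>"
    using ex_prime_char P by blast
  have "Least ?P \<le> p" using p prime_gt_0_nat by (intro Least_le) auto
  moreover have "p \<le> Least ?P" using p(2) P by (intro dvd_imp_le) auto
  ultimately show ?thesis unfolding c using p by simp
next
  case False
  hence "char_exponent R = 1" unfolding char_exponent_def by (rule if_not_P)
  thus ?thesis using False by blast
qed

section \<open>Translation between residue field conditions and congruences modulo the prime\<close>

context primeideal
begin

text \<open>The residue field at \<open>I\<close>, the canonical map to it, and the residue field of \<open>B\<close> inside it.\<close>

abbreviation "kap \<equiv> residue_field R I"
abbreviation "rmap \<equiv> res_map R I"
abbreviation "kim B \<equiv> residual_image (R\<lparr>carrier := B\<rparr>) R I"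

lemma res_map_minus:
  assumes "a \<in> carrier R" "b \<in> carrier R"
  shows "a \<ominus> b \<in> I \<longleftrightarrow> rmap a = rmap b"
proof -
  interpret L: field kap by (rule residue_field_field)
  interpret H: ring_hom_ring R kap rmap by (rule res_map_hom)
  have "a \<ominus> b \<in> I \<longleftrightarrow> rmap (a \<ominus> b) = \<zero>\<^bsub>kap\<^esub>" using res_map_zero_iff assms by simp
  also have "\<dots> \<longleftrightarrow> rmap a \<ominus>\<^bsub>kap\<^esub> rmap b = \<zero>\<^bsub>kap\<^esub>" using assms by (simp add: a_minus_def)
  also have "\<dots> \<longleftrightarrow> rmap a = rmap b" using assms by (intro L.r_right_minus_eq) auto
  finally show ?thesis .
qed

lemma residual_image_subfield:
  assumes B: "subring B R"
  shows "subfield (kim B) kap"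
proof -
  let ?B = "R\<lparr>carrier := B\<rparr>"
  interpret L: field kap by (rule residue_field_field)
  interpret P: primeideal "I \<inter> B" ?B by (rule subring_prime[OF B])
  interpret LB: field "residue_field ?B (I \<inter> B)" by (rule P.residue_field_field)
  interpret H: ring_hom_ring "residue_field ?B (I \<inter> B)" kap "residual_map ?B R I"
    by (rule ring_hom_ringI2[OF LB.ring_axioms L.ring_axioms residual_map_inj_hom(1)[OF B]])
  show ?thesis
    using H.img_is_subfield(2)[OF LB.carrier_is_subfield] L.one_not_zero
    unfolding residual_image_def by simp
qed

text \<open>\<open>x = a/s\<close> in cross-multiplied form; together with
  \<open>residual_imageI\<close> it spares later arguments any inverse in the residue field.\<close>

lemma residual_imageE:
  assumes B: "subring B R" and "x \<in> kim B"
  obtains a s where "a \<in> B" "s \<in> B - I" "rmap s \<otimes>\<^bsub>kap\<^esub> x = rmap a"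
proof -
  interpret L: field kap by (rule residue_field_field)
  interpret H: ring_hom_ring R kap rmap by (rule res_map_hom)
  obtain a s where as: "a \<in> B" "s \<in> B - I" "x = res_frac R I a s"
    using assms(2) unfolding residual_image_eq[OF B] by blast
  have c: "a \<in> carrier R" "s \<in> carrier R - I" using as subringE(1)[OF B] by auto
  have "rmap s \<noteq> \<zero>\<^bsub>kap\<^esub>" using res_map_zero_iff c by blast
  hence u: "rmap s \<in> Units kap" using L.field_Units H.hom_closed c by blast
  have "rmap s \<otimes>\<^bsub>kap\<^esub> x = rmap a"
    unfolding as(3) res_frac_eq_div[OF c]
    using u c H.hom_closed[of a] H.hom_closed[of s]
    by (metis Diff_iff L.Units_inv_closed L.Units_r_inv L.m_comm L.m_lcomm L.r_one)
  thus ?thesis using that as by blast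
qed

lemma residual_imageI:
  assumes B: "subring B R" and "a \<in> B" "s \<in> B - I" and x: "x \<in> carrier kap"
    and "rmap s \<otimes>\<^bsub>kap\<^esub> x = rmap a"
  shows "x \<in> kim B"
proof -
  interpret L: field kap by (rule residue_field_field)
  interpret H: ring_hom_ring R kap rmap by (rule res_map_hom)
  have c: "a \<in> carrier R" "s \<in> carrier R - I" using assms subringE(1)[OF B] by auto
  have "rmap s \<noteq> \<zero>\<^bsub>kap\<^esub>" using res_map_zero_iff c by blast
  hence u: "rmap s \<in> Units kap" using L.field_Units H.hom_closed c by blast
  have "x = res_frac R I a s"
    unfolding res_frac_eq_div[OF c] assms(5)[symmetric]
  proof -
    have "(rmap s \<otimes>\<^bsub>kap\<^esub> x) \<otimes>\<^bsub>kap\<^esub> inv\<^bsub>kap\<^esub> (rmap s) =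
        x \<otimes>\<^bsub>kap\<^esub> (rmap s \<otimes>\<^bsub>kap\<^esub> inv\<^bsub>kap\<^esub> (rmap s))"
      using x L.Units_inv_closed[OF u] L.Units_closed[OF u] by (simp add: L.m_ac)
    thus "x = (rmap s \<otimes>\<^bsub>kap\<^esub> x) \<otimes>\<^bsub>kap\<^esub> inv\<^bsub>kap\<^esub> (rmap s)"
      using x L.Units_r_inv[OF u] by simp
  qed
  thus ?thesis unfolding residual_image_eq[OF B] using assms by blast
qed

lemma rmap_mem_residual_image: "subring B R \<Longrightarrow> b \<in> B \<Longrightarrow> rmap b \<in> kim B"
  unfolding residual_image_eq res_map_def using subringE(3) compl_one by blast

lemma residue_fieldE:
  assumes "x \<in> carrier kap"
  obtains a s where "a \<in> carrier R" "s \<in> carrier R - I" "x = rmap a \<otimes>\<^bsub>kap\<^esub> inv\<^bsub>kap\<^esub> (rmap s)"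
    "rmap s \<noteq> \<zero>\<^bsub>kap\<^esub>"
  using residue_field_carrierE[OF assms] res_frac_eq_div res_map_zero_iff by (metis Diff_iff)

lemma t_at_iff:
  assumes B: "subring B R" and w: "w \<in> carrier R"
  shows "t_at R B I w \<longleftrightarrow> rmap w \<in> kim B"
proof -
  interpret L: field kap by (rule residue_field_field)
  interpret H: ring_hom_ring R kap rmap by (rule res_map_hom)
  have "s \<otimes> w \<ominus> r \<in> I \<longleftrightarrow> rmap s \<otimes>\<^bsub>kap\<^esub> rmap w = rmap r" if "s \<in> B" "r \<in> B" for s r
    using res_map_minus[of "s \<otimes> w" r] that w subringE(1)[OF B] by (simp add: subset_iff)
  thus ?thesis
    unfolding t_at_def
    using residual_imageI[OF B _ _ H.hom_closed[OF w]] residual_imageE[OF B, of "rmap w"]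
    by (metis DiffD1)
qed

lemma pi_at_iff:
  assumes B: "subring B R" and w: "w \<in> carrier R"
  shows "pi_at R B I w \<longleftrightarrow> (\<exists>n::nat. rmap w [^]\<^bsub>kap\<^esub> (char_exponent kap ^ n) \<in> kim B)"
proof -
  interpret L: field kap by (rule residue_field_field)
  interpret H: ring_hom_ring R kap rmap by (rule res_map_hom)
  show ?thesis unfolding pi_at_def using t_at_iff[OF B] w by (simp add: H.hom_nat_pow)
qed

lemma char_mem_iff: "[(n::nat)] \<cdot> \<one> \<in> I \<longleftrightarrow> [n] \<cdot>\<^bsub>kap\<^esub> \<one>\<^bsub>kap\<^esub> = \<zero>\<^bsub>kap\<^esub>"
proof -
  interpret L: field kap by (rule residue_field_field)
  interpret H: ring_hom_ring R kap rmap by (rule res_map_hom)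
  show ?thesis using res_map_zero_iff[of "[n] \<cdot> \<one>"] H.hom_add_pow[OF one_closed, of n] by simp
qed

text \<open>Only finitely many coefficients occur, so they have a common denominator in
  \<open>B - I\<close>. Conversely the image of \<open>s\<close> is a nonzero element of the field
  \<open>kim B\<close> and can be divided out.\<close>

lemma simple_extension_res_iff:
  assumes B: "subring B R" and v: "v \<in> carrier R" and y: "y \<in> carrier kap"
  shows "y \<in> ring.simple_extension kap (kim B) (rmap v) \<longleftrightarrow>
    (\<exists>s \<in> B - I. \<exists>g \<in> simple_extension B v. rmap s \<otimes>\<^bsub>kap\<^esub> y = rmap g)"
proof -
  interpret L: field kap by (rule residue_field_field)
  interpret H: ring_hom_ring R kap rmap by (rule res_map_hom)
  note BE = subringE[OF B]
  have K: "subfield (kim B) kap" by (rule residual_image_subfield[OF B])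
  note KE = subringE[OF subfieldE(1)[OF K]]
  have ext: "simple_extension B v \<subseteq> carrier R" by (rule simple_extension_in_carrier[OF BE(1) v])
  have vL: "rmap v \<in> carrier kap" using v by simp
  have SL: "subring (L.simple_extension (kim B) (rmap v)) kap"
    by (rule L.simple_extension_is_subring[OF subfieldE(1)[OF K] vL])
  \<comment> \<open>Needed to bring the numerator built so far over a new denominator.\<close>
  have mulB: "s \<otimes> g \<in> simple_extension B v" if "s \<in> B" "g \<in> simple_extension B v" for s g
    using that(2)
  proof (induction rule: simple_extension.induct)
    case zero show ?case using that BE(1) by (simp add: subset_iff)
  next
    case (lin k1 k2)
    have "s \<otimes> (k1 \<otimes> v \<oplus> k2) = (s \<otimes> k1) \<otimes> v \<oplus> s \<otimes> k2"
      using lin that ext BE(1) v by (simp add: subset_iff r_distr m_assoc)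
    thus ?case using simple_extension.lin[OF lin(3), of "s \<otimes> k2"] BE(6) that lin by simp
  qed
  show ?thesis
  proof
    assume "y \<in> L.simple_extension (kim B) (rmap v)"
    thus "\<exists>s \<in> B - I. \<exists>g \<in> simple_extension B v. rmap s \<otimes>\<^bsub>kap\<^esub> y = rmap g"
    proof (induction rule: L.simple_extension.induct)
      case zero
      show ?case using BE(3) compl_one by (intro bexI[of _ \<one>] bexI[of _ \<zero>]) auto
    next
      case (lin k1 k2)
      then obtain s g where sg: "s \<in> B - I" "g \<in> simple_extension B v" "rmap s \<otimes>\<^bsub>kap\<^esub> k1 = rmap g" by blast
      obtain a t where at: "a \<in> B" "t \<in> B - I" "rmap t \<otimes>\<^bsub>kap\<^esub> k2 = rmap a"
        using residual_imageE[OF B lin(2)] by metis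
      have k: "k1 \<in> carrier kap" "k2 \<in> carrier kap"
        using lin KE(1) L.simple_extension_in_carrier[OF KE(1) vL] by auto
      have c: "s \<in> carrier R" "t \<in> carrier R" "g \<in> carrier R" "a \<in> carrier R"
        using sg at BE(1) ext by auto
      have cL: "rmap s \<in> carrier kap" "rmap t \<in> carrier kap" "rmap g \<in> carrier kap" "rmap a \<in> carrier kap"
        using c by simp_all
      have st: "s \<otimes> t \<in> B - I" using sg(1) at(2) BE(1,6) compl_mult by blast
      \<comment> \<open>One Horner step over the common denominator \<open>s t\<close>:
        \<open>(g/s) v + a/t\<close>.\<close>
      let ?g = "(t \<otimes> g) \<otimes> v \<oplus> s \<otimes> a"
      have "t \<otimes> g \<in> simple_extension B v" using mulB at sg by blast
      hence g: "?g \<in> simple_extension B v"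
        using simple_extension.lin BE(6) sg at by blast
      have "rmap (s \<otimes> t) \<otimes>\<^bsub>kap\<^esub> (k1 \<otimes>\<^bsub>kap\<^esub> rmap v \<oplus>\<^bsub>kap\<^esub> k2) =
        (rmap t \<otimes>\<^bsub>kap\<^esub> (rmap s \<otimes>\<^bsub>kap\<^esub> k1)) \<otimes>\<^bsub>kap\<^esub> rmap v \<oplus>\<^bsub>kap\<^esub> rmap s \<otimes>\<^bsub>kap\<^esub> (rmap t \<otimes>\<^bsub>kap\<^esub> k2)"
        using c k cL vL by (simp add: L.r_distr L.m_ac)
      also have "\<dots> = rmap ?g" unfolding sg(3) at(3) using c v by simp
      finally show ?case using st g by blast
    qed
  next
    assume "\<exists>s \<in> B - I. \<exists>g \<in> simple_extension B v. rmap s \<otimes>\<^bsub>kap\<^esub> y = rmap g"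
    then obtain s g where sg: "s \<in> B - I" "g \<in> simple_extension B v" "rmap s \<otimes>\<^bsub>kap\<^esub> y = rmap g" by blast
    have "rmap g \<in> L.simple_extension (kim B) (rmap v)"
      using sg(2)
    proof (induction rule: simple_extension.induct)
      case zero show ?case by simp
    next
      case (lin k1 k2)
      have "k1 \<in> carrier R" "k2 \<in> carrier R" using lin ext BE(1) by auto
      thus ?case
        using L.simple_extension.lin[OF lin(3) rmap_mem_residual_image[OF B lin(2)]] v by simp
    qed
    moreover have sK: "rmap s \<in> kim B" "rmap s \<noteq> \<zero>\<^bsub>kap\<^esub>"
      using rmap_mem_residual_image[OF B] sg(1) res_map_zero_iff[of s] BE(1) by auto
    hence "inv\<^bsub>kap\<^esub> (rmap s) \<in> kim B" "inv\<^bsub>kap\<^esub> (rmap s) \<otimes>\<^bsub>kap\<^esub> rmap s = \<one>\<^bsub>kap\<^esub>"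
      using L.subfield_m_inv[OF K, of "rmap s"] by auto
    moreover have "kim B \<subseteq> L.simple_extension (kim B) (rmap v)" by (rule L.simple_extension_incl[OF KE(1) vL])
    ultimately have "inv\<^bsub>kap\<^esub> (rmap s) \<otimes>\<^bsub>kap\<^esub> (rmap s \<otimes>\<^bsub>kap\<^esub> y) \<in> L.simple_extension (kim B) (rmap v)"
      unfolding sg(3) using subringE(6)[OF SL] by blast
    moreover have "inv\<^bsub>kap\<^esub> (rmap s) \<otimes>\<^bsub>kap\<^esub> (rmap s \<otimes>\<^bsub>kap\<^esub> y) = y"
    proof -
      have i: "inv\<^bsub>kap\<^esub> (rmap s) \<in> carrier kap" "rmap s \<in> carrier kap"
        "inv\<^bsub>kap\<^esub> (rmap s) \<otimes>\<^bsub>kap\<^esub> rmap s = \<one>\<^bsub>kap\<^esub>"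
        using L.subfield_m_inv[OF K, of "rmap s"] sK KE(1) by auto
      show ?thesis unfolding L.m_assoc[OF i(1,2) y, symmetric] i(3) using y by simp
    qed
    ultimately show "y \<in> L.simple_extension (kim B) (rmap v)" by simp
  qed
qed

lemma sep_at_iff:
  assumes B: "subring B R" and w: "w \<in> carrier R"
  shows "sep_at R B I w \<longleftrightarrow> field.frobenius_generated kap (kim B) (rmap w)"
proof -
  interpret L: field kap by (rule residue_field_field)
  interpret H: ring_hom_ring R kap rmap by (rule res_map_hom)
  note BE = subringE[OF B]
  have "(\<exists>s \<in> B - I. \<exists>g \<in> simple_extension B (w [^] p). s \<otimes> w \<ominus> g \<in> I) \<longleftrightarrow>
      rmap w \<in> L.simple_extension (kim B) (rmap w [^]\<^bsub>kap\<^esub> p)" for p :: nat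
  proof -
    have wp: "w [^] p \<in> carrier R" using w by simp
    have "s \<otimes> w \<ominus> g \<in> I \<longleftrightarrow> rmap s \<otimes>\<^bsub>kap\<^esub> rmap w = rmap g"
      if "s \<in> B - I" "g \<in> simple_extension B (w [^] p)" for s g
      using res_map_minus[of "s \<otimes> w" g] that w BE(1) simple_extension_in_carrier[OF BE(1) wp]
      by (auto simp: subset_iff)
    hence "(\<exists>s \<in> B - I. \<exists>g \<in> simple_extension B (w [^] p). s \<otimes> w \<ominus> g \<in> I) \<longleftrightarrow>
      (\<exists>s \<in> B - I. \<exists>g \<in> simple_extension B (w [^] p). rmap s \<otimes>\<^bsub>kap\<^esub> rmap w = rmap g)" by blast
    also have "\<dots> \<longleftrightarrow> rmap w \<in> L.simple_extension (kim B) (rmap (w [^] p))"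
      using simple_extension_res_iff[OF B wp] w by simp
    finally show ?thesis using w by (simp add: H.hom_nat_pow)
  qed
  thus ?thesis unfolding sep_at_def L.frobenius_generated_def char_mem_iff by simp
qed

end

lemma (in ring) char_gcd:
  assumes "[(a::nat)] \<cdot> \<one> = \<zero>" "[(b::nat)] \<cdot> \<one> = \<zero>" "a \<noteq> 0"
  shows "[(gcd a b)] \<cdot> \<one> = \<zero>"
proof -
  obtain x y where xy: "a * x = b * y + gcd a b" using bezout_nat[OF assms(3)] by blast
  have "[(a * x)] \<cdot> \<one> = \<zero>" "[(b * y)] \<cdot> \<one> = \<zero>"
    using add_pow_dvd_zero[OF assms(1)] add_pow_dvd_zero[OF assms(2)] by auto
  thus ?thesis unfolding xy using add.nat_pow_mult[of \<one> "b * y" "gcd a b", symmetric] by simp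
qed

section \<open>The pointwise conditions define subrings and characterize the residual
  extensions\<close>

context primeideal
begin

lemma prime_char_unique:
  assumes "Factorial_Ring.prime (p::nat)" "Factorial_Ring.prime (q::nat)" "[p] \<cdot> \<one> \<in> I" "[q] \<cdot> \<one> \<in> I"
  shows "p = q"
proof (rule ccontr)
  interpret L: field kap by (rule residue_field_field)
  assume "p \<noteq> q"
  hence "gcd p q = 1" using primes_coprime[OF assms(1,2)] by (simp add: coprime_iff_gcd_eq_1)
  hence "[(1::nat)] \<cdot>\<^bsub>kap\<^esub> \<one>\<^bsub>kap\<^esub> = \<zero>\<^bsub>kap\<^esub>"
    using L.char_gcd[of p q] assms prime_gt_0_nat[OF assms(1)] unfolding char_mem_iff by simp
  thus False by simp
qed

text \<open>The leading coefficient \<open>1\<close> survives reduction modulo \<open>I\<close>, so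
  the reduced equation is nontrivial and of the same degree.\<close>

lemma integral_root:
  assumes B: "subring B R" and w: "w \<in> carrier R"
    and f: "f \<in> carrier (B[X])" "f \<noteq> []" "lead_coeff f = \<one>" "eval f w = \<zero>"
  shows "\<exists>q \<in> carrier (univ_poly kap (kim B)). q \<noteq> [] \<and> degree q = degree f \<and>
    ring.eval kap q (rmap w) = \<zero>\<^bsub>kap\<^esub>"
proof (intro bexI conjI)
  interpret L: field kap by (rule residue_field_field)
  interpret H: ring_hom_ring R kap rmap by (rule res_map_hom)
  have fB: "set f \<subseteq> B" using f(1) polynomial_incl unfolding univ_poly_carrier[symmetric] by blast
  hence fR: "set f \<subseteq> carrier R" using subringE(1)[OF B] by blast
  show "map rmap f \<noteq> []" "degree (map rmap f) = degree f" using f(2) by auto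
  show "L.eval (map rmap f) (rmap w) = \<zero>\<^bsub>kap\<^esub>"
    using H.eval_hom'[OF w fR] f(4) by simp
  have "lead_coeff (map rmap f) = \<one>\<^bsub>kap\<^esub>" using f(2,3) by (simp add: hd_map)
  thus "map rmap f \<in> carrier (univ_poly kap (kim B))"
    unfolding univ_poly_carrier[symmetric] polynomial_def
    using fB rmap_mem_residual_image[OF B] by auto
qed

lemma integral_extE:
  assumes "integral_ext (R\<lparr>carrier := B\<rparr>) R" "w \<in> carrier R"
  obtains f where "f \<in> carrier (B[X])" "f \<noteq> []" "lead_coeff f = \<one>" "eval f w = \<zero>"
  using assms unfolding integral_ext_def by auto

text \<open>Images of ring elements are algebraic by integrality. The algebraic elements form a
  field, which therefore also contains the quotients of such images.\<close>

lemma residue_algebraic: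
  assumes B: "subring B R" and int: "integral_ext (R\<lparr>carrier := B\<rparr>) R" and x: "x \<in> carrier kap"
  shows "ring.algebraic kap (kim B) x"
proof -
  interpret L: field kap by (rule residue_field_field)
  interpret H: ring_hom_ring R kap rmap by (rule res_map_hom)
  have K: "subfield (kim B) kap" by (rule residual_image_subfield[OF B])
  let ?A = "{x \<in> carrier kap. (L.algebraic over (kim B)) x}"
  have A: "subfield ?A kap" by (rule L.subfield_of_algebraics[OF K])
  have rm: "rmap w \<in> ?A" if w: "w \<in> carrier R" for w
  proof -
    obtain f where "f \<in> carrier (B[X])" "f \<noteq> []" "lead_coeff f = \<one>" "eval f w = \<zero>"
      using integral_extE[OF int w] by blast
    then obtain q where "q \<in> carrier (univ_poly kap (kim B))" "q \<noteq> []" "L.eval q (rmap w) = \<zero>\<^bsub>kap\<^esub>"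
      using integral_root[OF B w] by blast
    thus ?thesis using L.algebraicI w by auto
  qed
  obtain a s where as: "a \<in> carrier R" "s \<in> carrier R - I" "x = rmap a \<otimes>\<^bsub>kap\<^esub> inv\<^bsub>kap\<^esub> (rmap s)"
    "rmap s \<noteq> \<zero>\<^bsub>kap\<^esub>" using x by (rule residue_fieldE)
  have "inv\<^bsub>kap\<^esub> (rmap s) \<in> ?A" using L.subfield_m_inv(1)[OF A, of "rmap s"] rm[of s] as by blast
  hence "x \<in> ?A" unfolding as(3) using subringE(6)[OF subfieldE(1)[OF A]] rm[of a] as(1) by blast
  thus ?thesis unfolding over_def by blast
qed

text \<open>Sums, products, negatives and inverses of \<open>x\<close> and \<open>y\<close> stay in
  the field obtained by adjoining both, all of whose elements satisfy the criterion. Unary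
  operations use the pair \<open>x, x\<close>.\<close>

lemma frobenius_generated_subfield:
  assumes B: "subring B R" and int: "integral_ext (R\<lparr>carrier := B\<rparr>) R"
  shows "subfield {x \<in> carrier kap. field.frobenius_generated kap (kim B) x} kap" (is "subfield ?A _")
    and "kim B \<subseteq> {x \<in> carrier kap. field.frobenius_generated kap (kim B) x}"
proof -
  interpret L: field kap by (rule residue_field_field)
  have K: "subfield (kim B) kap" by (rule residual_image_subfield[OF B])
  note SK = subfieldE(1)[OF K]
  have ext: "z \<in> ?A" if "x \<in> ?A" "y \<in> ?A" "z \<in> L.finite_extension (kim B) [x, y]" for x y z
  proof -
    have "set [x, y] \<subseteq> carrier kap" using that by simp
    hence "z \<in> carrier kap" using L.finite_extension_in_carrier[OF subfieldE(3)[OF K]] that(3) by blast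
    thus ?thesis
      using L.frobenius_generated_extension[OF K _ residue_algebraic[OF B int] _ _ residue_algebraic[OF B int] _ that(3)]
        that by blast
  qed
  have E: "subfield (L.finite_extension (kim B) [x, y]) kap" "x \<in> L.finite_extension (kim B) [x, y]"
    "y \<in> L.finite_extension (kim B) [x, y]" if "x \<in> carrier kap" "y \<in> carrier kap" for x y
  proof -
    have xy: "set [x, y] \<subseteq> carrier kap" using that by simp
    show "subfield (L.finite_extension (kim B) [x, y]) kap"
      by (rule L.finite_extension_is_subfield[OF K xy])
        (use residue_algebraic[OF B int] that in \<open>auto simp: over_def\<close>)
    show "x \<in> L.finite_extension (kim B) [x, y]" "y \<in> L.finite_extension (kim B) [x, y]"
      using L.finite_extension_mem[OF SK xy] by auto
  qed
  show KA: "kim B \<subseteq> ?A"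
  proof
    fix k assume k: "k \<in> kim B"
    hence kc: "k \<in> carrier kap" using subfieldE(3)[OF K] by blast
    have "k \<in> L.simple_extension (kim B) (k [^]\<^bsub>kap\<^esub> p)" for p :: nat
      using L.simple_extension_incl[OF subfieldE(3)[OF K], of "k [^]\<^bsub>kap\<^esub> p"] k kc by auto
    thus "k \<in> ?A" using kc unfolding L.frobenius_generated_def by blast
  qed
  show "subfield ?A kap"
  proof (rule L.subfieldI'[OF L.subringI])
    show "?A \<subseteq> carrier kap" by blast
    show "\<one>\<^bsub>kap\<^esub> \<in> ?A" using KA subringE(3)[OF SK] by blast
  next
    fix x y assume xy: "x \<in> ?A" "y \<in> ?A"
    note e = E[of x y] and S = subringE[OF subfieldE(1)[OF E(1)[of x y]]]
    show "x \<otimes>\<^bsub>kap\<^esub> y \<in> ?A" by (rule ext[OF xy]) (use e S(6) xy in blast)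
    show "x \<oplus>\<^bsub>kap\<^esub> y \<in> ?A" by (rule ext[OF xy]) (use e S(7) xy in blast)
  next
    fix x assume x: "x \<in> ?A"
    note e = E[of x x] and S = subringE[OF subfieldE(1)[OF E(1)[of x x]]]
    show "\<ominus>\<^bsub>kap\<^esub> x \<in> ?A" by (rule ext[OF x x]) (use e S(5) x in blast)
  next
    fix x assume x: "x \<in> ?A - {\<zero>\<^bsub>kap\<^esub>}"
    hence xA: "x \<in> ?A" by blast
    note e = E[of x x]
    show "inv\<^bsub>kap\<^esub> x \<in> ?A"
      by (rule ext[OF xA xA]) (use L.subfield_m_inv(1)[OF e(1), of x] e x in blast)
  qed
qed

lemma preimage_subring:
  assumes "subring A kap"
  shows "subring {w \<in> carrier R. rmap w \<in> A} R"
proof -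
  interpret L: field kap by (rule residue_field_field)
  interpret H: ring_hom_ring R kap rmap by (rule res_map_hom)
  show ?thesis by (rule subringI) (use subringE[OF assms] in auto)
qed

lemma sep_at_subring:
  assumes B: "subring B R" and int: "integral_ext (R\<lparr>carrier := B\<rparr>) R"
  shows "subring {w \<in> carrier R. sep_at R B I w} R"
proof -
  interpret H: ring_hom_ring R kap rmap by (rule res_map_hom)
  have "{w \<in> carrier R. sep_at R B I w} =
      {w \<in> carrier R. rmap w \<in> {x \<in> carrier kap. field.frobenius_generated kap (kim B) x}}"
    using sep_at_iff[OF B] by auto
  thus ?thesis using preimage_subring[OF subfieldE(1)[OF frobenius_generated_subfield(1)[OF B int]]] by simp
qed

lemma t_at_subring:
  assumes B: "subring B R"
  shows "subring {w \<in> carrier R. t_at R B I w} R"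
proof -
  have "{w \<in> carrier R. t_at R B I w} = {w \<in> carrier R. rmap w \<in> kim B}"
    using t_at_iff[OF B] by auto
  thus ?thesis using preimage_subring[OF subfieldE(1)[OF residual_image_subfield[OF B]]] by simp
qed

text \<open>Two elements are raised to the common exponent \<open>?q ^ (n + m)\<close>, and
  Frobenius is additive. In characteristic \<open>0\<close> the exponent is \<open>1\<close> and
  nothing changes.\<close>

lemma inseparable_subfield:
  assumes B: "subring B R"
  shows "subfield {x \<in> carrier kap. \<exists>n::nat. x [^]\<^bsub>kap\<^esub> (char_exponent kap ^ n) \<in> kim B} kap" (is "subfield ?A _")
proof -
  interpret L: field kap by (rule residue_field_field)
  have K: "subfield (kim B) kap" by (rule residual_image_subfield[OF B])
  note KE = subringE[OF subfieldE(1)[OF K]]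
  let ?q = "char_exponent kap"
  have up: "x [^]\<^bsub>kap\<^esub> (?q ^ (n + m)) \<in> kim B" if "x \<in> carrier kap" "x [^]\<^bsub>kap\<^esub> (?q ^ n) \<in> kim B" for x n m
  proof -
    have "x [^]\<^bsub>kap\<^esub> (?q ^ (n + m)) = (x [^]\<^bsub>kap\<^esub> (?q ^ n)) [^]\<^bsub>kap\<^esub> (?q ^ m)"
      using that(1) by (simp add: L.nat_pow_pow power_add)
    thus ?thesis using L.nat_pow_mem_subring[OF subfieldE(1)[OF K] that(2)] by simp
  qed
  have add: "(x \<oplus>\<^bsub>kap\<^esub> y) [^]\<^bsub>kap\<^esub> (?q ^ n) = x [^]\<^bsub>kap\<^esub> (?q ^ n) \<oplus>\<^bsub>kap\<^esub> y [^]\<^bsub>kap\<^esub> (?q ^ n)"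
    if "x \<in> carrier kap" "y \<in> carrier kap" for x y n
    using L.char_exponent_cases L.frobenius_pow_add[of ?q x y n] that by auto
  show ?thesis
  proof (rule L.subfieldI'[OF L.subringI])
    show "?A \<subseteq> carrier kap" by blast
    show "\<one>\<^bsub>kap\<^esub> \<in> ?A" using KE(3) by simp
  next
    fix x y assume "x \<in> ?A" "y \<in> ?A"
    then obtain n m where xy: "x \<in> carrier kap" "y \<in> carrier kap"
      "x [^]\<^bsub>kap\<^esub> (?q ^ n) \<in> kim B" "y [^]\<^bsub>kap\<^esub> (?q ^ m) \<in> kim B" by blast
    have m: "x [^]\<^bsub>kap\<^esub> (?q ^ (n + m)) \<in> kim B" "y [^]\<^bsub>kap\<^esub> (?q ^ (n + m)) \<in> kim B"
      using up[OF xy(1,3)] up[OF xy(2,4), of n] by (auto simp: add.commute)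
    have "(x \<otimes>\<^bsub>kap\<^esub> y) [^]\<^bsub>kap\<^esub> (?q ^ (n + m)) \<in> kim B"
      using L.nat_pow_distrib[OF xy(1,2)] KE(6)[OF m] by simp
    thus "x \<otimes>\<^bsub>kap\<^esub> y \<in> ?A" using xy by blast
    have "(x \<oplus>\<^bsub>kap\<^esub> y) [^]\<^bsub>kap\<^esub> (?q ^ (n + m)) \<in> kim B"
      using add[OF xy(1,2)] KE(7)[OF m] by simp
    thus "x \<oplus>\<^bsub>kap\<^esub> y \<in> ?A" using xy by blast
  next
    fix x assume "x \<in> ?A"
    then obtain n where x: "x \<in> carrier kap" "x [^]\<^bsub>kap\<^esub> (?q ^ n) \<in> kim B" by blast
    \<comment> \<open>Multiplying by \<open>- 1\<close>, whose powers lie in the base field anyway,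
      avoids a distinction by the parity of the exponent.\<close>
    have "\<ominus>\<^bsub>kap\<^esub> x = \<ominus>\<^bsub>kap\<^esub> \<one>\<^bsub>kap\<^esub> \<otimes>\<^bsub>kap\<^esub> x" using x by (simp add: L.l_minus)
    hence "(\<ominus>\<^bsub>kap\<^esub> x) [^]\<^bsub>kap\<^esub> (?q ^ n) = (\<ominus>\<^bsub>kap\<^esub> \<one>\<^bsub>kap\<^esub>) [^]\<^bsub>kap\<^esub> (?q ^ n) \<otimes>\<^bsub>kap\<^esub> x [^]\<^bsub>kap\<^esub> (?q ^ n)"
      using L.nat_pow_distrib[of "\<ominus>\<^bsub>kap\<^esub> \<one>\<^bsub>kap\<^esub>" x] x by simp
    moreover have "(\<ominus>\<^bsub>kap\<^esub> \<one>\<^bsub>kap\<^esub>) [^]\<^bsub>kap\<^esub> (?q ^ n) \<in> kim B"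
      using L.nat_pow_mem_subring[OF subfieldE(1)[OF K] KE(5)[OF KE(3)]] .
    ultimately have "(\<ominus>\<^bsub>kap\<^esub> x) [^]\<^bsub>kap\<^esub> (?q ^ n) \<in> kim B" using KE(6) x(2) by simp
    thus "\<ominus>\<^bsub>kap\<^esub> x \<in> ?A" using x by blast
  next
    fix x assume "x \<in> ?A - {\<zero>\<^bsub>kap\<^esub>}"
    then obtain n where x: "x \<in> carrier kap" "x [^]\<^bsub>kap\<^esub> (?q ^ n) \<in> kim B" "x \<noteq> \<zero>\<^bsub>kap\<^esub>" by blast
    hence u: "x \<in> Units kap" using L.field_Units by blast
    let ?y = "x [^]\<^bsub>kap\<^esub> (?q ^ n)"
    have "?y \<otimes>\<^bsub>kap\<^esub> (inv\<^bsub>kap\<^esub> x) [^]\<^bsub>kap\<^esub> (?q ^ n) = \<one>\<^bsub>kap\<^esub>"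
      using L.nat_pow_distrib[of x "inv\<^bsub>kap\<^esub> x" "?q ^ n"] u x(1) by simp
    moreover have "?y \<noteq> \<zero>\<^bsub>kap\<^esub>" using L.pow_eq_zero_imp x by blast
    ultimately have "(inv\<^bsub>kap\<^esub> x) [^]\<^bsub>kap\<^esub> (?q ^ n) \<in> kim B"
      using L.subfield_m_inv_simprule[OF K, of ?y "(inv\<^bsub>kap\<^esub> x) [^]\<^bsub>kap\<^esub> (?q ^ n)"] x(2) u KE(3) by simp
    thus "inv\<^bsub>kap\<^esub> x \<in> ?A" using u by blast
  qed
qed

lemma pi_at_subring:
  assumes B: "subring B R"
  shows "subring {w \<in> carrier R. pi_at R B I w} R"
proof -
  interpret H: ring_hom_ring R kap rmap by (rule res_map_hom)
  have "{w \<in> carrier R. pi_at R B I w} = {w \<in> carrier R.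
      rmap w \<in> {x \<in> carrier kap. \<exists>n::nat. x [^]\<^bsub>kap\<^esub> (char_exponent kap ^ n) \<in> kim B}}"
    using pi_at_iff[OF B] by auto
  thus ?thesis using preimage_subring[OF subfieldE(1)[OF inseparable_subfield[OF B]]] by simp
qed

text \<open>Every element of the residue field is a quotient of images of ring elements. This is
  what reduces a condition on the whole residue field to one on the elements of the ring.\<close>

lemma subfield_eq_carrier:
  assumes A: "subfield A kap" and "\<And>w. w \<in> carrier R \<Longrightarrow> rmap w \<in> A"
  shows "A = carrier kap"
proof
  interpret L: field kap by (rule residue_field_field)
  show "A \<subseteq> carrier kap" by (rule subfieldE(3)[OF A])
  show "carrier kap \<subseteq> A"
  proof
    fix x assume "x \<in> carrier kap"
    then obtain a s where as: "a \<in> carrier R" "s \<in> carrier R - I"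
      "x = rmap a \<otimes>\<^bsub>kap\<^esub> inv\<^bsub>kap\<^esub> (rmap s)" "rmap s \<noteq> \<zero>\<^bsub>kap\<^esub>" by (rule residue_fieldE)
    have "inv\<^bsub>kap\<^esub> (rmap s) \<in> A" using L.subfield_m_inv(1)[OF A, of "rmap s"] as assms(2) by blast
    thus "x \<in> A" unfolding as(3) using subringE(6)[OF subfieldE(1)[OF A]] assms(2) as(1) by blast
  qed
qed

lemma separable_residue_iff:
  assumes B: "subring B R" and int: "integral_ext (R\<lparr>carrier := B\<rparr>) R"
  shows "separable_field_ext kap (kim B) \<longleftrightarrow> (\<forall>w \<in> carrier R. sep_at R B I w)"
proof -
  interpret L: field kap by (rule residue_field_field)
  interpret H: ring_hom_ring R kap rmap by (rule res_map_hom)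
  have K: "subfield (kim B) kap" by (rule residual_image_subfield[OF B])
  have "separable_field_ext kap (kim B) \<longleftrightarrow> (\<forall>x \<in> carrier kap. L.frobenius_generated (kim B) x)"
    unfolding separable_field_ext_def
    using L.separable_poly_Irr_iff[OF K _ residue_algebraic[OF B int]] residue_algebraic[OF B int] by blast
  also have "\<dots> \<longleftrightarrow> (\<forall>w \<in> carrier R. L.frobenius_generated (kim B) (rmap w))"
    using subfield_eq_carrier[OF frobenius_generated_subfield(1)[OF B int]] by auto
  finally show ?thesis using sep_at_iff[OF B] by blast
qed

lemma inseparable_residue_iff:
  assumes B: "subring B R"
  shows "purely_inseparable_field_ext kap (kim B) \<longleftrightarrow> (\<forall>w \<in> carrier R. pi_at R B I w)"
proof -
  interpret H: ring_hom_ring R kap rmap by (rule res_map_hom)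
  have "purely_inseparable_field_ext kap (kim B) \<longleftrightarrow>
      (\<forall>w \<in> carrier R. \<exists>n::nat. rmap w [^]\<^bsub>kap\<^esub> (char_exponent kap ^ n) \<in> kim B)"
    unfolding purely_inseparable_field_ext_def
    using subfield_eq_carrier[OF inseparable_subfield[OF B]] by auto
  thus ?thesis using pi_at_iff[OF B] by blast
qed

text \<open>The residual map is always an injective homomorphism, so only surjectivity is at
  stake.\<close>

lemma iso_residue_iff:
  assumes B: "subring B R"
  shows "residual_map (R\<lparr>carrier := B\<rparr>) R I \<in> ring_iso (residue_field (R\<lparr>carrier := B\<rparr>) (I \<inter> B)) kap \<longleftrightarrow>
    (\<forall>w \<in> carrier R. t_at R B I w)"
proof -
  interpret H: ring_hom_ring R kap rmap by (rule res_map_hom)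
  have K: "subfield (kim B) kap" by (rule residual_image_subfield[OF B])
  have "residual_map (R\<lparr>carrier := B\<rparr>) R I \<in> ring_iso (residue_field (R\<lparr>carrier := B\<rparr>) (I \<inter> B)) kap \<longleftrightarrow>
      kim B = carrier kap"
    unfolding ring_iso_def bij_betw_def residual_image_def using residual_map_inj_hom[OF B] by auto
  also have "\<dots> \<longleftrightarrow> (\<forall>w \<in> carrier R. rmap w \<in> kim B)"
  proof
    assume "kim B = carrier kap"
    thus "\<forall>w \<in> carrier R. rmap w \<in> kim B" using H.hom_closed by blast
  next
    assume "\<forall>w \<in> carrier R. rmap w \<in> kim B"
    thus "kim B = carrier kap" by (intro subfield_eq_carrier[OF K]) blast
  qed
  finally show ?thesis using t_at_iff[OF B] by blast
qed

lemma t_at_imp_pi_at: "w \<in> carrier R \<Longrightarrow> t_at R B I w \<Longrightarrow> pi_at R B I w"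
  unfolding pi_at_def by (rule exI[of _ 0]) simp

lemma t_at_imp_sep_at:
  assumes B: "subring B R" and int: "integral_ext (R\<lparr>carrier := B\<rparr>) R" and w: "w \<in> carrier R"
    and "t_at R B I w"
  shows "sep_at R B I w"
  using frobenius_generated_subfield(2)[OF B int] sep_at_iff[OF B w] t_at_iff[OF B w] assms(4) by blast

text \<open>A separable, purely inseparable element lies in the base field. With characteristic
  exponent \<open>1\<close> the power in \<open>pi_at\<close> is the element itself.\<close>

lemma sep_pi_imp_t:
  assumes B: "subring B R" and w: "w \<in> carrier R" and "sep_at R B I w" "pi_at R B I w"
  shows "t_at R B I w"
proof -
  interpret L: field kap by (rule residue_field_field)
  interpret H: ring_hom_ring R kap rmap by (rule res_map_hom)
  have K: "subfield (kim B) kap" by (rule residual_image_subfield[OF B])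
  obtain n where n: "rmap w [^]\<^bsub>kap\<^esub> (char_exponent kap ^ n) \<in> kim B"
    using assms(4) pi_at_iff[OF B w] by blast
  have "rmap w \<in> kim B"
    using L.char_exponent_cases
  proof
    assume "char_exponent kap = 1 \<and> (\<forall>n::nat. n > 0 \<longrightarrow> [n] \<cdot>\<^bsub>kap\<^esub> \<one>\<^bsub>kap\<^esub> \<noteq> \<zero>\<^bsub>kap\<^esub>)"
    thus ?thesis using n w by simp
  next
    assume "Factorial_Ring.prime (char_exponent kap) \<and> [(char_exponent kap)] \<cdot>\<^bsub>kap\<^esub> \<one>\<^bsub>kap\<^esub> = \<zero>\<^bsub>kap\<^esub>"
    thus ?thesis
      using L.frobenius_generated_inseparable[OF K _ _ _ _ n] assms(3) sep_at_iff[OF B w] w by simp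
  qed
  thus ?thesis using t_at_iff[OF B w] by blast
qed

lemma sep_at_of_degree:
  assumes B: "subring B R" and w: "w \<in> carrier R"
    and f: "f \<in> carrier (B[X])" "f \<noteq> []" "lead_coeff f = \<one>" "eval f w = \<zero>"
    and d: "[(fact (degree f) :: nat)] \<cdot> \<one> \<notin> I"
  shows "sep_at R B I w"
proof -
  interpret L: field kap by (rule residue_field_field)
  interpret H: ring_hom_ring R kap rmap by (rule res_map_hom)
  have K: "subfield (kim B) kap" by (rule residual_image_subfield[OF B])
  obtain q where q: "q \<in> carrier (univ_poly kap (kim B))" "q \<noteq> []" "degree q = degree f"
    "L.eval q (rmap w) = \<zero>\<^bsub>kap\<^esub>" using integral_root[OF B w f] by blast
  have "L.frobenius_generated (kim B) (rmap w)"
    by (rule L.frobenius_generated_of_degree[OF K _ q(1,2,4) eq_refl[OF q(3)]])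
      (use w d char_mem_iff in auto)
  thus ?thesis using sep_at_iff[OF B w] by blast
qed

text \<open>At \<open>I\<close> the prime \<open>p\<close> is the only one that
  \<open>sep_at\<close> asks about, and the hypothesis answers it with denominator
  \<open>1\<close>.\<close>

lemma sep_at_of_frobenius:
  assumes B: "subring B R" and w: "w \<in> carrier R"
    and p: "Factorial_Ring.prime (p::nat)" "[p] \<cdot> \<one> \<in> I" and "w \<in> simple_extension B (w [^] p)"
  shows "sep_at R B I w"
  unfolding sep_at_def
proof (intro allI impI)
  fix q :: nat assume "Factorial_Ring.prime q" "[q] \<cdot> \<one> \<in> I"
  hence "q = p" using prime_char_unique p by blast
  moreover have "\<one> \<in> B - I" using subringE(3)[OF B] compl_one by blast
  moreover have "\<one> \<otimes> w \<ominus> w \<in> I" using w by (simp add: a_minus_def r_neg)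
  ultimately show "\<exists>s \<in> B - I. \<exists>g \<in> simple_extension B (w [^] q). s \<otimes> w \<ominus> g \<in> I"
    using assms(5) by blast
qed

end

section \<open>Lying over\<close>

lemma (in ring) subring_restrict:
  assumes "subring B R" "subring W R" "B \<subseteq> W"
  shows "subring B (R\<lparr>carrier := W\<rparr>)"
  using ring.ring_incl_imp_subring[OF subring_is_ring[OF assms(2)], of B] subring_is_ring[OF assms(1)] assms(3)
  by simp

text \<open>Additive inverses are defined by a choice within the carrier, so unlike powers they are
  not unchanged by definition when the carrier shrinks.\<close>

lemma (in ring) a_minus_restrict:
  assumes W: "subring W R" and "a \<in> W" "b \<in> W"
  shows "a \<ominus>\<^bsub>R\<lparr>carrier := W\<rparr>\<^esub> b = a \<ominus> b"
proof -
  note WE = subringE[OF W]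
  interpret W: ring "R\<lparr>carrier := W\<rparr>" by (rule subring_is_ring[OF W])
  have "\<ominus>\<^bsub>R\<lparr>carrier := W\<rparr>\<^esub> b = \<ominus> b"
    using assms WE(1,5) by (intro W.minus_equality) (auto simp: l_neg)
  thus ?thesis by (simp add: a_minus_def)
qed

lemma nat_pow_restrict: "x [^]\<^bsub>R\<lparr>carrier := W\<rparr>\<^esub> (n::nat) = x [^]\<^bsub>R\<^esub> n"
  by (simp add: nat_pow_def)

lemma add_pow_restrict: "[(n::nat)] \<cdot>\<^bsub>R\<lparr>carrier := W\<rparr>\<^esub> x = [n] \<cdot>\<^bsub>R\<^esub> x"
  by (simp add: add_pow_def nat_pow_def)

text \<open>The ambient ring may have zero divisors here. The extension is the image of polynomials
  under evaluation, which respects sums and products.\<close>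

lemma (in cring) simple_extension_subring:
  assumes B: "subring B R" and x: "x \<in> carrier R"
  shows "subring (simple_extension B x) R"
proof -
  note BE = subringE[OF B]
  have eq: "simple_extension B x = (\<lambda>p. eval p x) ` {p. polynomial B p}"
    unfolding simple_extension_as_eval_img[OF BE(1) x] univ_poly_carrier by simp
  have incl: "B \<subseteq> simple_extension B x" by (rule simple_extension_incl[OF BE(1) x])
  have cR: "set p \<subseteq> carrier R" if "polynomial B p" for p using polynomial_in_carrier[OF B that] .
  have mult: "a \<otimes> b \<in> simple_extension B x" if ab: "a \<in> simple_extension B x" "b \<in> simple_extension B x" for a b
  proof -
    obtain p q where pq: "polynomial B p" "polynomial B q" "a = eval p x" "b = eval q x"
      using ab unfolding eq by blast
    have "a \<otimes> b = eval (poly_mult p q) x"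
      unfolding pq(3,4) by (rule eval_poly_mult[OF cR[OF pq(1)] cR[OF pq(2)] x, symmetric])
    thus ?thesis unfolding eq using poly_mult_closed[OF B pq(1,2)] by blast
  qed
  show ?thesis
  proof (rule subringI)
    show "simple_extension B x \<subseteq> carrier R" by (rule simple_extension_in_carrier[OF BE(1) x])
    show "\<one> \<in> simple_extension B x" using incl BE(3) by blast
    fix a assume a: "a \<in> simple_extension B x"
    have "\<ominus> \<one> \<otimes> a \<in> simple_extension B x" using mult[OF _ a] incl BE by blast
    moreover have "\<ominus> \<one> \<otimes> a = \<ominus> a"
      using a simple_extension_in_carrier[OF BE(1) x] by (simp add: l_minus subset_iff)
    ultimately show "\<ominus> a \<in> simple_extension B x" by simp
    fix b assume b: "b \<in> simple_extension B x"
    show "a \<otimes> b \<in> simple_extension B x" by (rule mult[OF a b])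
    obtain p q where pq: "polynomial B p" "polynomial B q" "a = eval p x" "b = eval q x" using a b unfolding eq by blast
    have "a \<oplus> b = eval (poly_add p q) x" 
      unfolding pq(3,4) by (rule eval_poly_add[OF cR[OF pq(1)] cR[OF pq(2)] x, symmetric])
    thus "a \<oplus> b \<in> simple_extension B x" unfolding eq using poly_add_closed[OF B pq(1,2)] by blast
  qed
qed

context primeideal
begin

context
  fixes B W assumes B: "subring B R" and W: "subring W R" and BW: "B \<subseteq> W"
begin

lemma t_at_restrict: "w \<in> W \<Longrightarrow> t_at (R\<lparr>carrier := W\<rparr>) B (I \<inter> W) w \<longleftrightarrow> t_at R B I w"
proof -
  assume w: "w \<in> W"
  have "s \<otimes> w \<ominus>\<^bsub>R\<lparr>carrier := W\<rparr>\<^esub> r \<in> I \<inter> W \<longleftrightarrow> s \<otimes> w \<ominus> r \<in> I" if "s \<in> B" "r \<in> B" for s r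
  proof -
    have m: "s \<otimes> w \<in> W" "r \<in> W" using that w BW subringE(6)[OF W] by blast+
    hence "s \<otimes> w \<ominus> r \<in> W" using subringE(5,7)[OF W] by (simp add: a_minus_def)
    thus ?thesis using a_minus_restrict[OF W m] by simp
  qed
  moreover have "B - (I \<inter> W) = B - I" using BW by blast
  ultimately show ?thesis unfolding t_at_def by auto
qed

text \<open>The characteristic exponent is determined by the integers \<open>n\<close> with
  \<open>n 1 \<in> I\<close>, and all multiples of \<open>1\<close> already lie in
  \<open>W\<close>.\<close>

lemma char_exponent_restrict:
  "char_exponent (residue_field (R\<lparr>carrier := W\<rparr>) (I \<inter> W)) = char_exponent (residue_field R I)"
proof -
  interpret P: primeideal "I \<inter> W" "R\<lparr>carrier := W\<rparr>" by (rule subring_prime[OF W])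
  have "[n] \<cdot> \<one> \<in> W" for n :: nat using add_pow_mem_subring[OF W subringE(3)[OF W]] .
  hence eq: "[n] \<cdot>\<^bsub>R\<lparr>carrier := W\<rparr>\<^esub> \<one>\<^bsub>R\<lparr>carrier := W\<rparr>\<^esub> \<in> I \<inter> W \<longleftrightarrow> [n] \<cdot> \<one> \<in> I" for n :: nat
    by (simp add: add_pow_restrict)
  show ?thesis unfolding char_exponent_def char_mem_iff[symmetric] P.char_mem_iff[symmetric] eq ..
qed

lemma pi_at_restrict: "w \<in> W \<Longrightarrow> pi_at (R\<lparr>carrier := W\<rparr>) B (I \<inter> W) w \<longleftrightarrow> pi_at R B I w"
  unfolding pi_at_def char_exponent_restrict nat_pow_restrict
  using t_at_restrict nat_pow_mem_subring[OF W] by blast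

lemma sep_at_restrict: "w \<in> W \<Longrightarrow> sep_at (R\<lparr>carrier := W\<rparr>) B (I \<inter> W) w \<longleftrightarrow> sep_at R B I w"
proof -
  assume w: "w \<in> W"
  have "(\<exists>s\<in>B - (I \<inter> W). \<exists>g\<in>ring.simple_extension (R\<lparr>carrier := W\<rparr>) B (w [^] p).
       s \<otimes> w \<ominus>\<^bsub>R\<lparr>carrier := W\<rparr>\<^esub> g \<in> I \<inter> W) \<longleftrightarrow>
     (\<exists>s\<in>B - I. \<exists>g\<in>simple_extension B (w [^] p). s \<otimes> w \<ominus> g \<in> I)" for p :: nat
  proof -
    have "s \<otimes> w \<ominus>\<^bsub>R\<lparr>carrier := W\<rparr>\<^esub> g \<in> I \<inter> W \<longleftrightarrow> s \<otimes> w \<ominus> g \<in> I"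
      if "s \<in> B" "g \<in> simple_extension B (w [^] p)" for s g
    proof -
      have "g \<in> W" using simple_extension_subring_incl[OF W BW nat_pow_mem_subring[OF W w]] that by blast
      moreover have "s \<otimes> w \<in> W" using that w BW subringE(6)[OF W] by blast
      moreover from calculation have "s \<otimes> w \<ominus> g \<in> W" using subringE(5,7)[OF W] by (simp add: a_minus_def)
      ultimately show ?thesis using a_minus_restrict[OF W] by simp
    qed
    moreover have "B - (I \<inter> W) = B - I" using BW by blast
    ultimately show ?thesis unfolding simple_extension_consistent[OF W] by auto
  qed
  moreover have "[n] \<cdot> \<one> \<in> W" for n :: nat using add_pow_mem_subring[OF W subringE(3)[OF W]] .
  ultimately show ?thesis unfolding sep_at_def by (simp add: add_pow_restrict nat_pow_restrict)
qed

end

end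

section \<open>Integrality of intermediate rings and the lying over theorem\<close>

context cring
begin

lemma integral_ext_restrict:
  assumes "integral_ext (R\<lparr>carrier := B\<rparr>) R" and W: "subring W R"
  shows "integral_ext (R\<lparr>carrier := B\<rparr>) (R\<lparr>carrier := W\<rparr>)"
  using assms subringE(1)[OF W] unfolding integral_ext_def univ_poly_consistent[OF W] eval_consistent[OF W]
  by auto

lemma integral_ext_mono:
  assumes "integral_ext (R\<lparr>carrier := B\<rparr>) R" "B \<subseteq> W"
  shows "integral_ext (R\<lparr>carrier := W\<rparr>) R"
proof -
  have sub: "carrier (univ_poly R B) \<subseteq> carrier (univ_poly R W)"
    using assms(2) unfolding univ_poly_def polynomial_def by auto
  show ?thesis
    unfolding integral_ext_def
  proof
    fix x assume "x \<in> carrier R"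
    then obtain f where f: "f \<in> carrier (univ_poly R B)" "f \<noteq> []" "lead_coeff f = \<one>" "eval f x = \<zero>"
      using assms(1) unfolding integral_ext_def by auto
    from f(1) sub have "f \<in> carrier (univ_poly R W)" by blast
    thus "\<exists>p \<in> carrier (univ_poly R (carrier (R\<lparr>carrier := W\<rparr>))).
        p \<noteq> [] \<and> lead_coeff p = \<one> \<and> eval p x = \<zero>"
      using f(2-4) by auto
  qed
qed

text \<open>No localization is used: \<open>Q\<close> is a maximal element among the ideals whose
  trace on \<open>W\<close> is contained in \<open>N\<close>. Maximality makes \<open>Q\<close>
  prime, and integrality makes the trace equal to \<open>N\<close>.\<close>

lemma lying_over:
  assumes W: "subring W R" and int: "integral_ext (R\<lparr>carrier := W\<rparr>) R"
    and N: "primeideal N (R\<lparr>carrier := W\<rparr>)"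
  shows "\<exists>Q. primeideal Q R \<and> Q \<inter> W = N"
proof -
  interpret N: primeideal N "R\<lparr>carrier := W\<rparr>" by (rule N)
  note WE = subringE[OF W]
  have NW: "N \<subseteq> W" using N.a_subset by simp
  let ?A = "{J. ideal J R \<and> J \<inter> W \<subseteq> N}"
  have "\<exists>Q\<in>?A. \<forall>J\<in>?A. Q \<subseteq> J \<longrightarrow> J = Q"
  proof (rule subset_Zorn_nonempty)
    have "\<zero> \<in> N" using additive_subgroup.zero_closed[OF N.additive_subgroup_axioms] by simp
    hence "{\<zero>} \<in> ?A" using zeroideal by auto
    thus "?A \<noteq> {}" by blast
  next
    fix C assume C: "C \<noteq> {}" "subset.chain ?A C"
    hence "subset.chain {J. ideal J R} C" unfolding subset_chain_def by blast
    from chain_Union_is_ideal[OF this] have "ideal (\<Union>C) R" using C(1) by simp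
    thus "\<Union>C \<in> ?A" using C(2) unfolding subset_chain_def by blast
  qed
  then obtain Q where QA: "Q \<in> ?A" and maxA: "\<forall>J\<in>?A. Q \<subseteq> J \<longrightarrow> J = Q" by (rule bexE)
  have Q: "ideal Q R" "Q \<inter> W \<subseteq> N" using QA by auto
  have max: "J = Q" if "ideal J R" "J \<inter> W \<subseteq> N" "Q \<subseteq> J" for J using maxA that by simp
  interpret Q: ideal Q R by (rule Q(1))
  \<comment> \<open>By maximality, enlarging \<open>Q\<close> by any \<open>a\<close> outside it
    produces an element of \<open>W\<close> outside \<open>N\<close>.\<close>
  have meet: "\<exists>w \<in> W - N. \<exists>q \<in> Q. \<exists>b \<in> carrier R. w = q \<oplus> b \<otimes> a" if a: "a \<in> carrier R" "a \<notin> Q" for a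
  proof (rule ccontr)
    assume no: "\<not> ?thesis"
    let ?J = "Q <+>\<^bsub>R\<^esub> PIdl\<^bsub>R\<^esub> a"
    have J: "ideal ?J R" by (rule add_ideals[OF Q(1) cgenideal_ideal[OF a(1)]])
    have "?J \<inter> W \<subseteq> N"
    proof
      fix w assume w: "w \<in> ?J \<inter> W"
      then obtain q b where "q \<in> Q" "b \<in> carrier R" "w = q \<oplus> b \<otimes> a"
        unfolding set_add_def' cgenideal_def by auto
      thus "w \<in> N" using no w by blast
    qed
    moreover have "Q \<subseteq> ?J"
    proof
      fix q assume q: "q \<in> Q"
      have "q = q \<oplus> \<zero> \<otimes> a" using q a Q.a_subset by auto
      thus "q \<in> ?J" unfolding set_add_def' cgenideal_def using q zero_closed by blast
    qed
    ultimately have "?J = Q" using max[OF J] by blast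
    moreover have "a = \<zero> \<oplus> \<one> \<otimes> a" using a by simp
    hence "a \<in> ?J" unfolding set_add_def' cgenideal_def using Q.zero_closed one_closed by blast
    ultimately show False using a by blast
  qed
  have oneQ: "\<one> \<notin> Q" using Q(2) WE(3) N.compl_one by auto
  have prime: "primeideal Q R"
  proof (rule primeidealI[OF Q(1) cring_axioms])
    show "carrier R \<noteq> Q" using oneQ by blast
    fix a b assume ab: "a \<in> carrier R" "b \<in> carrier R" "a \<otimes> b \<in> Q"
    show "a \<in> Q \<or> b \<in> Q"
    proof (rule ccontr)
      assume "\<not> (a \<in> Q \<or> b \<in> Q)"
      then obtain w q c w' q' c' where w: "w \<in> W - N" "q \<in> Q" "c \<in> carrier R" "w = q \<oplus> c \<otimes> a"
        and w': "w' \<in> W - N" "q' \<in> Q" "c' \<in> carrier R" "w' = q' \<oplus> c' \<otimes> b"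
        using meet[OF ab(1)] meet[OF ab(2)] by metis
      have qR: "q \<in> carrier R" "q' \<in> carrier R" using w w' Q.a_subset by blast+
      have "w \<otimes> w' = q \<otimes> (q' \<oplus> c' \<otimes> b) \<oplus> ((c \<otimes> a) \<otimes> q' \<oplus> (c \<otimes> c') \<otimes> (a \<otimes> b))"
        unfolding w w' using qR w(3) w'(3) ab(1,2) by algebra
      also have "\<dots> \<in> Q" using w(2,3) w'(2,3) qR ab Q.I_l_closed Q.I_r_closed by auto
      finally have "w \<otimes> w' \<in> N" using Q(2) w w' WE(6) by blast
      moreover have "w \<otimes> w' \<in> W - N" using N.compl_mult[of w w'] w w' by simp
      ultimately show False by blast
    qed
  qed
  \<comment> \<open>Integrality enters here: an \<open>n\<close> in \<open>N\<close> but not in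
    \<open>Q\<close> yields \<open>w = q + b n\<close> in \<open>W - N\<close>, and a monic equation
    for \<open>b\<close> forces a power of \<open>w\<close> into \<open>N\<close>.\<close>
  moreover have "N \<subseteq> Q"
  proof (rule ccontr)
    assume "\<not> N \<subseteq> Q"
    then obtain n where n: "n \<in> N" "n \<notin> Q" by blast
    hence nR: "n \<in> carrier R" using NW WE(1) by blast
    then obtain w q b where w: "w \<in> W - N" "q \<in> Q" "b \<in> carrier R" "w = q \<oplus> b \<otimes> n"
      using meet[OF nR n(2)] by blast
    obtain f where f: "f \<in> carrier (univ_poly R W)" "f \<noteq> []" "lead_coeff f = \<one>" "eval f b = \<zero>"
      using int w(3) unfolding integral_ext_def by auto
    have wR: "w \<in> carrier R" "q \<in> carrier R" using w WE(1) Q.a_subset by blast+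
    have nW: "n \<in> W" using n NW by blast
    have bn: "b \<otimes> n = w \<oplus> \<ominus> q" using w(4) wR w(3) nR by algebra
    txt \<open>Modulo \<open>Q\<close>, \<open>w\<close> is \<open>n b\<close>, so \<open>n\<^sup>d f(b)\<close> is congruent to a monic polynomial in \<open>w\<close>
      whose lower coefficients lie in \<open>N\<close>.\<close>
    have pw: "\<exists>u' \<in> Q. (b \<otimes> n) [^] k = w [^] k \<oplus> u'" for k :: nat
    proof (induction k)
      case 0 show ?case using Q.zero_closed by (intro bexI[of _ \<zero>]) auto
    next
      case (Suc k)
      then obtain u' where u': "u' \<in> Q" "(b \<otimes> n) [^] k = w [^] k \<oplus> u'" by blast
      have u'R: "u' \<in> carrier R" using u' Q.a_subset by blast
      have wk: "w [^] k \<in> carrier R" using wR by simp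
      have "(b \<otimes> n) [^] Suc k = (w [^] k \<oplus> u') \<otimes> (w \<oplus> \<ominus> q)" using u' bn by simp
      also have "\<dots> = w [^] k \<otimes> w \<oplus> (u' \<otimes> (w \<oplus> \<ominus> q) \<oplus> w [^] k \<otimes> (\<ominus> q))"
        using u'R wk wR by algebra
      finally have "(b \<otimes> n) [^] Suc k = w [^] Suc k \<oplus> (u' \<otimes> (w \<oplus> \<ominus> q) \<oplus> w [^] k \<otimes> (\<ominus> q))" by simp
      moreover have "u' \<otimes> (w \<oplus> \<ominus> q) \<oplus> w [^] k \<otimes> (\<ominus> q) \<in> Q"
        using u' wk wR w(2) Q.I_l_closed Q.I_r_closed by auto
      ultimately show ?case by blast
    qed
    \<comment> \<open>The exponent \<open>length g\<close> exceeds the formal degree by one, so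
      every term keeps a spare factor \<open>n\<close> and lands in \<open>N\<close> modulo
      \<open>Q\<close>.\<close>
    have key: "\<exists>v \<in> N. \<exists>u \<in> Q. n [^] length g \<otimes> eval g b = v \<oplus> u"
      if "set g \<subseteq> W" for g
      using that
    proof (induction g)
      case Nil
      have z: "\<zero> \<in> N" using additive_subgroup.zero_closed[OF N.additive_subgroup_axioms] by simp
      show ?case by (rule bexI[OF _ z], rule bexI[of _ \<zero>]) auto
    next
      case (Cons a g)
      then obtain v u where vu: "v \<in> N" "u \<in> Q" "n [^] length g \<otimes> eval g b = v \<oplus> u" by auto
      have gR: "set g \<subseteq> carrier R" "a \<in> carrier R" "a \<in> W" using Cons WE(1) by auto
      have vR: "v \<in> carrier R" "u \<in> carrier R" using vu NW WE(1) Q.a_subset by blast+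
      have eR: "eval g b \<in> carrier R" by (rule eval_in_carrier[OF gR(1) w(3)])
      let ?d = "length g"
      obtain u' where u': "u' \<in> Q" "(b \<otimes> n) [^] ?d = w [^] ?d \<oplus> u'" using pw by blast
      have u'R: "u' \<in> carrier R" using u' Q.a_subset by blast
      have nd: "n [^] ?d \<in> carrier R" "b [^] ?d \<in> carrier R" "w [^] ?d \<in> carrier R" using nR w(3) wR by auto
      have "n [^] length (a # g) \<otimes> eval (a # g) b = (n [^] ?d \<otimes> n) \<otimes> (a \<otimes> b [^] ?d \<oplus> eval g b)"
        by simp
      also have "\<dots> = (n \<otimes> a) \<otimes> (b [^] ?d \<otimes> n [^] ?d) \<oplus> n \<otimes> (n [^] ?d \<otimes> eval g b)"
        using nd nR gR(2) eR by algebra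
      also have "\<dots> = (n \<otimes> a) \<otimes> (w [^] ?d \<oplus> u') \<oplus> n \<otimes> (v \<oplus> u)"
        unfolding vu(3) using u'(2) nat_pow_distrib[OF w(3) nR] by simp
      also have "\<dots> = ((a \<otimes> w [^] ?d) \<otimes> n \<oplus> n \<otimes> v) \<oplus> ((n \<otimes> a) \<otimes> u' \<oplus> n \<otimes> u)"
        using nd nR gR u'R vR by algebra
      finally have eq: "n [^] length (a # g) \<otimes> eval (a # g) b =
        ((a \<otimes> w [^] ?d) \<otimes> n \<oplus> n \<otimes> v) \<oplus> ((n \<otimes> a) \<otimes> u' \<oplus> n \<otimes> u)" .
      have "a \<otimes> w [^] ?d \<in> W" using gR(3) nat_pow_mem_subring[OF W, of w] w(1) WE(6) by blast
      hence "(a \<otimes> w [^] ?d) \<otimes> n \<oplus> n \<otimes> v \<in> N"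
        using N.I_l_closed[OF n(1)] N.I_l_closed[OF vu(1), of n] nW
          additive_subgroup.a_closed[OF N.additive_subgroup_axioms] by simp
      moreover have "(n \<otimes> a) \<otimes> u' \<oplus> n \<otimes> u \<in> Q" using Q.I_l_closed u'(1) vu(2) nR gR by auto
      ultimately show ?case using eq by blast
    qed
    \<comment> \<open>The leading term has no spare factor \<open>n\<close>: it contributes
      \<open>w\<close> to the power \<open>length g\<close>, with coefficient
      \<open>1\<close>.\<close>
    obtain g where g: "f = \<one> # g" using f(2,3) by (cases f) auto
    have gW: "set g \<subseteq> W" using f(1) polynomial_incl unfolding g univ_poly_carrier[symmetric] by fastforce
    let ?d = "length g"
    obtain v u where vu: "v \<in> N" "u \<in> Q" "n [^] ?d \<otimes> eval g b = v \<oplus> u" using key[OF gW] by blast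
    obtain u' where u': "u' \<in> Q" "(b \<otimes> n) [^] ?d = w [^] ?d \<oplus> u'" using pw by blast
    have c: "v \<in> carrier R" "u \<in> carrier R" "u' \<in> carrier R" "w [^] ?d \<in> carrier R"
      using vu u' NW WE(1) Q.a_subset wR by auto
    have nd: "n [^] ?d \<in> carrier R" "b [^] ?d \<in> carrier R" "eval g b \<in> carrier R"
      using nR w(3) eval_in_carrier[OF _ w(3), of g] gW WE(1) by auto
    have "\<zero> = n [^] ?d \<otimes> eval f b" using f(4) nR by simp
    also have "\<dots> = (b \<otimes> n) [^] ?d \<oplus> n [^] ?d \<otimes> eval g b"
      unfolding g using nd nat_pow_distrib[OF w(3) nR, of ?d] by (simp add: r_distr m_comm)
    also have "\<dots> = (w [^] ?d \<oplus> u') \<oplus> (v \<oplus> u)" unfolding u'(2) vu(3) ..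
    finally have z: "(w [^] ?d \<oplus> u') \<oplus> (v \<oplus> u) = \<zero>" by simp
    have "w [^] ?d \<oplus> v = ((w [^] ?d \<oplus> u') \<oplus> (v \<oplus> u)) \<oplus> (\<ominus> u' \<oplus> \<ominus> u)" using c by algebra
    also have "\<dots> = \<ominus> u' \<oplus> \<ominus> u" unfolding z using c by simp
    finally have "w [^] ?d \<oplus> v \<in> Q" using u'(1) vu(2) by simp
    moreover have wd: "w [^] ?d \<in> W" using nat_pow_mem_subring[OF W] w(1) by blast
    moreover have vW: "v \<in> W" using vu NW by blast
    ultimately have "w [^] ?d \<oplus> v \<in> N" using Q(2) WE(7) by blast
    moreover have "\<ominus>\<^bsub>R\<lparr>carrier := W\<rparr>\<^esub> v \<in> N" using vu(1) by simp
    ultimately have "(w [^] ?d \<oplus> v) \<oplus> \<ominus>\<^bsub>R\<lparr>carrier := W\<rparr>\<^esub> v \<in> N"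
      using additive_subgroup.a_closed[OF N.additive_subgroup_axioms] by simp
    moreover have "(w [^] ?d \<oplus> v) \<oplus> \<ominus>\<^bsub>R\<lparr>carrier := W\<rparr>\<^esub> v = w [^] ?d"
      using a_minus_restrict[OF W, of "w [^] ?d \<oplus> v" v] wd vW WE(7) c by (simp add: a_minus_def a_assoc r_neg)
    ultimately have "w [^] ?d \<in> N" by simp
    moreover have "w [^] k \<in> W - N" for k :: nat
    proof (induction k)
      case 0 show ?case using N.compl_one by simp
    next
      case (Suc k) thus ?case using N.compl_mult[of "w [^] k" w] w(1) by simp
    qed
    ultimately show False by blast
  qed
  ultimately show ?thesis using Q(2) NW by blast
qed

end

section \<open>The three closures\<close>

text \<open>The common shape of the three closures, with \<open>P\<close> one of
  \<open>t_at\<close>, \<open>pi_at\<close>, \<open>sep_at\<close>; only primes of the top ring are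
  involved.\<close>

definition everywhere :: "('a, 'b) ring_scheme \<Rightarrow> ('a set \<Rightarrow> 'a \<Rightarrow> bool) \<Rightarrow> 'a set"
  where "everywhere S P = {w \<in> carrier S. \<forall>Q. primeideal Q S \<longrightarrow> P Q w}"

context cring
begin

lemma everywhere_subring:
  assumes "\<And>Q. primeideal Q R \<Longrightarrow> subring {w \<in> carrier R. P Q w} R"
  shows "subring (everywhere R P) R"
proof (rule subringI)
  show "everywhere R P \<subseteq> carrier R" unfolding everywhere_def by blast
  show "\<one> \<in> everywhere R P"
    using subringE(3)[OF assms] unfolding everywhere_def by simp
  fix a assume a: "a \<in> everywhere R P"
  show "\<ominus> a \<in> everywhere R P"
    using subringE(5)[OF assms, of _ a] a unfolding everywhere_def by simp
  fix b assume b: "b \<in> everywhere R P"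
  show "a \<otimes> b \<in> everywhere R P"
    using subringE(6)[OF assms, of _ a b] a b unfolding everywhere_def by simp
  show "a \<oplus> b \<in> everywhere R P"
    using subringE(7)[OF assms, of _ a b] a b unfolding everywhere_def by simp
qed

context
  fixes B assumes B: "subring B R" and int: "integral_ext (R\<lparr>carrier := B\<rparr>) R"
begin

text \<open>By lying over, the primes of \<open>W\<close> are exactly the traces of primes of the
  top ring. \<open>P'\<close> is a condition on a prime of \<open>W\<close> that can be tested
  elementwise upstairs by \<open>P\<close>.\<close>

lemma all_primes_restrict:
  assumes W: "subring W R" "B \<subseteq> W"
    and "\<And>Q. primeideal Q R \<Longrightarrow> P' (Q \<inter> W) \<longleftrightarrow> (\<forall>w \<in> W. P Q w)"
  shows "(\<forall>N. primeideal N (R\<lparr>carrier := W\<rparr>) \<longrightarrow> P' N) \<longleftrightarrow> W \<subseteq> everywhere R P"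
proof
  assume all: "\<forall>N. primeideal N (R\<lparr>carrier := W\<rparr>) \<longrightarrow> P' N"
  have "P Q w" if "primeideal Q R" "w \<in> W" for Q w
    using primeideal.subring_prime[OF that(1) W(1)] all assms(3)[OF that(1)] that(2) by blast
  thus "W \<subseteq> everywhere R P" unfolding everywhere_def using subringE(1)[OF W(1)] by blast
next
  assume sub: "W \<subseteq> everywhere R P"
  show "\<forall>N. primeideal N (R\<lparr>carrier := W\<rparr>) \<longrightarrow> P' N"
  proof (intro allI impI)
    fix N assume "primeideal N (R\<lparr>carrier := W\<rparr>)"
    then obtain Q where Q: "primeideal Q R" "Q \<inter> W = N"
      using lying_over[OF W(1) integral_ext_mono[OF int W(2)]] by blast
    have "\<forall>w \<in> W. P Q w" using sub Q(1) unfolding everywhere_def by blast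
    thus "P' N" using assms(3)[OF Q(1)] Q(2) by simp
  qed
qed

lemma kappa_separable_iff:
  assumes W: "subring W R" "B \<subseteq> W"
  shows "kappa_separable (R\<lparr>carrier := B\<rparr>) (R\<lparr>carrier := W\<rparr>) \<longleftrightarrow> W \<subseteq> everywhere R (sep_at R B)"
proof -
  have i: "integral_ext (R\<lparr>carrier := B\<rparr>) (R\<lparr>carrier := W\<rparr>)" by (rule integral_ext_restrict[OF int W(1)])
  have "separable_field_ext (residue_field (R\<lparr>carrier := W\<rparr>) (Q \<inter> W))
      (residual_image (R\<lparr>carrier := B\<rparr>) (R\<lparr>carrier := W\<rparr>) (Q \<inter> W)) \<longleftrightarrow> (\<forall>w \<in> W. sep_at R B Q w)"
    if Q: "primeideal Q R" for Q
    using primeideal.separable_residue_iff[OF primeideal.subring_prime[OF Q W(1)] subring_restrict[OF B W]]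
      i primeideal.sep_at_restrict[OF Q B W] by simp
  from all_primes_restrict[OF W, where P' = "\<lambda>N. separable_field_ext (residue_field (R\<lparr>carrier := W\<rparr>) N)
      (residual_image (R\<lparr>carrier := B\<rparr>) (R\<lparr>carrier := W\<rparr>) N)" and P = "sep_at R B", OF this]
  show ?thesis unfolding kappa_separable_def using i by simp
qed

lemma kappa_radicial_iff:
  assumes W: "subring W R" "B \<subseteq> W"
  shows "kappa_radicial (R\<lparr>carrier := B\<rparr>) (R\<lparr>carrier := W\<rparr>) \<longleftrightarrow> W \<subseteq> everywhere R (pi_at R B)"
proof -
  have i: "integral_ext (R\<lparr>carrier := B\<rparr>) (R\<lparr>carrier := W\<rparr>)" by (rule integral_ext_restrict[OF int W(1)])
  have "purely_inseparable_field_ext (residue_field (R\<lparr>carrier := W\<rparr>) (Q \<inter> W))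
      (residual_image (R\<lparr>carrier := B\<rparr>) (R\<lparr>carrier := W\<rparr>) (Q \<inter> W)) \<longleftrightarrow> (\<forall>w \<in> W. pi_at R B Q w)"
    if Q: "primeideal Q R" for Q
    using primeideal.inseparable_residue_iff[OF primeideal.subring_prime[OF Q W(1)] subring_restrict[OF B W]]
      primeideal.pi_at_restrict[OF Q B W] by simp
  from all_primes_restrict[OF W, where P' = "\<lambda>N. purely_inseparable_field_ext (residue_field (R\<lparr>carrier := W\<rparr>) N)
      (residual_image (R\<lparr>carrier := B\<rparr>) (R\<lparr>carrier := W\<rparr>) N)" and P = "pi_at R B", OF this]
  show ?thesis unfolding kappa_radicial_def using i by simp
qed

lemma infra_integral_iff:
  assumes W: "subring W R" "B \<subseteq> W"
  shows "infra_integral (R\<lparr>carrier := B\<rparr>) (R\<lparr>carrier := W\<rparr>) \<longleftrightarrow> W \<subseteq> everywhere R (t_at R B)"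
proof -
  have i: "integral_ext (R\<lparr>carrier := B\<rparr>) (R\<lparr>carrier := W\<rparr>)" by (rule integral_ext_restrict[OF int W(1)])
  have "residual_map (R\<lparr>carrier := B\<rparr>) (R\<lparr>carrier := W\<rparr>) (Q \<inter> W) \<in>
      ring_iso (residue_field (R\<lparr>carrier := B\<rparr>) ((Q \<inter> W) \<inter> B)) (residue_field (R\<lparr>carrier := W\<rparr>) (Q \<inter> W))
      \<longleftrightarrow> (\<forall>w \<in> W. t_at R B Q w)"
    if Q: "primeideal Q R" for Q
    using primeideal.iso_residue_iff[OF primeideal.subring_prime[OF Q W(1)] subring_restrict[OF B W]]
      primeideal.t_at_restrict[OF Q B W] by simp
  from all_primes_restrict[OF W, where P' = "\<lambda>N. residual_map (R\<lparr>carrier := B\<rparr>) (R\<lparr>carrier := W\<rparr>) N \<in>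
      ring_iso (residue_field (R\<lparr>carrier := B\<rparr>) (N \<inter> B)) (residue_field (R\<lparr>carrier := W\<rparr>) N)"
      and P = "t_at R B", OF this]
  show ?thesis unfolding infra_integral_def using i by simp
qed

lemma t_at_mem: "primeideal Q R \<Longrightarrow> b \<in> B \<Longrightarrow> t_at R B Q b"
  using primeideal.t_at_iff[OF _ B] primeideal.rmap_mem_residual_image[OF _ B] subringE(1)[OF B] by blast

text \<open>An intermediate ring has the property iff it is contained in one fixed intermediate
  ring. That ring is therefore the greatest, and existence, on which \<open>GREATEST\<close>
  depends, comes for free.\<close>

lemma Greatest_intermediate:
  assumes "subring (everywhere R P) R" "B \<subseteq> everywhere R P"
    and "\<And>W. subring W R \<Longrightarrow> B \<subseteq> W \<Longrightarrow> T W \<longleftrightarrow> W \<subseteq> everywhere R P"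
  shows "(GREATEST W. W \<in> intermediate_rings B R \<and> T W) = everywhere R P"
  by (rule Greatest_equality) (use assms in \<open>auto simp: intermediate_rings_def\<close>)

lemma t_closure_eq: "t_closure B R = everywhere R (t_at R B)"
  unfolding t_closure_def
proof (rule Greatest_intermediate)
  show "subring (everywhere R (t_at R B)) R"
    by (rule everywhere_subring) (rule primeideal.t_at_subring[OF _ B])
  show "B \<subseteq> everywhere R (t_at R B)"
    unfolding everywhere_def using t_at_mem subringE(1)[OF B] by blast
qed (rule infra_integral_iff)

lemma kappa_radicial_closure_eq: "kappa_radicial_closure B R = everywhere R (pi_at R B)"
  unfolding kappa_radicial_closure_def
proof (rule Greatest_intermediate)
  show "subring (everywhere R (pi_at R B)) R"
    by (rule everywhere_subring) (rule primeideal.pi_at_subring[OF _ B])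
  show "B \<subseteq> everywhere R (pi_at R B)"
  proof
    fix b assume b: "b \<in> B"
    hence bR: "b \<in> carrier R" using subringE(1)[OF B] by blast
    have "pi_at R B Q b" if "primeideal Q R" for Q
      by (rule primeideal.t_at_imp_pi_at[OF that bR t_at_mem[OF that b]])
    thus "b \<in> everywhere R (pi_at R B)" using bR unfolding everywhere_def by simp
  qed
qed (rule kappa_radicial_iff)

lemma kappa_separable_closure_eq: "kappa_separable_closure B R = everywhere R (sep_at R B)"
    and everywhere_sep_subring: "subring (everywhere R (sep_at R B)) R"
    and everywhere_sep_incl: "B \<subseteq> everywhere R (sep_at R B)"
proof -
  show sub: "subring (everywhere R (sep_at R B)) R"
    by (rule everywhere_subring) (rule primeideal.sep_at_subring[OF _ B int])
  show incl: "B \<subseteq> everywhere R (sep_at R B)"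
  proof
    fix b assume b: "b \<in> B"
    hence bR: "b \<in> carrier R" using subringE(1)[OF B] by blast
    have "sep_at R B Q b" if "primeideal Q R" for Q
      by (rule primeideal.t_at_imp_sep_at[OF that B int bR t_at_mem[OF that b]])
    thus "b \<in> everywhere R (sep_at R B)" using bR unfolding everywhere_def by simp
  qed
  show "kappa_separable_closure B R = everywhere R (sep_at R B)"
    unfolding kappa_separable_closure_def by (rule Greatest_intermediate[OF sub incl]) (rule kappa_separable_iff)
qed

lemma t_eq_sep_Int_pi:
  "everywhere R (t_at R B) = everywhere R (sep_at R B) \<inter> everywhere R (pi_at R B)"
proof -
  have "t_at R B Q w \<longleftrightarrow> sep_at R B Q w \<and> pi_at R B Q w" if "primeideal Q R" "w \<in> carrier R" for Q w
    using primeideal.t_at_imp_sep_at[OF that(1) B int that(2)] primeideal.t_at_imp_pi_at[OF that]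
      primeideal.sep_pi_imp_t[OF that(1) B that(2)] by blast
  thus ?thesis unfolding everywhere_def by auto
qed

section \<open>Multiples of powers that are separable at every prime, and radiciality\<close>

lemma multiple_sep_at:
  assumes Q: "primeideal Q R" and x: "x \<in> carrier R"
    and or: "[(m::nat)] \<cdot> \<one> \<in> Q \<or> sep_at R B Q x"
  shows "sep_at R B Q ([m] \<cdot> x)"
  using or
proof
  interpret Q: primeideal Q R by (rule Q)
  \<comment> \<open>The image of the multiple is then zero, so it lies in the base residue
    field.\<close>
  assume "[m] \<cdot> \<one> \<in> Q"
  hence "([m] \<cdot> \<one>) \<otimes> x \<in> Q" using Q.I_r_closed x by blast
  hence "[m] \<cdot> x \<in> Q" using add_pow_ldistr[OF one_closed x, of m] x by simp
  hence "res_map R Q ([m] \<cdot> x) = res_map R Q \<zero>"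
    using Q.res_map_zero_iff[of "[m] \<cdot> x"] Q.res_map_zero_iff[of \<zero>] x
      additive_subgroup.zero_closed[OF Q.additive_subgroup_axioms] by simp
  hence "t_at R B Q ([m] \<cdot> x)"
    using Q.t_at_iff[OF B] Q.rmap_mem_residual_image[OF B subringE(2)[OF B]] x by simp
  thus ?thesis using Q.t_at_imp_sep_at[OF B int] x by simp
next
  assume "sep_at R B Q x"
  thus ?thesis
    using add_pow_mem_subring[OF primeideal.sep_at_subring[OF Q B int], of x m] x by blast
qed

lemma frobenius_power_stable:
  assumes fcp: "FCP B R" and x: "x \<in> carrier R"
  shows "\<exists>n. x [^] (p ^ n) \<in> simple_extension B ((x [^] (p ^ n)) [^] (p::nat))"
proof -
  let ?E = "\<lambda>n. simple_extension B (x [^] (p ^ n))"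
  have SE: "subring (?E n) R" for n using simple_extension_subring[OF B] x by simp
  have BE: "B \<subseteq> ?E n" for n using simple_extension_incl[OF subringE(1)[OF B]] x by simp
  have anti: "?E m \<subseteq> ?E n" if "n \<le> m" for n m
  proof (rule simple_extension_subring_incl[OF SE BE])
    have "x [^] (p ^ m) = (x [^] (p ^ n)) [^] (p ^ (m - n))"
      using x that by (simp add: nat_pow_pow power_add[symmetric])
    thus "x [^] (p ^ m) \<in> ?E n"
      using nat_pow_mem_subring[OF SE simple_extension_mem[OF B]] x by simp
  qed
  have "subset.chain (intermediate_rings B R) (range ?E)"
    unfolding subset_chain_def intermediate_rings_def
  proof (intro conjI ballI)
    show "range ?E \<subseteq> {V. subring V R \<and> B \<subseteq> V}" using SE BE by blast
    fix U V assume "U \<in> range ?E" "V \<in> range ?E"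
    then obtain n m where "U = ?E n" "V = ?E m" by blast
    thus "U \<subseteq> V \<or> V \<subseteq> U" using anti[of n m] anti[of m n] by (meson linear)
  qed
  hence "finite (range ?E)" using fcp unfolding FCP_def by blast
  hence "\<not> inj ?E" using finite_imageD infinite_UNIV_nat by blast
  \<comment> \<open>Two equal members \<open>?E n = ?E m\<close> with \<open>n < m\<close> squeeze
    \<open>?E (Suc n)\<close> between them.\<close>
  then obtain a b where "?E a = ?E b" "a \<noteq> b" unfolding inj_def by blast
  then obtain n m where nm: "?E n = ?E m" "n < m" by (metis linorder_neqE_nat)
  have "x [^] (p ^ n) \<in> ?E n" using simple_extension_mem[OF B] x by simp
  hence "x [^] (p ^ n) \<in> ?E (Suc n)" using nm anti[of "Suc n" m] by auto
  moreover have "(x [^] (p ^ n)) [^] p = x [^] (p ^ Suc n)" using x by (simp add: nat_pow_pow mult.commute)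
  ultimately show ?thesis by metis
qed

lemma ex_multiple_power_mem:
  assumes fcp: "FCP B R" and x: "x \<in> carrier R" and Q: "primeideal Q R"
  shows "\<exists>n m::nat. [m] \<cdot> \<one> \<notin> Q \<and>
    [m] \<cdot> (x [^] (char_exponent (residue_field R Q) ^ n)) \<in> everywhere R (sep_at R B)"
proof -
  interpret Q: primeideal Q R by (rule Q)
  interpret L: field "residue_field R Q" by (rule Q.residue_field_field)
  let ?p = "char_exponent (residue_field R Q)"
  show ?thesis
    using L.char_exponent_cases
  proof
    assume c: "?p = 1 \<and> (\<forall>n::nat. n > 0 \<longrightarrow> [n] \<cdot>\<^bsub>residue_field R Q\<^esub> \<one>\<^bsub>residue_field R Q\<^esub> \<noteq> \<zero>\<^bsub>residue_field R Q\<^esub>)"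
    obtain f where f: "f \<in> carrier (univ_poly R B)" "f \<noteq> []" "lead_coeff f = \<one>" "eval f x = \<zero>"
      using Q.integral_extE[OF int x] by blast
    let ?m = "fact (degree f) :: nat"
    have "[?m] \<cdot> x \<in> everywhere R (sep_at R B)"
      unfolding everywhere_def
      using multiple_sep_at[OF _ x, of _ ?m] primeideal.sep_at_of_degree[OF _ B x f] x by blast
    moreover have "[?m] \<cdot> \<one> \<notin> Q" unfolding Q.char_mem_iff using c by simp
    ultimately show ?thesis using c x by (intro exI[of _ 0] exI[of _ ?m]) simp
  next
    assume "Factorial_Ring.prime ?p \<and> [?p] \<cdot>\<^bsub>residue_field R Q\<^esub> \<one>\<^bsub>residue_field R Q\<^esub> = \<zero>\<^bsub>residue_field R Q\<^esub>"
    hence p: "Factorial_Ring.prime ?p" "[?p] \<cdot> \<one> \<in> Q" unfolding Q.char_mem_iff by auto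
    obtain n where n: "x [^] (?p ^ n) \<in> simple_extension B ((x [^] (?p ^ n)) [^] ?p)"
      using frobenius_power_stable[OF fcp x] by blast
    define y where "y = x [^] (?p ^ n)"
    have y: "y \<in> carrier R" "y \<in> simple_extension B (y [^] ?p)" using x n unfolding y_def by auto
    obtain f where f: "f \<in> carrier (univ_poly R B)" "f \<noteq> []" "lead_coeff f = \<one>" "eval f y = \<zero>"
      using Q.integral_extE[OF int y(1)] by blast
    obtain a m where am: "fact (degree f) = ?p ^ a * m" "\<not> ?p dvd m"
    proof -
      have "(fact (degree f) :: nat) \<noteq> 0" by simp
      moreover have "\<not> is_unit ?p" using p(1) not_prime_unit by blast
      ultimately show ?thesis using multiplicity_decompose'[of "fact (degree f) :: nat" ?p] that by metis
    qed
    have "sep_at R B N ([m] \<cdot> y)" if N: "primeideal N R" for N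
    proof (rule multiple_sep_at[OF N y(1)])
      interpret N: primeideal N R by (rule N)
      interpret LN: field "residue_field R N" by (rule N.residue_field_field)
      show "[m] \<cdot> \<one> \<in> N \<or> sep_at R B N y"
      \<comment> \<open>If \<open>d!\<close> vanishes at \<open>N\<close>, the residue
        characteristic \<open>p'\<close> divides it. Either \<open>p' = ?p\<close>, where stability
        of the chain gives separability, or \<open>p'\<close> divides \<open>m\<close>, which then
        vanishes at \<open>N\<close>.\<close>
      proof (cases "[(fact (degree f) :: nat)] \<cdot> \<one> \<in> N")
        case True
        then obtain p' :: nat where p': "Factorial_Ring.prime p'" "p' dvd fact (degree f)" "[p'] \<cdot> \<one> \<in> N"
          using LN.ex_prime_char[of "fact (degree f)"] unfolding N.char_mem_iff by auto
        have "p' = ?p \<or> p' dvd m"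
          using p'(1,2) p(1) unfolding am(1)
          by (metis prime_dvd_mult_iff prime_dvd_power primes_dvd_imp_eq)
        thus ?thesis
        proof
          assume "p' = ?p"
          thus ?thesis using N.sep_at_of_frobenius[OF B y(1) p(1) _ y(2)] p'(3) by simp
        next
          assume "p' dvd m"
          thus ?thesis
            using LN.add_pow_dvd_zero[of p' m "\<one>\<^bsub>residue_field R N\<^esub>"] p'(3) unfolding N.char_mem_iff by simp
        qed
      next
        case False
        thus ?thesis using N.sep_at_of_degree[OF B y(1) f] by blast
      qed
    qed
    hence "[m] \<cdot> y \<in> everywhere R (sep_at R B)" unfolding everywhere_def using y(1) by simp
    \<comment> \<open>Both \<open>?p\<close> and \<open>m\<close> would vanish at \<open>Q\<close>,
      hence so would their gcd \<open>1\<close>.\<close>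
    moreover have "[m] \<cdot> \<one> \<notin> Q"
    proof
      assume "[m] \<cdot> \<one> \<in> Q"
      moreover have "gcd ?p m = 1" using prime_imp_coprime[OF p(1) am(2)] by (simp add: coprime_iff_gcd_eq_1)
      ultimately have "[(1::nat)] \<cdot>\<^bsub>residue_field R Q\<^esub> \<one>\<^bsub>residue_field R Q\<^esub> = \<zero>\<^bsub>residue_field R Q\<^esub>"
        using L.char_gcd[of ?p m] p prime_gt_0_nat[OF p(1)] unfolding Q.char_mem_iff by simp
      thus False by simp
    qed
    ultimately show ?thesis unfolding y_def by blast
  qed
qed

lemma radicial_over_separable_closure:
  assumes fcp: "FCP B R"
  shows "radicial (R\<lparr>carrier := everywhere R (sep_at R B)\<rparr>) R"
proof -
  let ?V = "everywhere R (sep_at R B)"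
  have V: "subring ?V R" by (rule everywhere_sep_subring)
  have "pi_at R ?V Q x" if Q: "primeideal Q R" and x: "x \<in> carrier R" for Q x
  proof -
    interpret Q: primeideal Q R by (rule Q)
    let ?q = "char_exponent (residue_field R Q)"
    obtain n m :: nat where nm: "[m] \<cdot> \<one> \<notin> Q" "[m] \<cdot> (x [^] (?q ^ n)) \<in> ?V"
      using ex_multiple_power_mem[OF fcp x Q] by blast
    \<comment> \<open>The witnesses for \<open>t_at\<close> are the denominator \<open>m 1\<close>
      and the numerator \<open>m x\<^sup>q\<close>, both in the closure.\<close>
    have "[m] \<cdot> \<one> \<in> ?V - Q" using nm(1) add_pow_mem_subring[OF V subringE(3)[OF V]] by blast
    moreover have "([m] \<cdot> \<one>) \<otimes> (x [^] (?q ^ n)) \<ominus> [m] \<cdot> (x [^] (?q ^ n)) \<in> Q"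
      using x by (simp add: add_pow_ldistr a_minus_def r_neg)
    ultimately show ?thesis unfolding pi_at_def t_at_def using nm(2) by blast
  qed
  hence "kappa_radicial (R\<lparr>carrier := ?V\<rparr>) R"
    unfolding kappa_radicial_def
    using integral_ext_mono[OF int everywhere_sep_incl] primeideal.inseparable_residue_iff[OF _ V] by blast
  \<comment> \<open>One inclusion suffices by symmetry; \<open>m\<close> and the exponent are chosen
    for \<open>Q2\<close>, so that \<open>m\<close> can be cancelled there.\<close>
  moreover have "Q1 \<subseteq> Q2" if Q: "primeideal Q1 R" "primeideal Q2 R" "Q1 \<inter> ?V = Q2 \<inter> ?V" for Q1 Q2
  proof
    interpret Q1: primeideal Q1 R by (rule Q)
    interpret Q2: primeideal Q2 R by (rule Q)
    interpret L: field "residue_field R Q2" by (rule Q2.residue_field_field)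
    let ?q = "char_exponent (residue_field R Q2)"
    fix x assume x: "x \<in> Q1"
    have xR: "x \<in> carrier R" using x Q1.a_subset by blast
    obtain n m :: nat where nm: "[m] \<cdot> \<one> \<notin> Q2" "[m] \<cdot> (x [^] (?q ^ n)) \<in> ?V"
      using ex_multiple_power_mem[OF fcp xR Q(2)] by blast
    \<comment> \<open>A positive exponent makes the power a multiple of \<open>x\<close>, so that it
      belongs to \<open>Q1\<close>.\<close>
    have "?q > 0" using L.char_exponent_cases prime_gt_0_nat by auto
    then obtain k where k: "?q ^ n = Suc k" by (metis gr0_conv_Suc zero_less_power)
    have "x [^] (?q ^ n) \<in> Q1" unfolding k using Q1.I_l_closed[OF x, of "x [^] k"] xR by simp
    hence "([m] \<cdot> \<one>) \<otimes> x [^] (?q ^ n) \<in> Q1" using Q1.I_l_closed by simp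
    hence "[m] \<cdot> (x [^] (?q ^ n)) \<in> Q1" using xR by (simp add: add_pow_ldistr)
    hence "[m] \<cdot> (x [^] (?q ^ n)) \<in> Q2" using nm(2) Q(3) by blast
    hence "([m] \<cdot> \<one>) \<otimes> x [^] (?q ^ n) \<in> Q2" using xR by (simp add: add_pow_ldistr)
    hence pw: "x [^] (?q ^ n) \<in> Q2" using Q2.I_prime[of "[m] \<cdot> \<one>" "x [^] (?q ^ n)"] nm(1) xR by simp
    have "x [^] j \<in> Q2 \<Longrightarrow> x \<in> Q2" for j :: nat
    proof (induction j)
      case 0 thus ?case using Q2.compl_one by simp
    next
      case (Suc j) thus ?case using Q2.I_prime[of "x [^] j" x] xR by auto
    qed
    thus "x \<in> Q2" using pw by blast
  qed
  hence "inj_on (\<lambda>Q. Q \<inter> carrier (R\<lparr>carrier := ?V\<rparr>)) {Q. primeideal Q R}"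
    by (intro inj_onI) (simp, metis subset_antisym)
  ultimately show ?thesis unfolding radicial_def by blast
qed

end

end

theorem corollary4p13:
  fixes S :: "('a, 'b) ring_scheme" and R :: "'a set"
  assumes "cring S" and "subring R S" and "R \<subset> carrier S"
    and "integral_ext (S\<lparr>carrier := R\<rparr>) S"
    and "FCP R S"
  shows "radicial (S\<lparr>carrier := kappa_separable_closure R S\<rparr>) S \<and>
    t_closure R S = kappa_separable_closure R S \<inter> kappa_radicial_closure R S"
proof -
  interpret cring S by (rule assms(1))
  note [simp] = t_closure_eq[OF assms(2,4)] kappa_separable_closure_eq[OF assms(2,4)]
    kappa_radicial_closure_eq[OF assms(2,4)]
  show ?thesis
    using radicial_over_separable_closure[OF assms(2,4,5)] t_eq_sep_Int_pi[OF assms(2,4)] by simp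
qed

end
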